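(* Let $p>0$ and let $u:\mathbb{R}^4\to\mathbb{R}$ be a solution to $\Delta^2 u=(1-|x|^p)e^{4u}$ in $\mathbb{R}^4$ such that $(1-|y|^p)e^{4u}\in L^1(\mathbb{R}^4)$, and let $$v(x):=\frac{1}{8\pi^2}\int_{\mathbb{R}^4}\log\left(\frac{|y|}{|x-y|}\right)(1-|y|^p)e^{4u(y)}\,dy.$$ Then $u=v+P$ where $P$ is a polynomial of degree at most $2$. Moreover there is a constant $C$ such that $$\Delta u(x)=-\frac{1}{4\pi^2}\int_{\mathbb{R}^4}\frac{1}{|x-y|^2}(1-|y|^p)e^{4u(y)}\,dy+C\quad\text{for all }x\in\mathbb{R}^4.$$ *)

theory Defs
  imports "HOL-Analysis.Analysis"
begin

definition pdiff :: "4 \<Rightarrow> (real^4 \<Rightarrow> real) \<Rightarrow> real^4 \<Rightarrow> real" where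
  "pdiff i f x = deriv (\<lambda>t. f (x + t *\<^sub>R axis i 1)) 0"

fun Ck :: "nat \<Rightarrow> (real^4 \<Rightarrow> real) \<Rightarrow> bool" where
  "Ck 0 f = continuous_on UNIV f"
| "Ck (Suc k) f = (continuous_on UNIV f \<and>
      (\<forall>i x. (\<lambda>t. f (x + t *\<^sub>R axis i 1)) differentiable (at 0)) \<and>
      (\<forall>i. Ck k (pdiff i f)))"

definition laplacian :: "(real^4 \<Rightarrow> real) \<Rightarrow> real^4 \<Rightarrow> real" where
  "laplacian f x = (\<Sum>i\<in>UNIV. pdiff i (pdiff i f) x)"

definition poly_deg_le2 :: "(real^4 \<Rightarrow> real) \<Rightarrow> bool" where
  "poly_deg_le2 P \<longleftrightarrow> (\<exists>(c::real) (b::real^4) (A::real^4^4).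
      \<forall>x. P x = c + b \<bullet> x + x \<bullet> (A *v x))"

end

theory Submission
  imports Defs
begin

text \<open>
  Write \<open>s = |x - y|\<^sup>2\<close> and \<open>q = max 0 (1 - s / a)\<close>. On \<open>\<real>\<^sup>4\<close> a radial function \<open>F s\<close> has Laplacian
  \<open>8 F' + 4 s F''\<close>; hence \<open>q\<^sup>n / s\<close> and \<open>- ln (1 - q) - (q + \<dots> + q\<^sup>n / n)\<close> are compactly supported
  parametrices of the Laplacian and of its square, with remainders that are polynomials in \<open>q\<close>.
  For every \<open>a > 0\<close> they represent \<open>u x\<close> (and \<open>laplacian u x\<close>) as a truncated potential of the
  right-hand side plus an integral of \<open>u\<close> against a rescaled \<open>C\<^sup>2\<close> kernel of size \<open>a\<close>.

  As \<open>a\<close> tends to infinity the truncated potentials converge, up to additive constants, to those in the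
  statement. A nonnegative combination of the kernels, together with \<open>u \<le> exp (4 u)\<close>, bounds the
  integral of \<open>|u|\<close> over the ball of radius \<open>R\<close> by \<open>C R\<^sup>6\<close>. Expanding the kernel to second order in \<open>x\<close>, the third-order
  error is \<open>O(1 / R)\<close>, so \<open>u\<close> minus the potential is a pointwise limit of quadratic polynomials. The same bound
  makes the remainder in the representation of the Laplacian asymptotically constant in \<open>x\<close>.
\<close>

text \<open>The potential \<open>v\<close> is never differentiated and no Liouville theorem is
  applied to \<open>u - v\<close>: every identity is about \<open>u\<close> itself, and the
  potentials appear only as limits of truncated ones. The singularities cost no boundary terms,
  because Green's identity is used for the difference of kernels at two scales, where the singular
  parts cancel; the inner scale then shrinks to a point. The obstacle is that \<open>u\<close> has
  no a priori lower bound: the finite integral of \<open>exp (4 * u y)\<close> controls it only from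
  above. The negative part is reached through the signed integral of \<open>u\<close> against one
  nonnegative kernel, which the values of \<open>u\<close> and its Laplacian at the origin and the
  right-hand side determine. The growth exponent 6 is that of a quadratic polynomial integrated over
  a ball in dimension four, and it is just affordable: with \<open>a = R ^ 2\<close>, the prefactor
  \<open>1 / R ^ 4\<close>, the Taylor error \<open>(norm x / R) ^ 3\<close> and the mass
  \<open>R ^ 6\<close> multiply to order \<open>1 / R\<close>. For the Laplacian the prefactor is
  \<open>1 / R ^ 6\<close>, so a Lipschitz bound suffices.\<close>

section \<open>Integration by parts for compactly supported functions\<close>

lemma lborel_integral_translate:
  fixes f :: "'a::euclidean_space \<Rightarrow> real"
  assumes [measurable]: "f \<in> borel_measurable borel"
  shows "(\<integral>y. f (y + c) \<partial>lborel) = (\<integral>y. f y \<partial>lborel)"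
proof -
  have "(\<integral>y. f y \<partial>lborel) = (\<integral>y. f y \<partial>distr lborel borel ((+) c))"
    by (simp add: lborel_distr_plus)
  also have "\<dots> = (\<integral>y. f (c + y) \<partial>lborel)"
    by (subst integral_distr) auto
  finally show ?thesis by (simp add: add.commute)
qed

lemma integrable_compact_support:
  fixes f :: "'a::euclidean_space \<Rightarrow> real"
  assumes "continuous_on UNIV f" "\<And>y. norm (y - x) > r \<Longrightarrow> f y = 0"
  shows "integrable lborel f"
proof -
  have "integrable lborel (\<lambda>y. indicator (cball x r) y *\<^sub>R f y)"
    by (rule borel_integrable_compact) (auto intro: continuous_on_subset[OF assms(1)])
  moreover have "(\<lambda>y. indicator (cball x r) y *\<^sub>R f y) = f"
    using assms(2) by (force simp: indicator_def dist_norm norm_minus_commute)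
  ultimately show ?thesis by simp
qed

text \<open>One directional derivative, existing everywhere and continuous, is what
  \<open>Ck\<close> supplies through \<open>pdiff\<close>. Continuity of both functions is bundled
  in because it yields measurability and integrability on compact sets.\<close>

definition has_partial :: "'a::euclidean_space \<Rightarrow> ('a \<Rightarrow> real) \<Rightarrow> ('a \<Rightarrow> real) \<Rightarrow> bool" where
  "has_partial e f f' \<longleftrightarrow> continuous_on UNIV f \<and> continuous_on UNIV f' \<and>
     (\<forall>x. ((\<lambda>t. f (x + t *\<^sub>R e)) has_real_derivative f' x) (at 0))"

lemma has_partial_line:
  assumes "has_partial e f f'"
  shows "((\<lambda>t. f (x + t *\<^sub>R e)) has_real_derivative f' (x + s *\<^sub>R e)) (at s)"
proof -
  have "((\<lambda>t. f (x + s *\<^sub>R e + t *\<^sub>R e)) has_real_derivative f' (x + s *\<^sub>R e)) (at 0)"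
    using assms by (simp add: has_partial_def)
  then have "((\<lambda>t. f (x + (t + s) *\<^sub>R e)) has_real_derivative f' (x + s *\<^sub>R e)) (at 0)"
    by (simp add: algebra_simps)
  then show ?thesis
    using DERIV_shift[of "\<lambda>t. f (x + t *\<^sub>R e)" _ 0 s] by simp
qed

lemma has_partial_mult:
  assumes "has_partial e f f'" "has_partial e g g'"
  shows "has_partial e (\<lambda>x. f x * g x) (\<lambda>x. f' x * g x + f x * g' x)"
  using assms unfolding has_partial_def
  by (auto intro!: continuous_intros derivative_eq_intros simp: algebra_simps)

lemma has_partial_zero_outside:
  assumes "has_partial e f f'" "\<And>y. norm (y - x) > r \<Longrightarrow> f y = 0" "norm (y - x) > r"
  shows "f' y = 0"
proof -
  have "eventually (\<lambda>t::real. norm (y + t *\<^sub>R e - x) > r) (at 0)"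
    by (rule order_tendstoD(1)[of _ "norm (y - x)"]) (use assms(3) in \<open>auto intro!: tendsto_eq_intros\<close>)
  then have ev: "eventually (\<lambda>t::real. f (y + t *\<^sub>R e) = 0) (at 0)"
    by eventually_elim (rule assms(2))
  have "((\<lambda>t. f (y + t *\<^sub>R e)) has_real_derivative f' y) (at 0)"
    using assms(1) by (simp add: has_partial_def)
  moreover have "((\<lambda>t. f (y + t *\<^sub>R e)) has_real_derivative 0) (at 0)"
    by (subst has_field_derivative_cong_eventually[OF ev]) (use assms(2,3) in auto)
  ultimately show ?thesis by (rule DERIV_unique)
qed

text \<open>Difference quotients of \<open>f\<close> along \<open>e\<close> have integral zero by
  translation invariance. The mean value theorem bounds them uniformly, so dominated convergence
  carries this over to the derivative, without Fubini along lines.\<close>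

lemma integral_partial_zero:
  assumes f: "has_partial e f f'" and supp: "\<And>y. norm (y - x) > r \<Longrightarrow> f y = 0"
  shows "(\<integral>y. f' y \<partial>lborel) = 0"
proof -
  have cf: "continuous_on UNIV f" and cf': "continuous_on UNIV f'"
    using f by (auto simp: has_partial_def)
  have [measurable]: "f \<in> borel_measurable borel" "f' \<in> borel_measurable borel"
    using cf cf' by (auto intro: borel_measurable_continuous_onI)
  have supp': "f' y = 0" if "norm (y - x) > r" for y
    using has_partial_zero_outside[OF f supp that] .
  have "bounded (f' ` cball x r)"
    by (intro compact_imp_bounded compact_continuous_image continuous_on_subset[OF cf']) auto
  then obtain B0 where B0: "\<And>y. y \<in> cball x r \<Longrightarrow> \<bar>f' y\<bar> \<le> B0"
    unfolding bounded_iff by (metis imageI real_norm_def)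
  define B where "B = max 0 B0"
  have B: "\<bar>f' y\<bar> \<le> B" for y
    using B0[of y] supp'[of y] unfolding B_def
    by (cases "norm (y - x) > r") (auto simp: dist_norm norm_minus_commute)
  define t where "t k = inverse (real (Suc k))" for k
  have t: "t k > 0" "t k \<le> 1" for k by (auto simp: t_def field_simps)
  have t0: "t \<longlonglongrightarrow> 0" unfolding t_def by (rule LIMSEQ_inverse_real_of_nat)
  define s where "s k y = (f (y + t k *\<^sub>R e) - f y) / t k" for k y
  have [measurable]: "s k \<in> borel_measurable borel" for k
    unfolding s_def by measurable
  have int: "integrable lborel (\<lambda>y. f (y + c))" for c
    by (rule integrable_compact_support[of _ "r + norm c" x])
       (auto intro!: continuous_intros continuous_on_compose2[OF cf] supp,
         smt (verit) add_diff_cancel_right' add_diff_eq norm_triangle_ineq4 diff_add_eq)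
  have "(\<integral>y. s k y \<partial>lborel) = 0" for k
    unfolding s_def using int[of "t k *\<^sub>R e"] int[of 0]
    by (simp add: lborel_integral_translate)
  moreover have "(\<lambda>k. \<integral>y. s k y \<partial>lborel) \<longlonglongrightarrow> (\<integral>y. f' y \<partial>lborel)"
  proof (rule integral_dominated_convergence)
    \<comment> \<open>The steps \<open>t k\<close> are at most 1, so all quotients vanish outside
      the ball enlarged by \<open>norm e\<close>.\<close>
    show "integrable lborel (\<lambda>y. indicator (cball x (r + norm e)) y * B)"
      by (auto intro!: integrable_mult_left emeasure_compact_finite)
    show "AE y in lborel. (\<lambda>k. s k y) \<longlonglongrightarrow> f' y"
    proof (rule AE_I2)
      fix y
      have "((\<lambda>t. f (y + t *\<^sub>R e)) has_real_derivative f' y) (at 0)"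
        using f by (simp add: has_partial_def)
      then have "((\<lambda>h. (f (y + h *\<^sub>R e) - f y) / h) \<longlongrightarrow> f' y) (at 0)"
        by (simp add: DERIV_def)
      then show "(\<lambda>k. s k y) \<longlonglongrightarrow> f' y"
        unfolding s_def
        by (rule filterlim_compose) (use t0 t in \<open>auto simp: filterlim_at order_less_imp_not_eq2\<close>)
    qed
    show "AE y in lborel. norm (s k y) \<le> indicator (cball x (r + norm e)) y * B" for k
    proof (rule AE_I2)
      fix y
      show "norm (s k y) \<le> indicator (cball x (r + norm e)) y * B"
      proof (cases "y \<in> cball x (r + norm e)")
        case True
        obtain z where "f (y + t k *\<^sub>R e) - f (y + 0 *\<^sub>R e) = (t k - 0) * f' (y + z *\<^sub>R e)"
          using MVT2[of 0 "t k" "\<lambda>t. f (y + t *\<^sub>R e)" "\<lambda>s. f' (y + s *\<^sub>R e)"]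
            has_partial_line[OF f] t[of k] by blast
        then have "s k y = f' (y + z *\<^sub>R e)"
          using t[of k] by (simp add: s_def field_simps)
        then show ?thesis using True B by simp
      next
        case False
        then have 1: "norm (y - x) > r + norm e" by (simp add: dist_norm norm_minus_commute)
        have "norm (y + t k *\<^sub>R e - x) \<ge> norm (y - x) - norm (t k *\<^sub>R e)"
          by (metis add_diff_eq diff_add_eq norm_diff_ineq)
        moreover have "norm (t k *\<^sub>R e) \<le> norm e"
          using t[of k] by (simp add: mult_left_le_one_le)
        ultimately have "f (y + t k *\<^sub>R e) = 0"
          using 1 by (intro supp) linarith
        moreover have "f y = 0"
          using 1 norm_ge_zero[of e] by (intro supp) linarith
        ultimately show ?thesis using False by (simp add: s_def)
      qed
    qed
  qed simp_all
  ultimately show ?thesis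
    using LIMSEQ_unique[of "\<lambda>k. 0::real" 0] by auto
qed

lemma integral_by_parts:
  assumes f: "has_partial e f f'" and g: "has_partial e g g'"
    and supp: "\<And>y. norm (y - x) > r \<Longrightarrow> f y = 0"
  shows "(\<integral>y. f y * g' y \<partial>lborel) = - (\<integral>y. f' y * g y \<partial>lborel)"
proof -
  have c: "continuous_on UNIV f" "continuous_on UNIV f'" "continuous_on UNIV g" "continuous_on UNIV g'"
    using f g by (auto simp: has_partial_def)
  have i: "integrable lborel (\<lambda>y. f y * g' y)" "integrable lborel (\<lambda>y. f' y * g y)"
    using has_partial_zero_outside[OF f supp] supp
    by (auto intro!: integrable_compact_support[of _ r x] continuous_intros c)
  have "(\<integral>y. f' y * g y + f y * g' y \<partial>lborel) = 0"
    by (rule integral_partial_zero[OF has_partial_mult[OF f g], of r x]) (simp add: supp)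
  then show ?thesis using i by simp
qed

section \<open>The class \<open>Ck\<close> and the Laplacian\<close>

lemma Ck_SucD: "Ck (Suc k) f \<Longrightarrow> Ck k f"
  by (induction k arbitrary: f) auto

lemma Ck_le: "Ck m f \<Longrightarrow> k \<le> m \<Longrightarrow> Ck k f"
  by (induction m) (auto simp: le_Suc_eq dest: Ck_SucD simp del: Ck.simps)

lemma Ck_continuous: "Ck k f \<Longrightarrow> continuous_on UNIV f"
  by (cases k) auto

lemma Ck_has_partial:
  assumes "Ck (Suc k) f"
  shows "has_partial (axis i 1) f (pdiff i f)"
proof -
  have "((\<lambda>t. f (x + t *\<^sub>R axis i 1)) has_real_derivative pdiff i f x) (at 0)" for x
    using assms by (simp add: pdiff_def DERIV_deriv_iff_real_differentiable)
  moreover have "continuous_on UNIV (pdiff i f)"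
    using assms by (auto intro: Ck_continuous)
  ultimately show ?thesis
    using assms by (simp add: has_partial_def)
qed

lemma Ck_add: "Ck k f \<Longrightarrow> Ck k g \<Longrightarrow> Ck k (\<lambda>x. f x + g x)"
proof (induction k arbitrary: f g)
  case (Suc k)
  have "pdiff i (\<lambda>x. f x + g x) = (\<lambda>x. pdiff i f x + pdiff i g x)" for i
    using Suc.prems[THEN Ck_has_partial, of i] unfolding has_partial_def
    by (auto simp: pdiff_def[of i "\<lambda>x. f x + g x"] fun_eq_iff intro!: DERIV_imp_deriv derivative_intros)
  then show ?case using Suc by (auto intro!: continuous_intros)
qed (auto intro!: continuous_intros)

lemma Ck_sum: "finite A \<Longrightarrow> (\<And>a. a \<in> A \<Longrightarrow> Ck k (f a)) \<Longrightarrow> Ck k (\<lambda>x. \<Sum>a\<in>A. f a x)"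
proof (induction A rule: finite_induct)
  case empty
  have "Ck k (\<lambda>x. 0)"
    by (induction k) (auto simp: pdiff_def[abs_def])
  then show ?case by simp
qed (auto intro: Ck_add)

lemma Ck_laplacian: "Ck (Suc (Suc k)) f \<Longrightarrow> Ck k (laplacian f)"
  unfolding laplacian_def[abs_def] by (rule Ck_sum) auto

section \<open>Green's identity for radial kernels\<close>

lemma has_partial_radial:
  fixes x :: "real^4"
  assumes F: "\<And>s. (F has_real_derivative F' s) (at s)" and F': "continuous_on UNIV F'"
  shows "has_partial (axis i 1) (\<lambda>y. F ((norm (x - y))\<^sup>2)) (\<lambda>y. F' ((norm (x - y))\<^sup>2) * (2 * (y - x) $ i))"
  unfolding has_partial_def
proof (intro conjI allI)
  have cF: "continuous_on UNIV F" using F by (auto intro!: DERIV_continuous_on)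
  show "continuous_on UNIV (\<lambda>y. F ((norm (x - y))\<^sup>2))"
    by (intro continuous_on_compose2[OF cF] continuous_intros) auto
  show "continuous_on UNIV (\<lambda>y. F' ((norm (x - y))\<^sup>2) * (2 * (y - x) $ i))"
    by (intro continuous_on_compose2[OF F'] continuous_intros) auto
next
  fix y
  have "((\<lambda>t. (norm (x - (y + t *\<^sub>R axis i 1)))\<^sup>2) has_real_derivative 2 * (y - x) $ i) (at 0)"
    unfolding power2_norm_eq_inner
    by (auto intro!: derivative_eq_intros simp: inner_simps inner_axis has_real_derivative_iff_has_vector_derivative
      inner_commute has_vector_derivative_def inner_axis' algebra_simps)
  from DERIV_chain2[OF _ this, of F] F
  show "((\<lambda>t. F ((norm (x - (y + t *\<^sub>R axis i 1)))\<^sup>2)) has_real_derivative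
          F' ((norm (x - y))\<^sup>2) * (2 * (y - x) $ i)) (at 0)" by auto
qed

text \<open>Two integrations by parts per coordinate move the Laplacian onto the kernel, whose
  compact support removes boundary terms. Each second partial is \<open>4 * F''\<close> times a
  squared coordinate of \<open>y - x\<close>, plus \<open>2 * F'\<close>; four of the latter make
  the 8.\<close>

lemma radial_green:
  fixes x :: "real^4"
  assumes F: "\<And>s. (F has_real_derivative F' s) (at s)" "\<And>s. (F' has_real_derivative F'' s) (at s)"
    and F'': "continuous_on UNIV F''" and supp: "\<And>s. s > a \<Longrightarrow> F s = 0" and a: "a \<ge> 0"
    and g: "Ck 2 g"
  shows "(\<integral>y. F ((norm (x - y))\<^sup>2) * laplacian g y \<partial>lborel) =
    (\<integral>y. (8 * F' ((norm (x - y))\<^sup>2) + 4 * (norm (x - y))\<^sup>2 * F'' ((norm (x - y))\<^sup>2)) * g y \<partial>lborel)"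
proof -
  define f where "f y = F ((norm (x - y))\<^sup>2)" for y
  define f1 where "f1 i y = F' ((norm (x - y))\<^sup>2) * (2 * (y - x) $ i)" for i y
  define f2 where "f2 i y = F'' ((norm (x - y))\<^sup>2) * (2 * (y - x) $ i) * (2 * (y - x) $ i) + F' ((norm (x - y))\<^sup>2) * 2" for i y
  have cF': "continuous_on UNIV F'" using F(2) by (auto intro!: DERIV_continuous_on)
  have p1: "has_partial (axis i 1) f (f1 i)" for i
    unfolding f_def[abs_def] f1_def[abs_def] by (rule has_partial_radial[OF F(1) cF'])
  have lin: "has_partial (axis i 1) (\<lambda>y. 2 * (y - x) $ i) (\<lambda>y. 2)" for i
    unfolding has_partial_def
    by (auto intro!: continuous_intros derivative_eq_intros)
  have p2: "has_partial (axis i 1) (f1 i) (f2 i)" for i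
    unfolding f2_def[abs_def] f1_def[abs_def]
    by (rule has_partial_mult[OF has_partial_radial[OF F(2) F''] lin])
  have s0: "f y = 0" if "norm (y - x) > sqrt a" for y
    unfolding f_def using that a
    by (intro supp) (metis norm_minus_commute real_less_lsqrt norm_ge_zero real_sqrt_less_iff real_sqrt_unique
        linorder_not_less real_sqrt_le_iff real_sqrt_abs abs_norm_cancel)
  have s1: "f1 i y = 0" if "norm (y - x) > sqrt a" for y i
    using has_partial_zero_outside[OF p1 s0 that] .
  have s2: "f2 i y = 0" if "norm (y - x) > sqrt a" for y i
    using has_partial_zero_outside[OF p2 s1 that] .
  have g1: "has_partial (axis i 1) g (pdiff i g)" for i
    using g by (intro Ck_has_partial[of 1]) (simp add: numeral_2_eq_2)
  have g2: "has_partial (axis i 1) (pdiff i g) (pdiff i (pdiff i g))" for i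
    using g by (intro Ck_has_partial[of 0]) (simp add: numeral_2_eq_2)
  have c: "continuous_on UNIV f" "continuous_on UNIV (f2 i)" "continuous_on UNIV g"
    "continuous_on UNIV (pdiff i (pdiff i g))" for i
    using p1 p2 g1 g2 by (auto simp: has_partial_def)
  have int: "integrable lborel (\<lambda>y. f y * pdiff i (pdiff i g) y)" "integrable lborel (\<lambda>y. f2 i y * g y)" for i
    by (auto intro!: integrable_compact_support[of _ "sqrt a" x] continuous_intros c simp: s0 s2)
  have "(\<integral>y. f y * laplacian g y \<partial>lborel) = (\<Sum>i\<in>UNIV. \<integral>y. f y * pdiff i (pdiff i g) y \<partial>lborel)"
    unfolding laplacian_def sum_distrib_left by (rule Bochner_Integration.integral_sum) (rule int)
  also have "\<dots> = (\<Sum>i\<in>UNIV. \<integral>y. f2 i y * g y \<partial>lborel)"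
    using integral_by_parts[OF p1 g2 s0] integral_by_parts[OF p2 g1 s1] by simp
  also have "\<dots> = (\<integral>y. (\<Sum>i\<in>UNIV. f2 i y * g y) \<partial>lborel)"
    by (rule Bochner_Integration.integral_sum[symmetric]) (rule int)
  also have "(\<lambda>y. \<Sum>i\<in>UNIV. f2 i y * g y) =
      (\<lambda>y. (8 * F' ((norm (x - y))\<^sup>2) + 4 * (norm (x - y))\<^sup>2 * F'' ((norm (x - y))\<^sup>2)) * g y)"
  proof
    fix y
    have "(norm (x - y))\<^sup>2 = (\<Sum>i\<in>UNIV. (y - x) $ i * (y - x) $ i)"
      unfolding norm_minus_commute[of x y] by (simp add: power2_norm_eq_inner inner_vec_def)
    moreover have "f2 i y = 4 * F'' ((norm (x - y))\<^sup>2) * ((y - x) $ i * (y - x) $ i) + 2 * F' ((norm (x - y))\<^sup>2)" for i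
      by (simp add: f2_def algebra_simps)
    ultimately have "(\<Sum>i\<in>UNIV. f2 i y) = 8 * F' ((norm (x - y))\<^sup>2) + 4 * (norm (x - y))\<^sup>2 * F'' ((norm (x - y))\<^sup>2)"
      by (simp add: sum.distrib flip: sum_distrib_left)
    then show "(\<Sum>i\<in>UNIV. f2 i y * g y) = (8 * F' ((norm (x - y))\<^sup>2) + 4 * (norm (x - y))\<^sup>2 * F'' ((norm (x - y))\<^sup>2)) * g y"
      by (simp flip: sum_distrib_right)
  qed
  finally show ?thesis by (simp add: f_def)
qed

lemma AE_norm_diff_pos: "AE y in lborel. norm (x - y :: real^4) > 0"
  using AE_lborel_singleton[of x] by eventually_elim auto

text \<open>The value \<open>s = 0\<close> is met only at \<open>y = x\<close>, a null set.
  Replacing \<open>F\<close> below \<open>b\<close> by the polynomial it equals there yields a C2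
  function on the whole line, to which \<open>radial_green\<close> applies.\<close>

lemma radial_green_punctured:
  fixes x :: "real^4"
  assumes F: "\<And>s. s > 0 \<Longrightarrow> (F has_real_derivative F' s) (at s)"
    "\<And>s. s > 0 \<Longrightarrow> (F' has_real_derivative F'' s) (at s)"
    and F'': "continuous_on {0<..} F''" and supp: "\<And>s. s > a \<Longrightarrow> F s = 0" and a: "b \<le> a"
    and b: "b > 0" and p: "\<And>s. 0 < s \<Longrightarrow> s < b \<Longrightarrow> F s = poly p s"
    and g: "Ck 2 g"
  shows "(\<integral>y. F ((norm (x - y))\<^sup>2) * laplacian g y \<partial>lborel) =
    (\<integral>y. (8 * F' ((norm (x - y))\<^sup>2) + 4 * (norm (x - y))\<^sup>2 * F'' ((norm (x - y))\<^sup>2)) * g y \<partial>lborel)"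
proof -
  define G where "G s = (if s < b then poly p s else F s)" for s
  define G' where "G' s = (if s < b then poly (pderiv p) s else F' s)" for s
  define G'' where "G'' s = (if s < b then poly (pderiv (pderiv p)) s else F'' s)" for s
  have near: "(f has_real_derivative D) (at s)"
    if "(h has_real_derivative D) (at s)" "open S" "s \<in> S" "\<And>t. t \<in> S \<Longrightarrow> f t = h t" for f h :: "real \<Rightarrow> real" and D s S
    using has_field_derivative_transform_within_open[OF that(1-3), of f] that(4) by auto
  have p': "F' s = poly (pderiv p) s" if "0 < s" "s < b" for s
    by (rule DERIV_unique[OF _ near[of "poly p" _ s "{0<..<b}" F]])
      (use that in \<open>auto intro: F p poly_DERIV\<close>)
  have p'': "F'' s = poly (pderiv (pderiv p)) s" if "0 < s" "s < b" for s
    by (rule DERIV_unique[OF _ near[of "poly (pderiv p)" _ s "{0<..<b}" F']])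
      (use that in \<open>auto intro: F p' poly_DERIV\<close>)
  have eq: "G s = F s" "G' s = F' s" "G'' s = F'' s" if "s > 0" for s
    using that p p' p'' by (auto simp: G_def G'_def G''_def)
  have D: "(G has_real_derivative G' s) (at s)" for s
  proof (cases "s < b")
    case True
    have "(G has_real_derivative poly (pderiv p) s) (at s)"
      by (rule near[of "poly p" _ s "{..<b}"]) (use True in \<open>auto simp: G_def intro: poly_DERIV\<close>)
    then show ?thesis using True by (simp add: G'_def)
  next
    case False
    show ?thesis
      by (rule near[of F "G' s" s "{0<..}" G]) (use b False in \<open>auto simp: eq intro: F\<close>)
  qed
  have D': "(G' has_real_derivative G'' s) (at s)" for s
  proof (cases "s < b")
    case True
    have "(G' has_real_derivative poly (pderiv (pderiv p)) s) (at s)"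
      by (rule near[of "poly (pderiv p)" _ s "{..<b}"]) (use True in \<open>auto simp: G'_def intro: poly_DERIV\<close>)
    then show ?thesis using True by (simp add: G''_def)
  next
    case False
    show ?thesis
      by (rule near[of F' "G'' s" s "{0<..}" G']) (use b False in \<open>auto simp: eq intro: F\<close>)
  qed
  have "continuous_on ({..<b} \<union> {0<..}) G''"
  proof (rule continuous_on_open_Un)
    show "continuous_on {..<b} G''"
      by (subst continuous_on_cong[OF refl, of _ _ "poly (pderiv (pderiv p))"])
        (auto simp: G''_def intro!: continuous_intros)
    show "continuous_on {0<..} G''"
      by (subst continuous_on_cong[OF refl, of _ _ F'']) (auto simp: eq F'')
  qed auto
  moreover have "{..<b} \<union> {0<..} = UNIV" using b by auto
  ultimately have c: "continuous_on UNIV G''" by simp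
  have [measurable]: "G \<in> borel_measurable borel" "G' \<in> borel_measurable borel" "G'' \<in> borel_measurable borel"
    using D D' c by (auto intro!: borel_measurable_continuous_onI DERIV_continuous_on)
  have [measurable]: "g \<in> borel_measurable borel" "laplacian g \<in> borel_measurable borel"
    using Ck_continuous[OF g] Ck_continuous[OF Ck_laplacian[of 0 g]] g
    by (auto intro!: borel_measurable_continuous_onI simp: numeral_2_eq_2)
  have G: "(\<integral>y. G ((norm (x - y))\<^sup>2) * laplacian g y \<partial>lborel) =
    (\<integral>y. (8 * G' ((norm (x - y))\<^sup>2) + 4 * (norm (x - y))\<^sup>2 * G'' ((norm (x - y))\<^sup>2)) * g y \<partial>lborel)"
    by (rule radial_green[OF D D' c _ _ g, of a]) (use a b supp in \<open>auto simp: G_def\<close>)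
  have ae1: "AE y in lborel. F ((norm (x - y))\<^sup>2) * laplacian g y = G ((norm (x - y))\<^sup>2) * laplacian g y"
    using AE_norm_diff_pos[of x] by eventually_elim (simp add: eq)
  have ae2: "AE y in lborel. (8 * F' ((norm (x - y))\<^sup>2) + 4 * (norm (x - y))\<^sup>2 * F'' ((norm (x - y))\<^sup>2)) * g y =
      (8 * G' ((norm (x - y))\<^sup>2) + 4 * (norm (x - y))\<^sup>2 * G'' ((norm (x - y))\<^sup>2)) * g y"
    using AE_norm_diff_pos[of x] by eventually_elim (simp add: eq)
  \<comment> \<open>\<open>F\<close> is unconstrained for \<open>s \<le> 0\<close> and so need not
    be Borel. The composition sees only its value at \<open>s = 0\<close>, attained at one
    point.\<close>
  have "(\<lambda>y. f ((norm (x - y))\<^sup>2)) \<in> borel_measurable borel"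
    if [measurable]: "h \<in> borel_measurable borel" and "\<And>s. s > 0 \<Longrightarrow> h s = f s" for f h :: "real \<Rightarrow> real"
  proof -
    have "(\<lambda>y. f ((norm (x - y))\<^sup>2)) = (\<lambda>y. if y = x then f 0 else h ((norm (x - y))\<^sup>2))"
      using that(2) by auto
    then show ?thesis by simp
  qed
  note meas = this[OF _ eq(1)] this[OF _ eq(2)] this[OF _ eq(3)]
  have [measurable]: "(\<lambda>y. F ((norm (x - y))\<^sup>2)) \<in> borel_measurable borel"
    "(\<lambda>y. F' ((norm (x - y))\<^sup>2)) \<in> borel_measurable borel"
    "(\<lambda>y. F'' ((norm (x - y))\<^sup>2)) \<in> borel_measurable borel"
    by (rule meas; measurable)+
  have "(\<integral>y. F ((norm (x - y))\<^sup>2) * laplacian g y \<partial>lborel) = (\<integral>y. G ((norm (x - y))\<^sup>2) * laplacian g y \<partial>lborel)"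
    by (rule integral_cong_AE[OF _ _ ae1]) measurable
  also note G
  also have "(\<integral>y. (8 * G' ((norm (x - y))\<^sup>2) + 4 * (norm (x - y))\<^sup>2 * G'' ((norm (x - y))\<^sup>2)) * g y \<partial>lborel) =
     (\<integral>y. (8 * F' ((norm (x - y))\<^sup>2) + 4 * (norm (x - y))\<^sup>2 * F'' ((norm (x - y))\<^sup>2)) * g y \<partial>lborel)"
    by (rule integral_cong_AE[OF _ _ ae2, symmetric]) measurable
  finally show ?thesis .
qed

section \<open>Integrals of radial functions in dimension four\<close>

lemma borel_measurable_indicator_cball [measurable]:
  "(indicator (cball x r) :: 'a::euclidean_space \<Rightarrow> real) \<in> borel_measurable borel"
  by (intro borel_measurable_indicator borel_closed closed_cball)

lemma measurable_layer_integral [measurable]: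
  fixes \<psi> :: "real \<Rightarrow> ennreal"
  assumes [measurable]: "\<psi> \<in> borel_measurable borel"
  shows "(\<lambda>z::real^4. \<integral>\<^sup>+\<sigma>. \<psi> \<sigma> * indicator {(norm z)\<^sup>2..} \<sigma> \<partial>lborel) \<in> borel_measurable borel"
proof -
  have "indicator {(norm z)\<^sup>2..} \<sigma> = (indicator {p. (norm (fst p))\<^sup>2 \<le> snd p} (z, \<sigma>) :: ennreal)"
    for z :: "real^4" and \<sigma> :: real
    by (auto simp: indicator_def)
  then show ?thesis by simp
qed

text \<open>The inner integral is a superposition of indicators of balls. Tonelli reduces everything
  to the volume \<open>pi ^ 2 / 2 * \<sigma> ^ 2\<close> of the ball of radius
  \<open>sqrt \<sigma>\<close>, which does the work of polar coordinates.\<close>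

lemma layer_cake_ball:
  fixes \<psi> :: "real \<Rightarrow> ennreal"
  assumes [measurable]: "\<psi> \<in> borel_measurable borel"
  shows "(\<integral>\<^sup>+(z::real^4). (\<integral>\<^sup>+\<sigma>. \<psi> \<sigma> * indicator {(norm z)\<^sup>2..} \<sigma> \<partial>lborel) \<partial>lborel) =
     (\<integral>\<^sup>+\<sigma>. \<psi> \<sigma> * (ennreal (pi\<^sup>2 / 2 * \<sigma>\<^sup>2) * indicator {0..} \<sigma>) \<partial>lborel)"
proof -
  have eq: "indicator {(norm z)\<^sup>2..} \<sigma> = (indicator {p. (norm (fst p))\<^sup>2 \<le> snd p} (z, \<sigma>) :: ennreal)"
    for z :: "real^4" and \<sigma> :: real
    by (auto simp: indicator_def)
  have "(\<integral>\<^sup>+(z::real^4). (\<integral>\<^sup>+\<sigma>. \<psi> \<sigma> * indicator {(norm z)\<^sup>2..} \<sigma> \<partial>lborel) \<partial>lborel) =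
     (\<integral>\<^sup>+\<sigma>. (\<integral>\<^sup>+(z::real^4). \<psi> \<sigma> * indicator {(norm z)\<^sup>2..} \<sigma> \<partial>lborel) \<partial>lborel)"
    unfolding eq by (rule lborel_pair.Fubini'[symmetric]) measurable
  also have "\<dots> = (\<integral>\<^sup>+\<sigma>. \<psi> \<sigma> * (ennreal (pi\<^sup>2 / 2 * \<sigma>\<^sup>2) * indicator {0..} \<sigma>) \<partial>lborel)"
  proof (rule nn_integral_cong)
    fix \<sigma> :: real
    show "(\<integral>\<^sup>+(z::real^4). \<psi> \<sigma> * indicator {(norm z)\<^sup>2..} \<sigma> \<partial>lborel) =
        \<psi> \<sigma> * (ennreal (pi\<^sup>2 / 2 * \<sigma>\<^sup>2) * indicator {0..} \<sigma>)"
    proof (cases "\<sigma> \<ge> 0")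
      case True
      have "indicator {(norm z)\<^sup>2..} \<sigma> = (indicator (cball 0 (sqrt \<sigma>)) z :: ennreal)" for z :: "real^4"
        using True by (auto simp: indicator_def real_le_rsqrt) (metis norm_ge_zero real_sqrt_pow2 power_mono)
      moreover have "sqrt \<sigma> ^ 4 = \<sigma>\<^sup>2"
        using True by (simp add: power4_eq_xxxx power2_eq_square)
      ultimately show ?thesis
        using True by (simp add: nn_integral_cmult_indicator emeasure_cball eval_unit_ball_vol)
    next
      case False
      then have "indicator {(norm z)\<^sup>2..} \<sigma> = (0 :: ennreal)" for z :: "real^4"
        by (auto simp: indicator_def) (smt (verit) zero_le_power2)
      then show ?thesis using False by simp
    qed
  qed
  finally show ?thesis .
qed

text \<open>The argument is meant to be a squared distance, so for \<open>a > 0\<close> the support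
  is a ball of radius \<open>sqrt a\<close>. Inside, the powers are polynomials in \<open>s\<close>;
  the \<open>n\<close>-th power has \<open>n - 1\<close> continuous derivatives across
  \<open>s = a\<close>.\<close>

definition cutoff :: "real \<Rightarrow> real \<Rightarrow> real" where
  "cutoff a s = max 0 (1 - s / a)"

lemma cutoff_measurable [measurable]: "cutoff a \<in> borel_measurable borel"
  unfolding cutoff_def[abs_def] by measurable

lemma cutoff_nonneg [simp]: "cutoff a s \<ge> 0" by (simp add: cutoff_def)

lemma cutoff_le_1: "a > 0 \<Longrightarrow> s \<ge> 0 \<Longrightarrow> cutoff a s \<le> 1" by (simp add: cutoff_def)

lemma cutoff_eq_0: "a > 0 \<Longrightarrow> s \<ge> a \<Longrightarrow> cutoff a s = 0" by (simp add: cutoff_def)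

lemma cutoff_eq: "a > 0 \<Longrightarrow> s \<le> a \<Longrightarrow> cutoff a s = 1 - s / a" by (simp add: cutoff_def field_simps)

text \<open>Layer cake with \<open>\<psi>\<close> equal to minus the derivative of the
  \<open>k\<close>-th power; what remains is a Beta integral.\<close>

lemma integral_cutoff_power:
  assumes a: "a > 0" and k: "k > 0"
  shows "has_bochner_integral lborel (\<lambda>z::real^4. cutoff a ((norm z)\<^sup>2) ^ k)
           (pi\<^sup>2 * a\<^sup>2 / ((k + 1) * (k + 2)))"
proof (rule has_bochner_integral_nn_integral)
  obtain m where m: "k = Suc m" using k by (cases k) auto
  define w where "w \<sigma> = 1 - \<sigma> / a" for \<sigma>
  define \<psi> where "\<psi> \<sigma> = ennreal (k / a * w \<sigma> ^ m) * indicator {0..a} \<sigma>" for \<sigma>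
  have [measurable]: "\<psi> \<in> borel_measurable borel" unfolding \<psi>_def w_def by measurable
  have D: "((\<lambda>\<sigma>. w \<sigma> ^ Suc j) has_real_derivative - ((real j + 1) * w \<sigma> ^ j / a)) (at \<sigma>)" for j \<sigma>
    unfolding w_def using a by (auto intro!: derivative_eq_intros simp del: power_Suc)
  have inner: "(\<integral>\<^sup>+ \<sigma>. \<psi> \<sigma> * indicator {s..} \<sigma> \<partial>lborel) = ennreal (cutoff a s ^ k)" if "s \<ge> 0" for s
  proof (cases "s \<le> a")
    case True
    have "(\<integral>\<^sup>+ \<sigma>. \<psi> \<sigma> * indicator {s..} \<sigma> \<partial>lborel) =
       (\<integral>\<^sup>+ \<sigma>. ennreal (k / a * w \<sigma> ^ m) * indicator {s..a} \<sigma> \<partial>lborel)"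
      using that by (intro nn_integral_cong) (auto simp: \<psi>_def indicator_def)
    also have "\<dots> = ennreal (- (w a ^ Suc m) - (- (w s ^ Suc m)))"
    proof (rule nn_integral_FTC_Icc[where F = "\<lambda>\<sigma>. - (w \<sigma> ^ Suc m)"])
      show "((\<lambda>\<sigma>. - (w \<sigma> ^ Suc m)) has_real_derivative k / a * w \<sigma> ^ m) (at \<sigma>)" for \<sigma>
        by (rule DERIV_cong[OF DERIV_minus[OF D]]) (simp add: m)
    qed (use a True that in \<open>auto simp: w_def\<close>)
    finally show ?thesis using True a by (simp add: cutoff_eq m w_def)
  next
    case False
    then have "(\<integral>\<^sup>+ \<sigma>. \<psi> \<sigma> * indicator {s..} \<sigma> \<partial>lborel) = (\<integral>\<^sup>+ (\<sigma>::real). 0 \<partial>lborel)"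
      by (intro nn_integral_cong) (auto simp: \<psi>_def indicator_def)
    then show ?thesis using False a k by (simp add: cutoff_eq_0)
  qed
  \<comment> \<open>Antiderivative obtained by integrating the power of \<open>w\<close> by parts
    until the factor \<open>\<sigma> ^ 2\<close> is used up. Every term vanishes at
    \<open>a\<close>, where \<open>w\<close> does; at 0 only the last one survives.\<close>
  define G where "G \<sigma> = - (pi\<^sup>2 / 2) * (w \<sigma> ^ Suc m * \<sigma>\<^sup>2 + 2 * a / (real m + 2) * (w \<sigma> ^ Suc (Suc m) * \<sigma>)
       + 2 * a\<^sup>2 / ((real m + 2) * (real m + 3)) * w \<sigma> ^ Suc (Suc (Suc m)))" for \<sigma>
  have "(\<integral>\<^sup>+(z::real^4). ennreal (cutoff a ((norm z)\<^sup>2) ^ k) \<partial>lborel) =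
    (\<integral>\<^sup>+\<sigma>. \<psi> \<sigma> * (ennreal (pi\<^sup>2 / 2 * \<sigma>\<^sup>2) * indicator {0..} \<sigma>) \<partial>lborel)"
    using layer_cake_ball[of \<psi>] by (simp add: inner)
  also have "\<dots> = (\<integral>\<^sup>+\<sigma>. ennreal (k / a * w \<sigma> ^ m * (pi\<^sup>2 / 2 * \<sigma>\<^sup>2)) * indicator {0..a} \<sigma> \<partial>lborel)"
    using a by (intro nn_integral_cong) (auto simp: \<psi>_def w_def indicator_def simp flip: ennreal_mult')
  also have "\<dots> = ennreal (G a - G 0)"
  proof (rule nn_integral_FTC_Icc[where F = G])
    fix \<sigma> :: real
    have D0: "((\<lambda>\<sigma>. \<sigma>\<^sup>2) has_real_derivative 2 * \<sigma>) (at \<sigma>)"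
      by (auto intro!: derivative_eq_intros)
    have alg: "- (pi\<^sup>2 / 2) * (- ((real m + 1) * W / a) * \<sigma>\<^sup>2 + 2 * \<sigma> * (w * W)
         + 2 * a / (real m + 2) * (- ((real m + 2) * (w * W) / a) * \<sigma> + w * (w * W))
         + 2 * a\<^sup>2 / ((real m + 2) * (real m + 3)) * - ((real m + 3) * (w * (w * W)) / a))
       = (real m + 1) / a * W * (pi\<^sup>2 / 2 * \<sigma>\<^sup>2)" for w W
    proof -
      have "2 * a / (real m + 2) * (- ((real m + 2) * (w * W) / a) * \<sigma> + w * (w * W)) =
          - (2 * \<sigma> * (w * W)) + 2 * a / (real m + 2) * (w * (w * W))"
        unfolding distrib_left using a by (simp add: divide_simps)
      moreover have "2 * a\<^sup>2 / ((real m + 2) * (real m + 3)) * - ((real m + 3) * (w * (w * W)) / a) =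
          - (2 * a / (real m + 2) * (w * (w * W)))"
        using a by (simp add: divide_simps power2_eq_square)
      ultimately show ?thesis by (simp add: mult_ac)
    qed
    show "(G has_real_derivative k / a * w \<sigma> ^ m * (pi\<^sup>2 / 2 * \<sigma>\<^sup>2)) (at \<sigma>)"
      unfolding G_def
      by (rule DERIV_cong[OF DERIV_cmult[OF DERIV_add[OF DERIV_add[OF DERIV_mult[OF D D0]
              DERIV_cmult[OF DERIV_mult[OF D DERIV_ident]]] DERIV_cmult[OF D]]]])
        (use alg[of "w \<sigma> ^ m" "w \<sigma>"] in \<open>simp add: m add_ac mult_ac\<close>)
  qed (use a in \<open>auto simp: w_def intro!: mult_nonneg_nonneg divide_nonneg_nonneg\<close>)
  also have "G a - G 0 = pi\<^sup>2 * a\<^sup>2 / ((k + 1) * (k + 2))"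
    using a by (simp add: G_def w_def m algebra_simps)
  finally show "(\<integral>\<^sup>+(z::real^4). ennreal (cutoff a ((norm z)\<^sup>2) ^ k) \<partial>lborel) = ennreal (pi\<^sup>2 * a\<^sup>2 / ((k + 1) * (k + 2)))" .
qed (use a in auto)

text \<open>For \<open>0 < s \<le> 1\<close>, \<open>1 / s\<close> is 1 plus the integral of
  \<open>1 / \<sigma> ^ 2\<close> from \<open>s\<close> to 1. The ball volume, of order
  \<open>\<sigma> ^ 2\<close>, cancels this density and leaves a constant on the unit
  interval.\<close>

lemma integrable_inverse_square_unit:
  "integrable lborel (\<lambda>z::real^4. indicator (cball 0 1) z * (1 / (norm z)\<^sup>2))"
proof (rule integrableI_nonneg)
  define \<psi> where "\<psi> \<sigma> = ennreal (1 / \<sigma>\<^sup>2) * indicator {0..1} \<sigma>" for \<sigma> :: real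
  have [measurable]: "\<psi> \<in> borel_measurable borel" unfolding \<psi>_def by measurable
  have inner: "ennreal (1 / s - 1) = (\<integral>\<^sup>+ \<sigma>. \<psi> \<sigma> * indicator {s..} \<sigma> \<partial>lborel)" if "0 < s" "s \<le> 1" for s
  proof -
    have "(\<integral>\<^sup>+ \<sigma>. \<psi> \<sigma> * indicator {s..} \<sigma> \<partial>lborel) = (\<integral>\<^sup>+ \<sigma>. ennreal (1 / \<sigma>\<^sup>2) * indicator {s..1} \<sigma> \<partial>lborel)"
      using that by (intro nn_integral_cong) (auto simp: \<psi>_def indicator_def)
    also have "\<dots> = ennreal (- (1 / 1) - (- (1 / s)))"
      using that by (intro nn_integral_FTC_Icc) (auto intro!: derivative_eq_intros simp: power2_eq_square)
    finally show ?thesis by simp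
  qed
  have "(\<integral>\<^sup>+(z::real^4). ennreal (indicator (cball 0 1) z * (1 / (norm z)\<^sup>2)) \<partial>lborel) \<le>
     (\<integral>\<^sup>+(z::real^4). indicator (cball 0 1) z + (\<integral>\<^sup>+ \<sigma>. \<psi> \<sigma> * indicator {(norm z)\<^sup>2..} \<sigma> \<partial>lborel) \<partial>lborel)"
  proof (rule nn_integral_mono)
    fix z :: "real^4"
    show "ennreal (indicator (cball 0 1) z * (1 / (norm z)\<^sup>2)) \<le>
      indicator (cball 0 1) z + (\<integral>\<^sup>+ \<sigma>. \<psi> \<sigma> * indicator {(norm z)\<^sup>2..} \<sigma> \<partial>lborel)"
    proof (cases "norm z \<le> 1 \<and> z \<noteq> 0")
      case True
      then have 1: "0 < (norm z)\<^sup>2" "(norm z)\<^sup>2 \<le> 1" by (auto simp: power_le_one)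
      have "ennreal (1 / (norm z)\<^sup>2) = ennreal (1 + (1 / (norm z)\<^sup>2 - 1))" by simp
      also have "\<dots> = 1 + ennreal (1 / (norm z)\<^sup>2 - 1)"
        using 1 by (subst ennreal_plus) (auto simp: field_simps)
      finally show ?thesis using True inner[OF 1] by simp
    next
      case False
      then show ?thesis by (auto simp: indicator_def)
    qed
  qed
  also have "\<dots> = emeasure lborel (cball 0 1 :: (real^4) set) +
     (\<integral>\<^sup>+ \<sigma>. \<psi> \<sigma> * (ennreal (pi\<^sup>2 / 2 * \<sigma>\<^sup>2) * indicator {0..} \<sigma>) \<partial>lborel)"
    by (subst nn_integral_add) (auto simp: layer_cake_ball intro!: borel_measurable_indicator measurable_layer_integral)
  also have "(\<integral>\<^sup>+ \<sigma>. \<psi> \<sigma> * (ennreal (pi\<^sup>2 / 2 * \<sigma>\<^sup>2) * indicator {0..} \<sigma>) \<partial>lborel) \<le>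
     (\<integral>\<^sup>+ \<sigma>. ennreal (pi\<^sup>2 / 2) * indicator {0..1} (\<sigma>::real) \<partial>lborel)"
    by (intro nn_integral_mono) (auto simp: \<psi>_def indicator_def simp flip: ennreal_mult')
  also have "\<dots> = ennreal (pi\<^sup>2 / 2)" by (simp add: nn_integral_cmult_indicator)
  finally show "(\<integral>\<^sup>+(z::real^4). ennreal (indicator (cball 0 1) z * (1 / (norm z)\<^sup>2)) \<partial>lborel) < \<infinity>"
    by (rule order.strict_trans1) (auto simp: emeasure_compact_finite less_top[symmetric] emeasure_cball)
qed auto

lemma integrable_cball_bounded:
  fixes f :: "'a::euclidean_space \<Rightarrow> real"
  assumes [measurable]: "f \<in> borel_measurable borel" and B: "\<And>y. y \<in> cball x r \<Longrightarrow> \<bar>f y\<bar> \<le> B"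
  shows "integrable lborel (\<lambda>y. indicator (cball x r) y * f y)"
  by (rule integrableI_bounded_set[where A="cball x r" and B=B])
    (use emeasure_compact_finite[OF compact_cball] in \<open>auto simp: B indicator_def less_top\<close>)

lemma integrable_inverse_square:
  fixes g :: "real^4 \<Rightarrow> real"
  assumes g: "continuous_on UNIV g"
  shows "integrable lborel (\<lambda>y. indicator (cball x r) y * (g y / (norm (x - y))\<^sup>2))"
proof -
  have [measurable]: "g \<in> borel_measurable borel" using g by (rule borel_measurable_continuous_onI)
  have "bounded (g ` cball x r)"
    by (intro compact_imp_bounded compact_continuous_image continuous_on_subset[OF g]) auto
  then obtain B where B: "\<And>y. y \<in> cball x r \<Longrightarrow> \<bar>g y\<bar> \<le> B"
    unfolding bounded_iff by (metis imageI real_norm_def)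
  have "integrable (distr lborel borel ((+) (-x))) (\<lambda>z::real^4. indicator (cball 0 1) z * (1 / (norm z)\<^sup>2))"
    unfolding lborel_distr_plus by (rule integrable_inverse_square_unit)
  then have "integrable lborel (\<lambda>y. indicator (cball 0 1) (-x + y) * (1 / (norm (-x + y))\<^sup>2))"
    by (subst (asm) integrable_distr_eq) auto
  moreover have "indicator (cball 0 1) (-x + y) * (1 / (norm (-x + y))\<^sup>2) = indicator (cball x 1) y * (1 / (norm (x - y))\<^sup>2)" for y
    by (simp add: indicator_def dist_norm norm_minus_commute)
  ultimately have i1: "integrable lborel (\<lambda>y. indicator (cball x 1) y * (1 / (norm (x - y))\<^sup>2))" by simp
  have i2: "integrable lborel (\<lambda>y. indicator (cball x r) y * (1::real))"
    by (rule integrable_cball_bounded[where B=1]) auto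
  show ?thesis
  proof (rule Bochner_Integration.integrable_bound[OF integrable_mult_right[OF Bochner_Integration.integrable_add[OF i1 i2], of B]])
    show "AE y in lborel. norm (indicator (cball x r) y * (g y / (norm (x - y))\<^sup>2)) \<le>
       norm (B * (indicator (cball x 1) y * (1 / (norm (x - y))\<^sup>2) + indicator (cball x r) y * 1))"
    proof (rule AE_I2)
      fix y
      show "norm (indicator (cball x r) y * (g y / (norm (x - y))\<^sup>2)) \<le>
       norm (B * (indicator (cball x 1) y * (1 / (norm (x - y))\<^sup>2) + indicator (cball x r) y * 1))"
      proof (cases "y \<in> cball x r")
        case True
        have B0: "\<bar>g y\<bar> \<le> \<bar>B\<bar>" using B[OF True] by linarith
        show ?thesis
        proof (cases "y \<in> cball x 1")
          case True
          have "\<bar>g y\<bar> * (1 / (norm (x - y))\<^sup>2) \<le> \<bar>B\<bar> * (1 / (norm (x - y))\<^sup>2 + 1)"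
            by (intro mult_mono B0) auto
          then show ?thesis using True \<open>y \<in> cball x r\<close> by (simp add: abs_mult)
        next
          case False
          then have "1 \<le> (norm (x - y))\<^sup>2" by (simp add: dist_norm)
          then have "\<bar>g y\<bar> * (1 / (norm (x - y))\<^sup>2) \<le> \<bar>B\<bar> * 1"
            by (intro mult_mono B0) (auto simp: divide_le_eq_1)
          then show ?thesis using False True by (simp add: abs_mult)
        qed
      qed simp
    qed
  qed auto
qed

text \<open>Within distance 1 of \<open>x\<close>, continuity bounds \<open>f\<close> and the
  inverse square is locally integrable; beyond, the kernel is at most 1. This supplies the majorants
  for the limits of both potentials.\<close>

lemma integrable_div_norm_sq:
  fixes f :: "real^4 \<Rightarrow> real"
  assumes f: "continuous_on UNIV f" "integrable lborel f"
  shows "integrable lborel (\<lambda>y. f y / (norm (x - y))\<^sup>2)"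
proof -
  have [measurable]: "f \<in> borel_measurable borel" using f by (intro borel_measurable_continuous_onI) auto
  show ?thesis
  proof (rule Bochner_Integration.integrable_bound[OF Bochner_Integration.integrable_add[OF
          integrable_norm[OF integrable_inverse_square[OF f(1), of x 1]] integrable_norm[OF f(2)]]])
    show "AE y in lborel. norm (f y / (norm (x - y))\<^sup>2) \<le>
       norm (norm (indicator (cball x 1) y * (f y / (norm (x - y))\<^sup>2)) + norm (f y))"
    proof (rule AE_I2)
      fix y
      show "norm (f y / (norm (x - y))\<^sup>2) \<le>
       norm (norm (indicator (cball x 1) y * (f y / (norm (x - y))\<^sup>2)) + norm (f y))"
      proof (cases "y \<in> cball x 1")
        case False
        then have "1 \<le> (norm (x - y))\<^sup>2" by (simp add: dist_norm)
        then have "\<bar>f y\<bar> * (1 / (norm (x - y))\<^sup>2) \<le> \<bar>f y\<bar> * 1"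
          by (intro mult_left_mono) (auto simp: divide_le_eq_1)
        then show ?thesis using False by simp
      qed simp
    qed
  qed auto
qed

section \<open>Truncated kernels with an integrable singularity\<close>

text \<open>Only \<open>w = 0\<close> is delicate: left quotients are zero because the positive part
  is constant there, and \<open>D = 0\<close> sends the right quotients to zero as well. This gives
  the smoothness of the kernels across the edge \<open>s = a\<close>.\<close>

lemma DERIV_comp_max_0:
  fixes f :: "real \<Rightarrow> real"
  assumes f: "(f has_real_derivative D) (at (max 0 w))" and D: "w \<le> 0 \<Longrightarrow> D = 0"
  shows "((\<lambda>w. f (max 0 w)) has_real_derivative D) (at w)"
proof -
  consider "w < 0" | "w > 0" | "w = 0" by linarith
  then show ?thesis
  proof cases
    case 1
    show ?thesis
      by (rule has_field_derivative_transform_within_open[where f = "\<lambda>w. f 0" and S = "{..<0}"]) (use 1 D in auto)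
  next
    case 2
    show ?thesis
      by (rule has_field_derivative_transform_within_open[where f = f and S = "{0<..}"]) (use f 2 in auto)
  next
    case 3
    then have "((\<lambda>h. (f h - f 0) / h) \<longlongrightarrow> 0) (at 0)"
      using f D by (simp add: DERIV_def)
    then have "((\<lambda>h. (f (max 0 h) - f 0) / h) \<longlongrightarrow> 0) (at 0)"
      by (rule Lim_null_comparison[rotated, OF tendsto_rabs_zero]) (auto simp: max_def simp del: abs_divide)
    then show ?thesis using 3 D by (simp add: DERIV_def)
  qed
qed

lemma DERIV_cutoff_power:
  assumes "a > 0" "n \<ge> 2"
  shows "((\<lambda>s. cutoff a s ^ n) has_real_derivative - (real n * cutoff a s ^ (n - 1) / a)) (at s)"
proof -
  have "((\<lambda>w::real. w ^ n) has_real_derivative real n * w ^ (n - 1)) (at w)" for w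
    by (auto intro!: derivative_eq_intros)
  then have "((\<lambda>w. max 0 w ^ n) has_real_derivative real n * (max 0 (1 - s / a)) ^ (n - 1)) (at (1 - s / a))"
    using assms by (intro DERIV_comp_max_0) auto
  moreover have "((\<lambda>s. 1 - s / a) has_real_derivative - 1 / a) (at s)"
    using assms by (auto intro!: derivative_eq_intros)
  ultimately show ?thesis
    unfolding cutoff_def using DERIV_chain2[of "\<lambda>w. max 0 w ^ n" _ "\<lambda>s. 1 - s / a" s "-1/a" UNIV] by simp
qed

lemma continuous_on_cutoff [continuous_intros]: "continuous_on S f \<Longrightarrow> continuous_on S (\<lambda>x. cutoff a (f x))"
  unfolding cutoff_def by (cases "a = 0") (auto intro!: continuous_intros)

text \<open>A pole \<open>1 / s\<close> in the squared distance is integrable in dimension four.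
  Both the inverse-square and the logarithmic kernels satisfy such a bound.\<close>

lemma singular_kernel_integrable:
  fixes x :: "real^4" and g :: "real^4 \<Rightarrow> real"
  assumes [measurable]: "k \<in> borel_measurable borel" and C: "\<And>s. s > 0 \<Longrightarrow> \<bar>k s\<bar> \<le> C / s"
    and supp: "\<And>s. s > a \<Longrightarrow> k s = 0" and g: "continuous_on UNIV g"
  shows "integrable lborel (\<lambda>y. k ((norm (x - y))\<^sup>2) * g y)"
proof -
  have [measurable]: "g \<in> borel_measurable borel" using g by (rule borel_measurable_continuous_onI)
  have "AE y in lborel. norm (k ((norm (x - y))\<^sup>2) * g y) \<le>
      norm (C * (indicator (cball x (sqrt a)) y * (g y / (norm (x - y))\<^sup>2)))"
    using AE_norm_diff_pos[of x]
  proof eventually_elim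
    case (elim y)
    show ?case
    proof (cases "(norm (x - y))\<^sup>2 > a")
      case False
      then have "y \<in> cball x (sqrt a)"
        by (simp add: dist_norm real_le_rsqrt)
      moreover have "\<bar>k ((norm (x - y))\<^sup>2)\<bar> * \<bar>g y\<bar> \<le> C / (norm (x - y))\<^sup>2 * \<bar>g y\<bar>"
        using elim by (intro mult_right_mono C) auto
      moreover have "C / (norm (x - y))\<^sup>2 \<ge> 0" using C[of "(norm (x - y))\<^sup>2"] elim by force
      ultimately show ?thesis using elim by (simp add: abs_mult zero_le_divide_iff)
    qed (simp add: supp)
  qed
  then show ?thesis
    by (rule Bochner_Integration.integrable_bound[OF integrable_mult_right[OF integrable_inverse_square[OF g]], rotated]) auto
qed

text \<open>The majorant \<open>C / s\<close> on the ball of radius \<open>sqrt a\<close> serves all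
  \<open>m\<close>, and the shrinking supports make the integrand eventually zero off
  \<open>y = x\<close>. It disposes of the inner-scale kernels.\<close>

lemma singular_kernel_tendsto_0:
  fixes x :: "real^4" and g :: "real^4 \<Rightarrow> real" and b :: "nat \<Rightarrow> real"
  assumes [measurable]: "\<And>m. k m \<in> borel_measurable borel" and C: "\<And>m s. s > 0 \<Longrightarrow> \<bar>k m s\<bar> \<le> C / s"
    and supp: "\<And>m s. s > b m \<Longrightarrow> k m s = 0" and b: "b \<longlonglongrightarrow> 0" "\<And>m. b m \<le> a" and g: "continuous_on UNIV g"
  shows "(\<lambda>m. \<integral>y. k m ((norm (x - y))\<^sup>2) * g y \<partial>lborel) \<longlonglongrightarrow> 0"
proof -
  have [measurable]: "g \<in> borel_measurable borel" using g by (rule borel_measurable_continuous_onI)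
  have "(\<lambda>m. \<integral>y. k m ((norm (x - y))\<^sup>2) * g y \<partial>lborel) \<longlonglongrightarrow> (\<integral>(y::real^4). 0 \<partial>lborel)"
  proof (rule integral_dominated_convergence)
    show "integrable lborel (\<lambda>y. norm (C * (indicator (cball x (sqrt a)) y * (g y / (norm (x - y))\<^sup>2))))"
      by (intro integrable_norm integrable_mult_right integrable_inverse_square g)
    show "AE y in lborel. norm (k m ((norm (x - y))\<^sup>2) * g y) \<le>
      norm (C * (indicator (cball x (sqrt a)) y * (g y / (norm (x - y))\<^sup>2)))" for m
      using AE_norm_diff_pos[of x]
    proof eventually_elim
      case (elim y)
      show ?case
      proof (cases "(norm (x - y))\<^sup>2 > a")
        case False
        then have "y \<in> cball x (sqrt a)"
          by (simp add: dist_norm real_le_rsqrt)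
        moreover have "\<bar>k m ((norm (x - y))\<^sup>2)\<bar> * \<bar>g y\<bar> \<le> C / (norm (x - y))\<^sup>2 * \<bar>g y\<bar>"
          using elim by (intro mult_right_mono C) auto
        moreover have "C / (norm (x - y))\<^sup>2 \<ge> 0" using C[of "(norm (x - y))\<^sup>2" m] elim by force
        ultimately show ?thesis using elim by (simp add: abs_mult zero_le_divide_iff)
      next
        case True
        then have "(norm (x - y))\<^sup>2 > b m" using b(2)[of m] by linarith
        then show ?thesis by (simp add: supp)
      qed
    qed
    show "AE y in lborel. (\<lambda>m. k m ((norm (x - y))\<^sup>2) * g y) \<longlonglongrightarrow> 0"
      using AE_norm_diff_pos[of x]
    proof eventually_elim
      case (elim y)
      then have "eventually (\<lambda>m. b m < (norm (x - y))\<^sup>2) sequentially"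
        by (intro order_tendstoD(2)[OF b(1)]) auto
      then have "eventually (\<lambda>m. k m ((norm (x - y))\<^sup>2) * g y = 0) sequentially"
        by eventually_elim (simp add: supp)
      then show ?case by (rule tendsto_eventually)
    qed
  qed auto
  then show ?thesis by simp
qed

lemma cutoff_power_compact_support:
  fixes x :: "real^4"
  assumes "a > 0" "k > 0" "norm (y - x) > sqrt a"
  shows "cutoff a ((norm (x - y))\<^sup>2) ^ k = 0"
proof -
  have "a \<le> (norm (x - y))\<^sup>2"
    using assms by (simp add: norm_minus_commute sqrt_le_D)
  then show ?thesis using assms by (simp add: cutoff_eq_0)
qed

lemma integrable_cutoff_power:
  fixes x :: "real^4" and g :: "real^4 \<Rightarrow> real"
  assumes "a > 0" "k > 0" "continuous_on UNIV g"
  shows "integrable lborel (\<lambda>y. cutoff a ((norm (x - y))\<^sup>2) ^ k * g y)"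
  using assms by (intro integrable_compact_support[of _ "sqrt a" x] continuous_intros)
    (auto simp: cutoff_power_compact_support simp del: power_eq_0_iff)

lemma integral_cutoff_power_shifted:
  fixes x :: "real^4"
  assumes "a > 0" "k > 0"
  shows "(\<integral>y. cutoff a ((norm (x - y))\<^sup>2) ^ k \<partial>lborel) = pi\<^sup>2 * a\<^sup>2 / ((k + 1) * (k + 2))"
proof -
  have "(\<integral>y. cutoff a ((norm (y + (-x)))\<^sup>2) ^ k \<partial>lborel) = (\<integral>(y::real^4). cutoff a ((norm y)\<^sup>2) ^ k \<partial>lborel)"
    by (rule lborel_integral_translate) measurable
  then show ?thesis
    using has_bochner_integral_integral_eq[OF integral_cutoff_power[OF assms]] by (simp add: norm_minus_commute)
qed

text \<open>After division by the square of \<open>b m\<close> the nonnegative weights have a mass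
  independent of \<open>m\<close>, and they live in the ball of radius \<open>sqrt (b m)\<close>,
  where \<open>g\<close> is close to \<open>g x\<close>.\<close>

lemma cutoff_approximate_identity:
  fixes x :: "real^4" and g :: "real^4 \<Rightarrow> real" and b :: "nat \<Rightarrow> real"
  assumes b: "b \<longlonglongrightarrow> 0" "\<And>m. b m > 0" and k: "k > 0" and g: "continuous_on UNIV g"
  shows "(\<lambda>m. \<integral>y. cutoff (b m) ((norm (x - y))\<^sup>2) ^ k / (b m)\<^sup>2 * g y \<partial>lborel)
     \<longlonglongrightarrow> pi\<^sup>2 / ((k + 1) * (k + 2)) * g x"
proof -
  define c where "c = pi\<^sup>2 / ((k + 1) * (k + 2))"
  have c: "c > 0" unfolding c_def by (intro divide_pos_pos) (simp_all del: of_nat_mult of_nat_add)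
  define w where "w m y = cutoff (b m) ((norm (x - y))\<^sup>2) ^ k / (b m)\<^sup>2" for m y
  have w0: "w m y \<ge> 0" for m y by (simp add: w_def)
  have iw: "integrable lborel (\<lambda>y. w m y * h y)" if "continuous_on UNIV h" for m h
    using integrable_divide_zero[OF integrable_cutoff_power[OF b(2) k that, of m x], of "(b m)\<^sup>2"] by (simp add: w_def)
  have Iw: "(\<integral>y. w m y \<partial>lborel) = c" for m
    using b(2)[of m] integral_cutoff_power_shifted[OF b(2)[of m] k, of x] by (simp add: w_def c_def)
  have "(\<lambda>m. \<integral>y. w m y * g y \<partial>lborel) \<longlonglongrightarrow> c * g x"
  proof (rule LIMSEQ_I)
    fix r :: real assume r: "r > 0"
    obtain d where d: "d > 0" "\<And>y. dist y x < d \<Longrightarrow> dist (g y) (g x) < r / (2 * c)"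
      using g r c unfolding continuous_on_eq_continuous_at[OF open_UNIV] continuous_at_eps_delta
      by (metis UNIV_I divide_pos_pos mult_pos_pos zero_less_numeral)
    have "eventually (\<lambda>m. b m < d\<^sup>2) sequentially"
      by (rule order_tendstoD(2)[OF b(1)]) (use d in auto)
    then obtain N where N: "\<And>m. m \<ge> N \<Longrightarrow> b m < d\<^sup>2" by (auto simp: eventually_sequentially)
    show "\<exists>N. \<forall>m\<ge>N. norm ((\<integral>y. w m y * g y \<partial>lborel) - c * g x) < r"
    proof (intro exI allI impI)
      fix m assume m: "m \<ge> N"
      have "(\<integral>y. w m y * g y \<partial>lborel) - c * g x = (\<integral>y. w m y * g y - w m y * g x \<partial>lborel)"
        using iw[OF g, of m] iw[of "\<lambda>_. g x" m] Iw[of m] iw[of "\<lambda>_. 1" m] by simp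
      also have "\<dots> = (\<integral>y. w m y * (g y - g x) \<partial>lborel)" by (simp add: algebra_simps)
      also have "norm \<dots> \<le> (\<integral>y. w m y * (r / (2 * c)) \<partial>lborel)"
      proof (rule Bochner_Integration.integral_norm_bound_integral)
        show "integrable lborel (\<lambda>y. w m y * (g y - g x))" "integrable lborel (\<lambda>y. w m y * (r / (2 * c)))"
          by (intro iw continuous_intros g)+
        fix y
        show "norm (w m y * (g y - g x)) \<le> w m y * (r / (2 * c))"
        proof (cases "dist y x < d")
          case True
          then show ?thesis
            using mult_left_mono[OF less_imp_le[OF d(2)[OF True]] w0[of m y]] w0[of m y]
            by (simp add: abs_mult dist_real_def)
        next
          case False
          then have "d\<^sup>2 \<le> (norm (x - y))\<^sup>2"
            using d by (intro power_mono) (auto simp: dist_norm norm_minus_commute)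
          then have "w m y = 0" using N[OF m] b(2)[of m] k by (simp add: w_def cutoff_eq_0)
          then show ?thesis by simp
        qed
      qed
      also have "\<dots> = r / 2"
        using c Iw[of m] by simp
      finally show "norm ((\<integral>y. w m y * g y \<partial>lborel) - c * g x) < r" using r by linarith
    qed
  qed
  then show ?thesis by (simp add: w_def c_def)
qed

section \<open>Representing a function by its Laplacian\<close>

text \<open>The singular part of \<open>q\<^sup>n / s\<close> does not depend on \<open>a\<close>, so the difference of two such kernels
  is a polynomial near \<open>s = 0\<close>.\<close>

lemma poly_geometric_cutoff:
  assumes "a > 0" "0 < s" "s < a"
  shows "cutoff a s ^ n / s = 1 / s - poly (smult (1 / a) (\<Sum>j<n. [:1, - 1 / a:] ^ j)) s"
proof -
  have "1 - (1 - s / a) ^ n = s / a * (\<Sum>j<n. (1 - s / a) ^ j)"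
    using one_diff_power_eq[of "1 - s / a" n] by simp
  then have "(1 - s / a) ^ n / s = 1 / s - 1 / a * (\<Sum>j<n. (1 - s / a) ^ j)"
    using assms by (simp add: field_simps)
  then show ?thesis using assms by (simp add: cutoff_eq poly_sum)
qed

lemma DERIV_cutoff_power_over:
  assumes "a > 0" "n \<ge> 2" "s > 0"
  shows "((\<lambda>s. cutoff a s ^ n / s) has_real_derivative - (real n * cutoff a s ^ (n - 1) / (a * s)) - cutoff a s ^ n / s\<^sup>2) (at s)"
proof -
  have "(- (N * P / a) * s - Q * 1) / (s * s) = - (N * P / (a * s)) - Q / s\<^sup>2" for N P Q :: real
    using assms by (simp add: divide_simps power2_eq_square)
  then show ?thesis
    using assms(3) by (intro DERIV_cong[OF DERIV_divide[OF DERIV_cutoff_power[OF assms(1,2)] DERIV_ident]]) auto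
qed

lemma DERIV_cutoff_power_over_sq:
  assumes "a > 0" "n \<ge> 2" "s > 0"
  shows "((\<lambda>s. cutoff a s ^ n / s\<^sup>2) has_real_derivative - (real n * cutoff a s ^ (n - 1) / (a * s\<^sup>2)) - 2 * cutoff a s ^ n / s ^ 3) (at s)"
proof -
  have D0: "((\<lambda>s. s\<^sup>2) has_real_derivative 2 * s) (at s)" by (auto intro!: derivative_eq_intros)
  have "s\<^sup>2 \<noteq> 0" using assms by simp
  moreover have "(- (N * P / a) * s\<^sup>2 - Q * (2 * s)) / (s\<^sup>2 * s\<^sup>2) = - (N * P / (a * s\<^sup>2)) - 2 * Q / s ^ 3" for N P Q :: real
    using assms by (simp add: divide_simps power2_eq_square power3_eq_cube) (simp add: algebra_simps)
  ultimately show ?thesis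
    by (intro DERIV_cong[OF DERIV_divide[OF DERIV_cutoff_power[OF assms(1,2)] D0]])
qed

text \<open>\<open>1 / s\<close> is harmonic away from 0, so in \<open>8 F' + 4 s F''\<close> for
  \<open>q ^ n / s\<close> the terms with \<open>q ^ n\<close> and \<open>q ^ (n - 1)\<close>
  cancel. Only the second derivative of the cutoff power survives, and it has no singularity
  left.\<close>

lemma inverse_square_kernel_green:
  fixes x :: "real^4"
  assumes g: "Ck 2 g" and b: "0 < b" "b \<le> a" and n: "n \<ge> 4"
  shows "(\<integral>y. (cutoff a ((norm (x - y))\<^sup>2) ^ n / (norm (x - y))\<^sup>2 - cutoff b ((norm (x - y))\<^sup>2) ^ n / (norm (x - y))\<^sup>2) * laplacian g y \<partial>lborel) =
    (\<integral>y. 4 * real n * (real n - 1) * (cutoff a ((norm (x - y))\<^sup>2) ^ (n - 2) / a\<^sup>2 - cutoff b ((norm (x - y))\<^sup>2) ^ (n - 2) / b\<^sup>2) * g y \<partial>lborel)"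
proof -
  define e1 where "e1 a s = - (real n * (cutoff a s ^ (n - 1) / s) / a) - cutoff a s ^ n / s\<^sup>2" for a s
  define e2 where "e2 a s = - (real n * (- (real (n - 1) * cutoff a s ^ (n - 2) / (a * s)) - cutoff a s ^ (n - 1) / s\<^sup>2) / a)
     - (- (real n * cutoff a s ^ (n - 1) / (a * s\<^sup>2)) - 2 * cutoff a s ^ n / s ^ 3)" for a s
  have D1: "((\<lambda>s. cutoff a s ^ n / s) has_real_derivative e1 a s) (at s)" if "a > 0" "s > 0" for a s
    using DERIV_cutoff_power_over[of a n s] that n by (simp add: e1_def mult.commute)
  have D2: "((\<lambda>s. e1 a s) has_real_derivative e2 a s) (at s)" if "a > 0" "s > 0" for a s
    unfolding e1_def
    by (rule DERIV_cong[OF DERIV_diff[OF DERIV_minus[OF DERIV_cdivide[OF DERIV_cmult[OF DERIV_cutoff_power_over]]] DERIV_cutoff_power_over_sq]])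
      (use that n in \<open>auto simp: e2_def numeral_2_eq_2\<close>)
  have lap: "8 * e1 a s + 4 * s * e2 a s = 4 * real n * (real n - 1) * (cutoff a s ^ (n - 2) / a\<^sup>2)" if "a > 0" "s > 0" for a s
  proof -
    \<comment> \<open>The powers of the cutoff enter as independent unknowns \<open>Q0\<close>,
      \<open>Q1\<close>, \<open>Q2\<close>: the cancellation holds coefficient by
      coefficient.\<close>
    have alg: "8 * (- (N * (Q1 / s) / a) - Q0 / s\<^sup>2) +
        4 * s * (- (N * (- (M * Q2 / (a * s)) - Q1 / s\<^sup>2) / a) - (- (N * Q1 / (a * s\<^sup>2)) - 2 * Q0 / s ^ 3))
        = 4 * N * M * (Q2 / a\<^sup>2)" for N M Q0 Q1 Q2 :: real
      using that by (simp add: divide_simps power2_eq_square power3_eq_cube) (simp add: algebra_simps)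
    show ?thesis
      using n unfolding e1_def e2_def alg by (simp add: of_nat_diff)
  qed
  have cont: "continuous_on {0<..} (e2 a)" if "a > 0" for a
    unfolding e2_def[abs_def] using that by (intro continuous_intros) auto
  have p: "cutoff a s ^ n / s - cutoff b s ^ n / s = poly (smult (1 / b) (\<Sum>j<n. [:1, - 1 / b:] ^ j) - smult (1 / a) (\<Sum>j<n. [:1, - 1 / a:] ^ j)) s"
    if "0 < s" "s < b" for s
    using poly_geometric_cutoff[of a s n] poly_geometric_cutoff[of b s n] that b by simp
  have "(\<integral>y. (cutoff a ((norm (x - y))\<^sup>2) ^ n / (norm (x - y))\<^sup>2 - cutoff b ((norm (x - y))\<^sup>2) ^ n / (norm (x - y))\<^sup>2) * laplacian g y \<partial>lborel) =
    (\<integral>y. (8 * (e1 a ((norm (x - y))\<^sup>2) - e1 b ((norm (x - y))\<^sup>2)) + 4 * (norm (x - y))\<^sup>2 * (e2 a ((norm (x - y))\<^sup>2) - e2 b ((norm (x - y))\<^sup>2))) * g y \<partial>lborel)"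
    by (rule radial_green_punctured[where F = "\<lambda>s. cutoff a s ^ n / s - cutoff b s ^ n / s" and a = a and b = b,
        OF DERIV_diff[OF D1 D1] DERIV_diff[OF D2 D2] continuous_on_diff[OF cont cont] _ _ _ p g])
      (use b n in \<open>auto simp: cutoff_eq_0\<close>)
  also have "\<dots> = (\<integral>y. 4 * real n * (real n - 1) * (cutoff a ((norm (x - y))\<^sup>2) ^ (n - 2) / a\<^sup>2 - cutoff b ((norm (x - y))\<^sup>2) ^ (n - 2) / b\<^sup>2) * g y \<partial>lborel)"
  proof (rule integral_cong_AE)
    show "AE y in lborel. (8 * (e1 a ((norm (x - y))\<^sup>2) - e1 b ((norm (x - y))\<^sup>2)) + 4 * (norm (x - y))\<^sup>2 * (e2 a ((norm (x - y))\<^sup>2) - e2 b ((norm (x - y))\<^sup>2))) * g y =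
       4 * real n * (real n - 1) * (cutoff a ((norm (x - y))\<^sup>2) ^ (n - 2) / a\<^sup>2 - cutoff b ((norm (x - y))\<^sup>2) ^ (n - 2) / b\<^sup>2) * g y"
      using AE_norm_diff_pos[of x]
    proof eventually_elim
      case (elim y)
      have "8 * (e1 a s - e1 b s) + 4 * s * (e2 a s - e2 b s) = (8 * e1 a s + 4 * s * e2 a s) - (8 * e1 b s + 4 * s * e2 b s)" for s
        by (simp add: algebra_simps)
      also have "(8 * e1 a s + 4 * s * e2 a s) - (8 * e1 b s + 4 * s * e2 b s) =
          4 * real n * (real n - 1) * (cutoff a s ^ (n - 2) / a\<^sup>2 - cutoff b s ^ (n - 2) / b\<^sup>2)" if "s > 0" for s
        using b n that by (simp only: lap) (simp add: right_diff_distrib)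
      finally show ?case using elim by simp
    qed
    have [measurable]: "g \<in> borel_measurable borel" using Ck_continuous[OF g] by (rule borel_measurable_continuous_onI)
    show "(\<lambda>y. (8 * (e1 a ((norm (x - y))\<^sup>2) - e1 b ((norm (x - y))\<^sup>2)) + 4 * (norm (x - y))\<^sup>2 * (e2 a ((norm (x - y))\<^sup>2) - e2 b ((norm (x - y))\<^sup>2))) * g y) \<in> borel_measurable lborel"
      "(\<lambda>y. 4 * real n * (real n - 1) * (cutoff a ((norm (x - y))\<^sup>2) ^ (n - 2) / a\<^sup>2 - cutoff b ((norm (x - y))\<^sup>2) ^ (n - 2) / b\<^sup>2) * g y) \<in> borel_measurable lborel"
      unfolding e1_def e2_def by measurable
  qed
  finally show ?thesis .
qed

text \<open>The two-scale identity above as \<open>b\<close> tends to \<open>0\<close>: the kernels at scale \<open>b\<close> become an approximate identity.\<close>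

lemma laplacian_representation:
  fixes x :: "real^4"
  assumes g: "Ck 2 g" and a: "a > 0" and n: "n \<ge> 4"
  shows "4 * pi\<^sup>2 * g x =
    (\<integral>y. 4 * real n * (real n - 1) / a\<^sup>2 * cutoff a ((norm (x - y))\<^sup>2) ^ (n - 2) * g y \<partial>lborel) -
    (\<integral>y. cutoff a ((norm (x - y))\<^sup>2) ^ n / (norm (x - y))\<^sup>2 * laplacian g y \<partial>lborel)"
proof -
  define b where "b m = a / real (Suc m)" for m
  have b: "0 < b m" "b m \<le> a" for m
    using a by (auto simp: b_def divide_le_eq mult_le_cancel_left1)
  have b0: "b \<longlonglongrightarrow> 0"
    unfolding b_def using tendsto_mult_right_zero[OF LIMSEQ_inverse_real_of_nat, of a] by (simp add: divide_inverse)
  define h where "h = laplacian g"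
  have cg: "continuous_on UNIV g" and ch: "continuous_on UNIV h"
    using Ck_continuous[OF g] Ck_continuous[OF Ck_laplacian[of 0 g]] g by (auto simp: numeral_2_eq_2 h_def)
  define E where "E a = (\<integral>y. cutoff a ((norm (x - y))\<^sup>2) ^ n / (norm (x - y))\<^sup>2 * h y \<partial>lborel)" for a
  define N where "N a = (\<integral>y. cutoff a ((norm (x - y))\<^sup>2) ^ (n - 2) / a\<^sup>2 * g y \<partial>lborel)" for a
  define c where "c = 4 * real n * (real n - 1)"
  have bound: "cutoff a s ^ n / s \<le> 1 / s" if "a > 0" "s > 0" for a s
    using that by (simp add: divide_right_mono power_le_one cutoff_le_1)
  have iE: "integrable lborel (\<lambda>y. cutoff a ((norm (x - y))\<^sup>2) ^ n / (norm (x - y))\<^sup>2 * h y)" if "a > 0" for a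
    by (rule singular_kernel_integrable[of "\<lambda>s. cutoff a s ^ n / s" 1 a])
      (use that n in \<open>auto simp: ch cutoff_eq_0 bound\<close>)
  have iN: "integrable lborel (\<lambda>y. cutoff a ((norm (x - y))\<^sup>2) ^ (n - 2) / a\<^sup>2 * g y)" if "a > 0" for a
    using integrable_divide_zero[OF integrable_cutoff_power[OF that _ cg, of "n - 2" x], of "a\<^sup>2"] n by simp
  have eq: "E a - E (b m) = c * (N a - N (b m))" for m
    using inverse_square_kernel_green[OF g b n, of x m] iE[OF a] iE[OF b(1)[of m]] iN[OF a] iN[OF b(1)[of m]]
    by (simp add: E_def N_def c_def h_def left_diff_distrib mult.assoc)
  have E0: "(\<lambda>m. E (b m)) \<longlonglongrightarrow> 0"
    unfolding E_def
    by (rule singular_kernel_tendsto_0[where k = "\<lambda>m s. cutoff (b m) s ^ n / s" and C = 1 and b = b and a = a])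
      (use b b0 n in \<open>auto simp: ch cutoff_eq_0 bound\<close>)
  have N0: "(\<lambda>m. N (b m)) \<longlonglongrightarrow> pi\<^sup>2 / ((n - 2 + 1) * (n - 2 + 2)) * g x"
    unfolding N_def by (rule cutoff_approximate_identity) (use b0 b n cg in auto)
  have "(\<lambda>m. c * (N a - N (b m))) \<longlonglongrightarrow> E a - 0"
    unfolding eq[symmetric] by (intro tendsto_diff tendsto_const E0)
  moreover have "(\<lambda>m. c * (N a - N (b m))) \<longlonglongrightarrow> c * (N a - pi\<^sup>2 / ((n - 2 + 1) * (n - 2 + 2)) * g x)"
    by (intro tendsto_mult tendsto_diff tendsto_const N0)
  ultimately have "E a = c * (N a - pi\<^sup>2 / ((n - 2 + 1) * (n - 2 + 2)) * g x)"
    by (metis LIMSEQ_unique diff_zero)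
  \<comment> \<open>The factor \<open>4 n (n - 1)\<close> from the Laplacian cancels the mass of the
    approximate identity. What is left, \<open>4 * pi ^ 2\<close>, is the flux of the inverse square
    through spheres in dimension four, whatever \<open>n\<close> is.\<close>
  moreover have "c * (pi\<^sup>2 / ((n - 2 + 1) * (n - 2 + 2)) * g x) = 4 * pi\<^sup>2 * g x"
  proof -
    have "real ((n - 2 + 1) * (n - 2 + 2)) = (real n - 1) * real n"
    proof -
      have "n - 2 + 1 = n - 1" "n - 2 + 2 = n" using n by auto
      then show ?thesis using n by (simp only: of_nat_mult of_nat_diff) simp
    qed
    then show ?thesis using n by (simp add: c_def)
  qed
  moreover have "c * N a = (\<integral>y. 4 * real n * (real n - 1) / a\<^sup>2 * cutoff a ((norm (x - y))\<^sup>2) ^ (n - 2) * g y \<partial>lborel)"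
    unfolding N_def c_def integral_mult_right_zero[symmetric] by (simp add: mult_ac)
  ultimately show ?thesis by (simp add: E_def h_def right_diff_distrib)
qed

section \<open>The logarithmic kernel\<close>

text \<open>For \<open>0 < s < a\<close> one has \<open>1 - q = s / a\<close>, so this is
  \<open>ln (a / s)\<close> minus a polynomial in \<open>s\<close>. Subtracting the Taylor
  polynomial of \<open>- ln (1 - q)\<close> makes the kernel vanish to order \<open>n + 1\<close> in
  \<open>q\<close> at the edge.\<close>

definition log_kernel :: "nat \<Rightarrow> real \<Rightarrow> real \<Rightarrow> real" where
  "log_kernel n a s = - ln (1 - cutoff a s) - (\<Sum>k=1..n. cutoff a s ^ k / k)"

lemma DERIV_log_remainder:
  fixes w :: real
  assumes "w < 1"
  shows "((\<lambda>w. - ln (1 - w) - (\<Sum>k=1..n. w ^ k / k)) has_real_derivative w ^ n / (1 - w)) (at w)"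
proof -
  have "(\<Sum>k=1..n. real k * w ^ (k - 1) / k) = (\<Sum>j<n. w ^ j)"
    by (rule sum.reindex_bij_witness[of _ Suc "\<lambda>k. k - 1"]) auto
  moreover have "1 / (1 - w) - (\<Sum>j<n. w ^ j) = w ^ n / (1 - w)"
    using assms one_diff_power_eq[of w n] by (simp add: field_simps)
  ultimately show ?thesis
    using assms by (auto intro!: derivative_eq_intros)
qed

text \<open>The geometric remainder \<open>q ^ n / (1 - q)\<close> becomes the inverse-square kernel
  since \<open>1 - q = s / a\<close> on the support. This ties the two families of kernels
  together.\<close>

lemma DERIV_log_kernel:
  assumes "a > 0" "n \<ge> 1" "s > 0"
  shows "((\<lambda>s. log_kernel n a s) has_real_derivative - (cutoff a s ^ n / s)) (at s)"
proof -
  let ?f = "\<lambda>w::real. - ln (1 - w) - (\<Sum>k=1..n. w ^ k / k)"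
  have "cutoff a s < 1" using assms by (simp add: cutoff_def)
  then have "((\<lambda>w. ?f (max 0 w)) has_real_derivative cutoff a s ^ n / (1 - cutoff a s)) (at (1 - s / a))"
    unfolding cutoff_def using assms by (intro DERIV_comp_max_0 DERIV_log_remainder) auto
  moreover have "((\<lambda>s. 1 - s / a) has_real_derivative - 1 / a) (at s)"
    using assms by (auto intro!: derivative_eq_intros)
  ultimately have "((\<lambda>s. ?f (max 0 (1 - s / a))) has_real_derivative cutoff a s ^ n / (1 - cutoff a s) * (- 1 / a)) (at s)"
    by (rule DERIV_chain2)
  then have "((\<lambda>s. log_kernel n a s) has_real_derivative cutoff a s ^ n / (1 - cutoff a s) * (- 1 / a)) (at s)"
    by (simp only: log_kernel_def cutoff_def)
  moreover have "cutoff a s ^ n / (1 - cutoff a s) * (- 1 / a) = - (cutoff a s ^ n / s)"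
    using assms by (cases "s < a") (auto simp: cutoff_eq cutoff_eq_0 power_0_left)
  ultimately show ?thesis by (rule DERIV_cong)
qed

lemma log_kernel_eq_0: "a > 0 \<Longrightarrow> s \<ge> a \<Longrightarrow> log_kernel n a s = 0"
  by (simp add: log_kernel_def cutoff_eq_0 power_0_left)

lemma log_kernel_measurable [measurable]: "log_kernel n a \<in> borel_measurable borel"
  unfolding log_kernel_def[abs_def] by measurable

lemma log_kernel_decreasing:
  assumes "a > 0" "n \<ge> 1" "0 < s" "s \<le> t"
  shows "log_kernel n a t \<le> log_kernel n a s"
  by (rule DERIV_nonpos_imp_nonincreasing[OF assms(4)])
    (use assms in \<open>auto intro!: exI[of _ "- (cutoff a _ ^ n / _)"] DERIV_log_kernel\<close>)

lemma log_kernel_plus_ln_increasing: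
  assumes "a > 0" "n \<ge> 1" "0 < s" "s \<le> t"
  shows "log_kernel n a s + ln s \<le> log_kernel n a t + ln t"
proof (rule DERIV_nonneg_imp_nondecreasing[OF assms(4)])
  fix r assume "s \<le> r" "r \<le> t"
  then have r: "r > 0" using assms by simp
  have "((\<lambda>s. log_kernel n a s + ln s) has_real_derivative - (cutoff a r ^ n / r) + 1 / r) (at r)"
    using r assms by (auto intro!: derivative_eq_intros DERIV_log_kernel)
  moreover have "- (cutoff a r ^ n / r) + 1 / r \<ge> 0"
    using r assms by (simp add: divide_right_mono power_le_one cutoff_le_1)
  ultimately show "\<exists>y. ((\<lambda>s. log_kernel n a s + ln s) has_real_derivative y) (at r) \<and> 0 \<le> y" by blast
qed

text \<open>The kernel decreases while its sum with \<open>ln\<close> increases, so its oscillation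
  is at most that of \<open>ln\<close>. The bound does not involve \<open>a\<close>, which makes it
  a majorant for the limit of large \<open>a\<close>.\<close>

lemma log_kernel_diff_bound:
  assumes "a > 0" "n \<ge> 1" "0 < s" "0 < t"
  shows "\<bar>log_kernel n a s - log_kernel n a t\<bar> \<le> \<bar>ln s - ln t\<bar>"
proof (cases "s \<le> t")
  case True
  then show ?thesis using log_kernel_decreasing[OF assms(1-3) True] log_kernel_plus_ln_increasing[OF assms(1-3) True] by linarith
next
  case False
  then show ?thesis
    using log_kernel_decreasing[OF assms(1,2,4), of s] log_kernel_plus_ln_increasing[OF assms(1,2,4), of s] by linarith
qed

text \<open>Comparison with \<open>s = a\<close>, where the kernel vanishes, gives
  \<open>ln (a / s)\<close>. The cruder \<open>a / s\<close> brings it under the inverse-square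
  estimates.\<close>

lemma log_kernel_bound:
  assumes "a > 0" "n \<ge> 1" "0 < s"
  shows "\<bar>log_kernel n a s\<bar> \<le> a / s"
proof (cases "s \<le> a")
  case True
  have "\<bar>log_kernel n a s\<bar> \<le> \<bar>ln s - ln a\<bar>"
    using log_kernel_diff_bound[of a n s a] assms by (simp add: log_kernel_eq_0)
  also have "\<dots> = ln (a / s)" using assms True by (simp add: ln_div)
  also have "\<dots> \<le> a / s" using ln_le_minus_one[of "a / s"] assms by simp
  finally show ?thesis .
qed (use assms in \<open>simp add: log_kernel_eq_0\<close>)

text \<open>With \<open>F' = - q ^ n / s\<close> the radial Laplacian is
  \<open>4 n q ^ (n - 1) / a - 4 q ^ n / s\<close>. All terms are at most of order
  \<open>1 / s\<close>, so every inner-scale integral vanishes as \<open>b m\<close> tends to 0 and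
  no point value of \<open>g\<close> is produced.\<close>

lemma log_kernel_green:
  fixes x :: "real^4"
  assumes g: "Ck 2 g" and a: "a > 0" and n: "n \<ge> 4"
  shows "(\<integral>y. log_kernel n a ((norm (x - y))\<^sup>2) * laplacian g y \<partial>lborel) =
    4 * real n / a * (\<integral>y. cutoff a ((norm (x - y))\<^sup>2) ^ (n - 1) * g y \<partial>lborel)
    - 4 * (\<integral>y. cutoff a ((norm (x - y))\<^sup>2) ^ n / (norm (x - y))\<^sup>2 * g y \<partial>lborel)"
proof -
  define b where "b m = a / real (Suc m)" for m
  have b: "0 < b m" "b m \<le> a" for m
    using a by (auto simp: b_def divide_le_eq mult_le_cancel_left1)
  have b0: "b \<longlonglongrightarrow> 0"
    unfolding b_def using tendsto_mult_right_zero[OF LIMSEQ_inverse_real_of_nat, of a] by (simp add: divide_inverse)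
  define h where "h = laplacian g"
  have cg: "continuous_on UNIV g" and ch: "continuous_on UNIV h"
    using Ck_continuous[OF g] Ck_continuous[OF Ck_laplacian[of 0 g]] g by (auto simp: numeral_2_eq_2 h_def)
  have [measurable]: "g \<in> borel_measurable borel" using cg by (rule borel_measurable_continuous_onI)
  define L where "L a s = 4 * n * (cutoff a s ^ (n - 1) / a) - 4 * (cutoff a s ^ n / s)" for a s
  have [measurable]: "L a \<in> borel_measurable borel" for a unfolding L_def[abs_def] by measurable
  define K where "K a = (\<integral>y. log_kernel n a ((norm (x - y))\<^sup>2) * h y \<partial>lborel)" for a
  define M where "M a = (\<integral>y. L a ((norm (x - y))\<^sup>2) * g y \<partial>lborel)" for a
  have bL: "\<bar>L a s\<bar> \<le> (4 * real n + 4) / s" if "a > 0" "s > 0" for a s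
  proof (cases "s \<le> a")
    case True
    have "cutoff a s ^ (n - 1) / a \<le> 1 / s" "cutoff a s ^ n / s \<le> 1 / s"
      using that True by (auto intro!: frac_le power_le_one cutoff_le_1)
    moreover have "cutoff a s ^ (n - 1) / a \<ge> 0" "cutoff a s ^ n / s \<ge> 0" using that by auto
    ultimately have "\<bar>L a s\<bar> \<le> 4 * n * (1 / s) + 4 * (1 / s)"
      unfolding L_def abs_le_iff by (smt (verit) mult_left_mono mult_nonneg_nonneg of_nat_0_le_iff)
    then show ?thesis by (simp add: add_divide_distrib)
  next
    case False
    then show ?thesis using that n by (simp add: L_def cutoff_eq_0 power_0_left)
  qed
  have L0: "L a s = 0" if "a > 0" "s > a" for a s
    using that n by (simp add: L_def cutoff_eq_0 power_0_left)
  have bK: "\<bar>log_kernel n (b m) s\<bar> \<le> a / s" if "s > 0" for m s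
    using log_kernel_bound[of "b m" n s] b[of m] n that divide_right_mono[of "b m" a s] by linarith
  have iK: "integrable lborel (\<lambda>y. log_kernel n a ((norm (x - y))\<^sup>2) * h y)" if "a > 0" for a
    by (rule singular_kernel_integrable[of "log_kernel n a" a a])
      (use that n in \<open>auto simp: ch log_kernel_eq_0 log_kernel_bound\<close>)
  have iM: "integrable lborel (\<lambda>y. L a ((norm (x - y))\<^sup>2) * g y)" if "a > 0" for a
    by (rule singular_kernel_integrable[of "L a" "4 * real n + 4" a])
      (use that n in \<open>auto simp: cg L0 bL\<close>)
  have D1: "((\<lambda>s. - (cutoff a s ^ n / s)) has_real_derivative real n * cutoff a s ^ (n - 1) / (a * s) + cutoff a s ^ n / s\<^sup>2) (at s)"
    if "a > 0" "s > 0" for a s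
    by (rule DERIV_cong[OF DERIV_minus[OF DERIV_cutoff_power_over]]) (use that n in auto)
  have cont: "continuous_on {0<..} (\<lambda>s. real n * cutoff a s ^ (n - 1) / (a * s) + cutoff a s ^ n / s\<^sup>2)" if "a > 0" for a
    using that by (intro continuous_intros) auto
  \<comment> \<open>The two copies of \<open>ln s\<close> cancel, leaving the constant
    \<open>ln a - ln (b m)\<close> and the difference of the two Taylor polynomials.\<close>
  have p: "log_kernel n a s - log_kernel n (b m) s = poly ([:ln a - ln (b m):] + (\<Sum>k=1..n. smult (1 / k) ([:1, - 1 / b m:] ^ k - [:1, - 1 / a:] ^ k))) s"
    if "0 < s" "s < b m" for s m
    using that b[of m] by (simp add: log_kernel_def cutoff_eq poly_sum ln_div sum_subtractf diff_divide_distrib)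
  have eq: "K a - K (b m) = M a - M (b m)" for m
  proof -
    have "K a - K (b m) = (\<integral>y. (log_kernel n a ((norm (x - y))\<^sup>2) - log_kernel n (b m) ((norm (x - y))\<^sup>2)) * h y \<partial>lborel)"
      using iK[OF a] iK[OF b(1)[of m]] by (simp add: K_def left_diff_distrib)
    also have "\<dots> = (\<integral>y. (8 * (- (cutoff a ((norm (x - y))\<^sup>2) ^ n / (norm (x - y))\<^sup>2) - - (cutoff (b m) ((norm (x - y))\<^sup>2) ^ n / (norm (x - y))\<^sup>2))
        + 4 * (norm (x - y))\<^sup>2 * ((real n * cutoff a ((norm (x - y))\<^sup>2) ^ (n - 1) / (a * (norm (x - y))\<^sup>2) + cutoff a ((norm (x - y))\<^sup>2) ^ n / ((norm (x - y))\<^sup>2)\<^sup>2)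
          - (real n * cutoff (b m) ((norm (x - y))\<^sup>2) ^ (n - 1) / (b m * (norm (x - y))\<^sup>2) + cutoff (b m) ((norm (x - y))\<^sup>2) ^ n / ((norm (x - y))\<^sup>2)\<^sup>2))) * g y \<partial>lborel)"
      unfolding h_def
      by (rule radial_green_punctured[where F = "\<lambda>s. log_kernel n a s - log_kernel n (b m) s" and a = a and b = "b m",
          OF DERIV_diff[OF DERIV_log_kernel DERIV_log_kernel] DERIV_diff[OF D1 D1] continuous_on_diff[OF cont cont] _ _ _ p g])
        (use a b[of m] n in \<open>auto simp: log_kernel_eq_0\<close>)
    also have "\<dots> = (\<integral>y. (L a ((norm (x - y))\<^sup>2) - L (b m) ((norm (x - y))\<^sup>2)) * g y \<partial>lborel)"
    proof (rule integral_cong_AE)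
      have alg: "8 * (- (Q / s) - - (Q' / s)) + 4 * s * ((P / (a * s) + Q / s\<^sup>2) - (P' / (b m * s) + Q' / s\<^sup>2))
         = (4 * (P / a) - 4 * (Q / s)) - (4 * (P' / b m) - 4 * (Q' / s))" if "s > 0" for s P Q P' Q' :: real
        using that a b(1)[of m] by (simp add: field_simps power2_eq_square)
      show "AE y in lborel. (8 * (- (cutoff a ((norm (x - y))\<^sup>2) ^ n / (norm (x - y))\<^sup>2) - - (cutoff (b m) ((norm (x - y))\<^sup>2) ^ n / (norm (x - y))\<^sup>2))
        + 4 * (norm (x - y))\<^sup>2 * ((real n * cutoff a ((norm (x - y))\<^sup>2) ^ (n - 1) / (a * (norm (x - y))\<^sup>2) + cutoff a ((norm (x - y))\<^sup>2) ^ n / ((norm (x - y))\<^sup>2)\<^sup>2)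
          - (real n * cutoff (b m) ((norm (x - y))\<^sup>2) ^ (n - 1) / (b m * (norm (x - y))\<^sup>2) + cutoff (b m) ((norm (x - y))\<^sup>2) ^ n / ((norm (x - y))\<^sup>2)\<^sup>2))) * g y =
        (L a ((norm (x - y))\<^sup>2) - L (b m) ((norm (x - y))\<^sup>2)) * g y"
        using AE_norm_diff_pos[of x]
      proof eventually_elim
        case (elim y)
        then have "(norm (x - y))\<^sup>2 > 0" by simp
        then show ?case unfolding alg[OF \<open>(norm (x - y))\<^sup>2 > 0\<close>] by (simp add: L_def)
      qed
    qed (measurable)
    also have "\<dots> = M a - M (b m)"
      using iM[OF a] iM[OF b(1)[of m]] by (simp add: M_def left_diff_distrib)
    finally show ?thesis .
  qed
  have K0: "(\<lambda>m. K (b m)) \<longlonglongrightarrow> 0"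
    unfolding K_def
    by (rule singular_kernel_tendsto_0[where k = "\<lambda>m. log_kernel n (b m)" and C = a and b = b and a = a])
      (use b b0 n bK in \<open>auto simp: ch log_kernel_eq_0\<close>)
  have M0: "(\<lambda>m. M (b m)) \<longlonglongrightarrow> 0"
    unfolding M_def
    by (rule singular_kernel_tendsto_0[where k = "\<lambda>m. L (b m)" and C = "4 * real n + 4" and b = b and a = a])
      (use b b0 n bL L0 in \<open>auto simp: cg\<close>)
  have "(\<lambda>m. K a - K (b m)) \<longlonglongrightarrow> K a - 0"
    by (intro tendsto_diff tendsto_const K0)
  moreover have "(\<lambda>m. K a - K (b m)) \<longlonglongrightarrow> M a - 0"
    unfolding eq by (intro tendsto_diff tendsto_const M0)
  ultimately have "K a = M a"
    by (metis LIMSEQ_unique diff_zero)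
  also have "M a = 4 * real n / a * (\<integral>y. cutoff a ((norm (x - y))\<^sup>2) ^ (n - 1) * g y \<partial>lborel)
    - 4 * (\<integral>y. cutoff a ((norm (x - y))\<^sup>2) ^ n / (norm (x - y))\<^sup>2 * g y \<partial>lborel)"
  proof -
    have i1: "integrable lborel (\<lambda>y. cutoff a ((norm (x - y))\<^sup>2) ^ (n - 1) * g y)"
      using n by (intro integrable_cutoff_power a cg) auto
    have i2: "integrable lborel (\<lambda>y. cutoff a ((norm (x - y))\<^sup>2) ^ n / (norm (x - y))\<^sup>2 * g y)"
      by (rule singular_kernel_integrable[of "\<lambda>s. cutoff a s ^ n / s" 1 a])
        (use a n in \<open>auto simp: cg cutoff_eq_0 divide_right_mono power_le_one cutoff_le_1\<close>)
    have "M a = (\<integral>y. 4 * real n / a * (cutoff a ((norm (x - y))\<^sup>2) ^ (n - 1) * g y) - 4 * (cutoff a ((norm (x - y))\<^sup>2) ^ n / (norm (x - y))\<^sup>2 * g y) \<partial>lborel)"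
      by (simp add: M_def L_def algebra_simps)
    then show ?thesis
      using Bochner_Integration.integral_diff[OF integrable_mult_right[OF i1, of "4 * real n / a"] integrable_mult_right[OF i2, of 4]]
      by (simp only: integral_mult_right_zero)
  qed
  finally show ?thesis by (simp add: K_def h_def)
qed

text \<open>The factor \<open>s\<close> in \<open>4 s F''\<close> is absorbed through
  \<open>s / a = 1 - q\<close> on the support, so the result is again a combination of powers of
  \<open>q\<close> alone.\<close>

lemma cutoff_power_green:
  fixes x :: "real^4"
  assumes g: "Ck 2 g" and a: "a > 0" and n: "n \<ge> 4"
  shows "(\<integral>y. cutoff a ((norm (x - y))\<^sup>2) ^ n * laplacian g y \<partial>lborel) =
    (\<integral>y. 4 * real n / a * ((real n - 1) * cutoff a ((norm (x - y))\<^sup>2) ^ (n - 2) - (real n + 1) * cutoff a ((norm (x - y))\<^sup>2) ^ (n - 1)) * g y \<partial>lborel)"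
proof -
  have s: "s / a * cutoff a s ^ (n - 2) = cutoff a s ^ (n - 2) - cutoff a s ^ (n - 1)" for s
  proof (cases "s \<le> a")
    case True
    have "n - 1 = Suc (n - 2)" using n by simp
    then show ?thesis using True a by (simp add: cutoff_eq algebra_simps)
  next
    case False
    then show ?thesis using a n by (simp add: cutoff_eq_0 power_0_left)
  qed
  have lap: "8 * (- (real n * cutoff a s ^ (n - 1) / a)) + 4 * s * (- (real n * - (real (n - 1) * cutoff a s ^ (n - 2) / a) / a)) =
     4 * real n / a * ((real n - 1) * cutoff a s ^ (n - 2) - (real n + 1) * cutoff a s ^ (n - 1))" for s
  proof -
    have "4 * s * (- (real n * - (real (n - 1) * cutoff a s ^ (n - 2) / a) / a)) = 4 * real n / a * (real n - 1) * (s / a * cutoff a s ^ (n - 2))"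
      using n by (simp add: of_nat_diff)
    also have "\<dots> = 4 * real n / a * (real n - 1) * (cutoff a s ^ (n - 2) - cutoff a s ^ (n - 1))"
      by (simp only: s)
    finally have 1: "4 * s * (- (real n * - (real (n - 1) * cutoff a s ^ (n - 2) / a) / a)) = \<dots>" .
    have 2: "8 * (- (real n * Y / a)) + 4 * real n / a * (real n - 1) * (X - Y) = 4 * real n / a * ((real n - 1) * X - (real n + 1) * Y)" for X Y
      using a by (simp add: field_simps)
    show ?thesis by (simp only: 1 2)
  qed
  have n2: "n - 1 - 1 = n - 2" by simp
  have "(\<integral>y. cutoff a ((norm (x - y))\<^sup>2) ^ n * laplacian g y \<partial>lborel) =
    (\<integral>y. (8 * (- (real n * cutoff a ((norm (x - y))\<^sup>2) ^ (n - 1) / a)) + 4 * (norm (x - y))\<^sup>2 *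
       (- (real n * - (real (n - 1) * cutoff a ((norm (x - y))\<^sup>2) ^ (n - 2) / a) / a))) * g y \<partial>lborel)"
  proof (rule radial_green[where F = "\<lambda>s. cutoff a s ^ n" and a = a])
    show "((\<lambda>s. cutoff a s ^ n) has_real_derivative - (real n * cutoff a s ^ (n - 1) / a)) (at s)" for s
      using a n by (intro DERIV_cutoff_power) auto
    show "((\<lambda>s. - (real n * cutoff a s ^ (n - 1) / a)) has_real_derivative
        - (real n * - (real (n - 1) * cutoff a s ^ (n - 2) / a) / a)) (at s)" for s
      by (rule DERIV_minus[OF DERIV_cdivide[OF DERIV_cmult[OF DERIV_cutoff_power[of a "n - 1", unfolded n2]]]])
        (use a n in auto)
  qed (use a n g in \<open>auto simp: cutoff_eq_0 power_0_left intro!: continuous_intros\<close>)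
  then show ?thesis by (simp only: lap)
qed

section \<open>Quadratic polynomials and their pointwise limits\<close>

lemma quadratic_form_sum:
  fixes x :: "real^4" and A :: "real^4^4"
  shows "x \<bullet> (A *v x) = (\<Sum>i\<in>UNIV. \<Sum>j\<in>UNIV. x $ i * x $ j * A $ i $ j)"
  by (simp add: inner_vec_def matrix_vector_mult_def sum_distrib_left mult_ac)

text \<open>A quadratic polynomial is a fixed linear combination of finitely many of its values, so pointwise limits of
  quadratic polynomials are again quadratic.\<close>

lemma poly_deg_le2_interpolation:
  assumes "poly_deg_le2 P"
  shows "P x = P 0 + (\<Sum>i\<in>UNIV. x $ i * ((P (axis i 1) - P (- axis i 1)) / 2)) +
    (\<Sum>i\<in>UNIV. \<Sum>j\<in>UNIV. x $ i * x $ j * ((P (axis i 1 + axis j 1) - P (axis i 1) - P (axis j 1) + P 0) / 2))"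
proof -
  obtain c and b :: "real^4" and A :: "real^4^4" where P: "\<And>x. P x = c + b \<bullet> x + x \<bullet> (A *v x)"
    using assms unfolding poly_deg_le2_def by blast
  have e: "axis i 1 \<bullet> (A *v axis j 1) = A $ i $ j" for i j
    by (simp add: inner_axis' matrix_vector_mult_basis column_def)
  have neg: "(- y) \<bullet> (A *v (- y)) = y \<bullet> (A *v y)" for y
    by (simp add: quadratic_form_sum)
  have 1: "(P (axis i 1) - P (- axis i 1)) / 2 = b $ i" for i
    by (simp add: P inner_axis neg[simplified])
  \<comment> \<open>Second differences see only the symmetric part of \<open>A\<close>; swapping the
    summation indices shows that it has the same quadratic form.\<close>
  have 2: "(P (axis i 1 + axis j 1) - P (axis i 1) - P (axis j 1) + P 0) / 2 = (A $ i $ j + A $ j $ i) / 2" for i j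
    by (simp add: P inner_simps matrix_vector_right_distrib e)
  have "(\<Sum>i\<in>UNIV. \<Sum>j\<in>UNIV. x $ i * x $ j * ((A $ i $ j + A $ j $ i) / 2)) =
      ((\<Sum>i\<in>UNIV. \<Sum>j\<in>UNIV. x $ i * x $ j * A $ i $ j) + (\<Sum>i\<in>UNIV. \<Sum>j\<in>UNIV. x $ i * x $ j * A $ j $ i)) / 2"
    by (simp add: sum_divide_distrib sum.distrib[symmetric] field_simps)
  also have "(\<Sum>i\<in>UNIV. \<Sum>j\<in>UNIV. x $ i * x $ j * A $ j $ i) = (\<Sum>i\<in>UNIV. \<Sum>j\<in>UNIV. x $ i * x $ j * A $ i $ j)"
    by (subst sum.swap) (simp add: mult_ac)
  finally show ?thesis
    unfolding 1 2 unfolding P quadratic_form_sum by (simp add: inner_vec_def mult.commute)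
qed

lemma poly_deg_le2_sum:
  assumes "\<And>x. P x = c + (\<Sum>i\<in>UNIV. x $ i * b i) + (\<Sum>i\<in>UNIV. \<Sum>j\<in>UNIV. x $ i * x $ j * A i j)"
  shows "poly_deg_le2 P"
  unfolding poly_deg_le2_def
  by (rule exI[of _ c], rule exI[of _ "\<chi> i. b i"], rule exI[of _ "\<chi> i j. A i j"])
    (simp add: assms quadratic_form_sum, simp add: inner_vec_def mult.commute)

lemma poly_deg_le2_tendsto:
  assumes P: "\<And>k::nat. poly_deg_le2 (P k)" and lim: "\<And>x. (\<lambda>k. P k x) \<longlonglongrightarrow> h x"
  shows "poly_deg_le2 h"
proof (rule poly_deg_le2_sum)
  fix x
  have "(\<lambda>k. P k 0 + (\<Sum>i\<in>UNIV. x $ i * ((P k (axis i 1) - P k (- axis i 1)) / 2)) +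
    (\<Sum>i\<in>UNIV. \<Sum>j\<in>UNIV. x $ i * x $ j * ((P k (axis i 1 + axis j 1) - P k (axis i 1) - P k (axis j 1) + P k 0) / 2))) \<longlonglongrightarrow>
   h 0 + (\<Sum>i\<in>UNIV. x $ i * ((h (axis i 1) - h (- axis i 1)) / 2)) +
    (\<Sum>i\<in>UNIV. \<Sum>j\<in>UNIV. x $ i * x $ j * ((h (axis i 1 + axis j 1) - h (axis i 1) - h (axis j 1) + h 0) / 2))"
    by (intro tendsto_intros lim) simp_all
  then show "h x = h 0 + (\<Sum>i\<in>UNIV. x $ i * ((h (axis i 1) - h (- axis i 1)) / 2)) +
    (\<Sum>i\<in>UNIV. \<Sum>j\<in>UNIV. x $ i * x $ j * ((h (axis i 1 + axis j 1) - h (axis i 1) - h (axis j 1) + h 0) / 2))"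
    using LIMSEQ_unique[OF lim[of x]] poly_deg_le2_interpolation[OF P, of _ x] by simp
qed

lemma poly_deg_le2_affine:
  assumes "poly_deg_le2 P"
  shows "poly_deg_le2 (\<lambda>x. d + m * P x)"
proof -
  obtain c and b :: "real^4" and A :: "real^4^4" where P: "\<And>x. P x = c + b \<bullet> x + x \<bullet> (A *v x)"
    using assms unfolding poly_deg_le2_def by blast
  show ?thesis
    unfolding poly_deg_le2_def
    by (rule exI[of _ "d + m * c"], rule exI[of _ "m *\<^sub>R b"], rule exI[of _ "m *\<^sub>R A"])
      (simp add: P algebra_simps scaleR_matrix_vector_assoc[symmetric])
qed

section \<open>Taylor estimates for truncated powers\<close>

text \<open>The truncated cube is only C2, but its third derivative is bounded, so the third-order
  remainder survives. If \<open>t\<close> and \<open>t + d\<close> have opposite signs, both are at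
  most \<open>\<bar>d\<bar>\<close> in modulus.\<close>

lemma cubic_taylor_max_0:
  fixes t d :: real
  shows "\<bar>max 0 (t + d) ^ 3 - max 0 t ^ 3 - 3 * max 0 t ^ 2 * d - 3 * max 0 t * d\<^sup>2\<bar> \<le> 2 * \<bar>d\<bar> ^ 3"
proof -
  have p: "\<bar>d ^ 3\<bar> = \<bar>d\<bar> ^ 3" by (simp add: power_abs)
  consider "t \<ge> 0" "t + d \<ge> 0" | "t \<ge> 0" "t + d < 0" | "t < 0" "t + d \<ge> 0" | "t < 0" "t + d < 0" by linarith
  then show ?thesis
  proof cases
    case 1
    then have "max 0 (t + d) ^ 3 - max 0 t ^ 3 - 3 * max 0 t ^ 2 * d - 3 * max 0 t * d\<^sup>2 = d ^ 3"
      by (simp add: power2_eq_square power3_eq_cube algebra_simps)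
    then show ?thesis using p by simp
  next
    case 2
    then have "max 0 (t + d) ^ 3 - max 0 t ^ 3 - 3 * max 0 t ^ 2 * d - 3 * max 0 t * d\<^sup>2 = d ^ 3 - (t + d) ^ 3"
      by (simp add: power2_eq_square power3_eq_cube algebra_simps)
    moreover have "\<bar>(t + d) ^ 3\<bar> \<le> \<bar>d\<bar> ^ 3"
      unfolding power_abs using 2 by (intro power_mono) auto
    ultimately show ?thesis using p by linarith
  next
    case 3
    then have "max 0 (t + d) ^ 3 - max 0 t ^ 3 - 3 * max 0 t ^ 2 * d - 3 * max 0 t * d\<^sup>2 = (t + d) ^ 3"
      by simp
    moreover have "\<bar>(t + d) ^ 3\<bar> \<le> \<bar>d\<bar> ^ 3"
      unfolding power_abs using 3 by (intro power_mono) auto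
    ultimately show ?thesis by simp
  qed simp
qed

text \<open>Stopping at second order leaves \<open>4 t d ^ 3 + d ^ 4\<close>; the bounds on
  \<open>t\<close> and \<open>d\<close> turn this into a multiple of
  \<open>\<bar>d\<bar> ^ 3\<close>.\<close>

lemma quartic_taylor_max_0:
  fixes t d :: real
  assumes "t \<le> 1" "\<bar>d\<bar> \<le> 1"
  shows "\<bar>max 0 (t + d) ^ 4 - max 0 t ^ 4 - 4 * max 0 t ^ 3 * d - 6 * max 0 t ^ 2 * d\<^sup>2\<bar> \<le> 6 * \<bar>d\<bar> ^ 3"
proof -
  have p: "\<bar>d ^ 4\<bar> \<le> \<bar>d\<bar> ^ 3"
    unfolding power_abs using assms by (intro power_decreasing) auto
  have q: "\<bar>4 * t * d ^ 3\<bar> \<le> 4 * \<bar>d\<bar> ^ 3" if "t \<ge> 0"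
    using that assms by (simp add: abs_mult power_abs mult_left_le_one_le)
  have r: "\<bar>(t + d) ^ 4\<bar> \<le> \<bar>d\<bar> ^ 3" if "\<bar>t + d\<bar> \<le> \<bar>d\<bar>"
  proof -
    have "\<bar>(t + d) ^ 4\<bar> \<le> \<bar>d\<bar> ^ 4" unfolding power_abs using that by (intro power_mono) auto
    also have "\<dots> \<le> \<bar>d\<bar> ^ 3" using assms by (intro power_decreasing) auto
    finally show ?thesis .
  qed
  consider "t \<ge> 0" "t + d \<ge> 0" | "t \<ge> 0" "t + d < 0" | "t < 0" "t + d \<ge> 0" | "t < 0" "t + d < 0" by linarith
  then show ?thesis
  proof cases
    case 1
    then have "max 0 (t + d) ^ 4 - max 0 t ^ 4 - 4 * max 0 t ^ 3 * d - 6 * max 0 t ^ 2 * d\<^sup>2 = 4 * t * d ^ 3 + d ^ 4"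
      by (simp add: power2_eq_square power3_eq_cube power4_eq_xxxx algebra_simps)
    then show ?thesis using p q 1 by linarith
  next
    case 2
    then have "max 0 (t + d) ^ 4 - max 0 t ^ 4 - 4 * max 0 t ^ 3 * d - 6 * max 0 t ^ 2 * d\<^sup>2 = 4 * t * d ^ 3 + d ^ 4 - (t + d) ^ 4"
      by (simp add: power2_eq_square power3_eq_cube power4_eq_xxxx algebra_simps)
    then show ?thesis using p q 2 r by linarith
  next
    case 3
    then have "max 0 (t + d) ^ 4 - max 0 t ^ 4 - 4 * max 0 t ^ 3 * d - 6 * max 0 t ^ 2 * d\<^sup>2 = (t + d) ^ 4"
      by simp
    then show ?thesis using 3 r by linarith
  qed simp
qed

section \<open>Integrability of the exponential; quadratic moments\<close>

text \<open>The weight vanishes on the unit sphere and cannot simply be divided out. Continuity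
  handles the ball of radius \<open>2 powr (1 / p)\<close>; outside it the weight has modulus at
  least 1.\<close>

lemma integrable_exp:
  fixes u :: "real^4 \<Rightarrow> real"
  assumes p: "p > 0" and u: "continuous_on UNIV u"
    and int: "integrable lborel (\<lambda>y. (1 - norm y powr p) * exp (4 * u y))"
  shows "integrable lborel (\<lambda>y. exp (4 * u y))"
proof -
  have [measurable]: "u \<in> borel_measurable borel" using u by (rule borel_measurable_continuous_onI)
  define r :: real where "r = 2 powr (1 / p)"
  have i: "integrable lborel (\<lambda>y. indicator (cball 0 r) y *\<^sub>R exp (4 * u y))"
    by (rule borel_integrable_compact) (auto intro!: continuous_intros continuous_on_subset[OF u])
  show ?thesis
  proof (rule Bochner_Integration.integrable_bound[OF Bochner_Integration.integrable_add[OF integrable_norm[OF int] i]])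
    show "AE y in lborel. norm (exp (4 * u y)) \<le> norm (norm ((1 - norm y powr p) * exp (4 * u y)) + indicator (cball 0 r) y *\<^sub>R exp (4 * u y))"
    proof (rule AE_I2)
      fix y :: "real^4"
      show "norm (exp (4 * u y)) \<le> norm (norm ((1 - norm y powr p) * exp (4 * u y)) + indicator (cball 0 r) y *\<^sub>R exp (4 * u y))"
      proof (cases "norm y \<le> r")
        case False
        have "2 = r powr p" using p by (simp add: r_def powr_powr)
        also have "\<dots> \<le> norm y powr p"
          using False p by (intro powr_mono2) (auto simp: r_def)
        finally have "1 * exp (4 * u y) \<le> \<bar>1 - norm y powr p\<bar> * exp (4 * u y)"
          by (intro mult_right_mono) auto
        then show ?thesis using False by (simp add: abs_mult)
      qed simp
    qed
  qed auto
qed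

text \<open>The integrand has the shape of a kernel expanded to second order in \<open>x\<close>.
  Multiplying out leaves moments of \<open>\<alpha>\<close> and \<open>\<beta>\<close> as
  coefficients, and \<open>x \<bullet> x\<close> contributes to the diagonal.\<close>

lemma integral_quadratic:
  fixes \<alpha> \<beta> :: "real^4 \<Rightarrow> real"
  assumes \<alpha>: "continuous_on UNIV \<alpha>" "\<And>y. norm y > r \<Longrightarrow> \<alpha> y = 0"
    and \<beta>: "continuous_on UNIV \<beta>" "\<And>y. norm y > r \<Longrightarrow> \<beta> y = 0"
  shows "poly_deg_le2 (\<lambda>x. \<integral>y. \<alpha> y * (2 * (x \<bullet> y) - x \<bullet> x) + \<beta> y * (x \<bullet> y)\<^sup>2 \<partial>lborel)"
proof (rule poly_deg_le2_sum)
  fix x :: "real^4"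
  have int: "integrable lborel f" if "continuous_on UNIV f" "\<And>y. norm y > r \<Longrightarrow> f y = 0" for f :: "real^4 \<Rightarrow> real"
    by (rule integrable_compact_support[of _ r 0]) (use that in auto)
  define I where "I = (\<lambda>i. \<integral>y. \<alpha> y * y $ i \<partial>lborel)"
  define J where "J = (\<lambda>i j. \<integral>y. \<beta> y * (y $ i * y $ j) \<partial>lborel)"
  have h1: "has_bochner_integral lborel (\<lambda>y. \<alpha> y * y $ i) (I i)" for i
    unfolding I_def by (intro has_bochner_integral_integrable int continuous_intros \<alpha>) (auto simp: \<alpha>)
  have h2: "has_bochner_integral lborel (\<lambda>y. \<beta> y * (y $ i * y $ j)) (J i j)" for i j
    unfolding J_def by (intro has_bochner_integral_integrable int continuous_intros \<beta>) (auto simp: \<beta>)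
  have h0: "has_bochner_integral lborel \<alpha> (integral\<^sup>L lborel \<alpha>)"
    by (intro has_bochner_integral_integrable int \<alpha>)
  have "has_bochner_integral lborel (\<lambda>y. (\<Sum>i\<in>UNIV. x $ i * 2 * (\<alpha> y * y $ i)) - (x \<bullet> x) * \<alpha> y + (\<Sum>i\<in>UNIV. \<Sum>j\<in>UNIV. x $ i * x $ j * (\<beta> y * (y $ i * y $ j))))
     ((\<Sum>i\<in>UNIV. x $ i * 2 * I i) - (x \<bullet> x) * integral\<^sup>L lborel \<alpha> + (\<Sum>i\<in>UNIV. \<Sum>j\<in>UNIV. x $ i * x $ j * J i j))"
    by (intro has_bochner_integral_add has_bochner_integral_diff has_bochner_integral_sum has_bochner_integral_mult_right h0 h1 h2)
  moreover have "(\<Sum>i\<in>UNIV. x $ i * 2 * (\<alpha> y * y $ i)) - (x \<bullet> x) * \<alpha> y + (\<Sum>i\<in>UNIV. \<Sum>j\<in>UNIV. x $ i * x $ j * (\<beta> y * (y $ i * y $ j)))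
     = \<alpha> y * (2 * (x \<bullet> y) - x \<bullet> x) + \<beta> y * (x \<bullet> y)\<^sup>2" for y
  proof -
    have "(x \<bullet> y)\<^sup>2 = (\<Sum>i\<in>UNIV. \<Sum>j\<in>UNIV. x $ i * x $ j * (y $ i * y $ j))"
      by (simp add: power2_eq_square inner_vec_def sum_product mult_ac)
    moreover have "x \<bullet> y = (\<Sum>i\<in>UNIV. x $ i * y $ i)" by (simp add: inner_vec_def)
    ultimately show ?thesis by (simp add: algebra_simps sum_distrib_left)
  qed
  ultimately have eq: "(\<integral>y. \<alpha> y * (2 * (x \<bullet> y) - x \<bullet> x) + \<beta> y * (x \<bullet> y)\<^sup>2 \<partial>lborel) =
     (\<Sum>i\<in>UNIV. x $ i * 2 * I i) - (x \<bullet> x) * integral\<^sup>L lborel \<alpha> + (\<Sum>i\<in>UNIV. \<Sum>j\<in>UNIV. x $ i * x $ j * J i j)"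
    by (simp add: has_bochner_integral_integral_eq)
  have xx: "(x \<bullet> x) * s = (\<Sum>i\<in>UNIV. \<Sum>j\<in>UNIV. x $ i * x $ j * (if i = j then s else 0))" for s
    by (simp add: inner_vec_def sum_distrib_right if_distrib cong: if_cong)
  show "(\<integral>y. \<alpha> y * (2 * (x \<bullet> y) - x \<bullet> x) + \<beta> y * (x \<bullet> y)\<^sup>2 \<partial>lborel) =
     0 + (\<Sum>i\<in>UNIV. x $ i * (2 * I i)) + (\<Sum>i\<in>UNIV. \<Sum>j\<in>UNIV. x $ i * x $ j * (J i j - (if i = j then integral\<^sup>L lborel \<alpha> else 0)))"
    unfolding eq xx by (simp add: right_diff_distrib sum_subtractf mult.assoc)
qed

section \<open>Representation formulas at a finite scale\<close>

lemma Ck_4_laplacian: "Ck 4 u \<Longrightarrow> Ck 2 (laplacian u)"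
proof (rule Ck_laplacian)
  have "Suc (Suc 2) = (4::nat)" by simp
  then show "Ck 4 u \<Longrightarrow> Ck (Suc (Suc 2)) u" by (simp only:)
qed

lemma Ck_2_laplacian_continuous: "Ck 2 g \<Longrightarrow> continuous_on UNIV (laplacian g)"
  by (rule Ck_continuous[of 0], rule Ck_laplacian) (simp only: numeral_2_eq_2)

text \<open>\<open>laplacian_representation\<close> with \<open>n = 6\<close> gives
  \<open>120 q ^ 4\<close> and an inverse-square term in \<open>laplacian u\<close>. The logarithmic
  identity trades that term for \<open>q ^ 5\<close>, and \<open>cutoff_power_green\<close> trades
  \<open>q ^ 5\<close> for \<open>480 q ^ 3 - 720 q ^ 4\<close>. Starting at 6 leaves
  \<open>q ^ 3\<close> as lowest power, which is still C2.\<close>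

lemma biharmonic_representation:
  fixes x :: "real^4"
  assumes u: "Ck 4 u" and a: "a > 0"
  shows "4 * pi\<^sup>2 * u x =
    (\<integral>y. (840 * cutoff a ((norm (x - y))\<^sup>2) ^ 4 - 480 * cutoff a ((norm (x - y))\<^sup>2) ^ 3) / a\<^sup>2 * u y \<partial>lborel) +
    (\<integral>y. log_kernel 6 a ((norm (x - y))\<^sup>2) * laplacian (laplacian u) y \<partial>lborel) / 4"
proof -
  have u2: "Ck 2 u" by (rule Ck_le[OF u]) simp
  note g2 = Ck_4_laplacian[OF u]
  have cu: "continuous_on UNIV u" by (rule Ck_continuous[OF u])
  define E where "E = (\<integral>y. cutoff a ((norm (x - y))\<^sup>2) ^ 6 / (norm (x - y))\<^sup>2 * laplacian u y \<partial>lborel)"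
  define Q where "Q k = (\<integral>y. cutoff a ((norm (x - y))\<^sup>2) ^ k * u y \<partial>lborel)" for k
  have i3: "integrable lborel (\<lambda>y. cutoff a ((norm (x - y))\<^sup>2) ^ 3 * u y)"
    and i4: "integrable lborel (\<lambda>y. cutoff a ((norm (x - y))\<^sup>2) ^ 4 * u y)"
    by (intro integrable_cutoff_power[OF a _ cu]; simp)+
  have "4 * pi\<^sup>2 * u x = (\<integral>y. 120 / a\<^sup>2 * (cutoff a ((norm (x - y))\<^sup>2) ^ 4 * u y) \<partial>lborel) - E"
    using laplacian_representation[OF u2 a, of 6 x] by (simp add: E_def mult.assoc)
  then have 1: "4 * pi\<^sup>2 * u x = 120 / a\<^sup>2 * Q 4 - E"
    by (simp only: integral_mult_right_zero Q_def)
  have 2: "(\<integral>y. log_kernel 6 a ((norm (x - y))\<^sup>2) * laplacian (laplacian u) y \<partial>lborel) =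
     24 / a * (\<integral>y. cutoff a ((norm (x - y))\<^sup>2) ^ 5 * laplacian u y \<partial>lborel) - 4 * E"
    using log_kernel_green[OF g2 a, of 6 x] by (simp add: E_def)
  have "(\<integral>y. cutoff a ((norm (x - y))\<^sup>2) ^ 5 * laplacian u y \<partial>lborel) =
     (\<integral>y. 80 / a * (cutoff a ((norm (x - y))\<^sup>2) ^ 3 * u y) - 120 / a * (cutoff a ((norm (x - y))\<^sup>2) ^ 4 * u y) \<partial>lborel)"
    using cutoff_power_green[OF u2 a, of 5 x] by (simp add: algebra_simps diff_divide_distrib)
  also have "\<dots> = 80 / a * Q 3 - 120 / a * Q 4"
    using Bochner_Integration.integral_diff[OF integrable_mult_right[OF i3, of "80 / a"] integrable_mult_right[OF i4, of "120 / a"]]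
    by (simp only: integral_mult_right_zero Q_def)
  finally have 3: "(\<integral>y. cutoff a ((norm (x - y))\<^sup>2) ^ 5 * laplacian u y \<partial>lborel) = 80 / a * Q 3 - 120 / a * Q 4" .
  have "(\<integral>y. (840 * cutoff a ((norm (x - y))\<^sup>2) ^ 4 - 480 * cutoff a ((norm (x - y))\<^sup>2) ^ 3) / a\<^sup>2 * u y \<partial>lborel) =
     (\<integral>y. 840 / a\<^sup>2 * (cutoff a ((norm (x - y))\<^sup>2) ^ 4 * u y) - 480 / a\<^sup>2 * (cutoff a ((norm (x - y))\<^sup>2) ^ 3 * u y) \<partial>lborel)"
    by (simp add: algebra_simps diff_divide_distrib)
  also have "\<dots> = 840 / a\<^sup>2 * Q 4 - 480 / a\<^sup>2 * Q 3"
    using Bochner_Integration.integral_diff[OF integrable_mult_right[OF i4, of "840 / a\<^sup>2"] integrable_mult_right[OF i3, of "480 / a\<^sup>2"]]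
    by (simp only: integral_mult_right_zero Q_def)
  finally have 4: "(\<integral>y. (840 * cutoff a ((norm (x - y))\<^sup>2) ^ 4 - 480 * cutoff a ((norm (x - y))\<^sup>2) ^ 3) / a\<^sup>2 * u y \<partial>lborel) =
     840 / a\<^sup>2 * Q 4 - 480 / a\<^sup>2 * Q 3" .
  show ?thesis
    unfolding 1 2 3 4 using a by (simp add: field_simps power2_eq_square)
qed

text \<open>The kernel \<open>120 q ^ 4 / a ^ 2\<close> from \<open>laplacian_representation\<close>
  is moved onto \<open>u\<close> by one more Green identity with factor \<open>16 / a\<close>; hence
  1920. The lowest power is now \<open>q ^ 2\<close>, enough for a Lipschitz bound.\<close>

lemma laplacian_biharmonic_representation:
  fixes x :: "real^4"
  assumes u: "Ck 4 u" and a: "a > 0"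
  shows "4 * pi\<^sup>2 * laplacian u x =
    (\<integral>y. 1920 / a ^ 3 * ((3 * cutoff a ((norm (x - y))\<^sup>2) ^ 2 - 5 * cutoff a ((norm (x - y))\<^sup>2) ^ 3) * u y) \<partial>lborel) -
    (\<integral>y. cutoff a ((norm (x - y))\<^sup>2) ^ 6 / (norm (x - y))\<^sup>2 * laplacian (laplacian u) y \<partial>lborel)"
proof -
  have u2: "Ck 2 u" by (rule Ck_le[OF u]) simp
  note g2 = Ck_4_laplacian[OF u]
  have "(\<integral>y. 120 / a\<^sup>2 * cutoff a ((norm (x - y))\<^sup>2) ^ 4 * laplacian u y \<partial>lborel) =
      120 / a\<^sup>2 * (\<integral>y. cutoff a ((norm (x - y))\<^sup>2) ^ 4 * laplacian u y \<partial>lborel)"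
    by (simp only: mult.assoc integral_mult_right_zero)
  also have "\<dots> = 120 / a\<^sup>2 * (\<integral>y. 16 / a * ((3 * cutoff a ((norm (x - y))\<^sup>2) ^ 2 - 5 * cutoff a ((norm (x - y))\<^sup>2) ^ 3) * u y) \<partial>lborel)"
  proof -
    have "4 * real 4 / a * ((real 4 - 1) * P - (real 4 + 1) * Q) * v = 16 / a * ((3 * P - 5 * Q) * v)" for P Q v
      by simp
    moreover have "(4::nat) - 2 = 2" "(4::nat) - 1 = 3" by simp_all
    ultimately show ?thesis
      using cutoff_power_green[OF u2 a, of 4 x] by (simp only: order_refl)
  qed
  also have "\<dots> = (\<integral>y. 1920 / a ^ 3 * ((3 * cutoff a ((norm (x - y))\<^sup>2) ^ 2 - 5 * cutoff a ((norm (x - y))\<^sup>2) ^ 3) * u y) \<partial>lborel)"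
    by (simp only: integral_mult_right_zero) (simp add: power2_eq_square power3_eq_cube)
  finally show ?thesis
    using laplacian_representation[OF g2 a, of 6 x] by simp
qed

section \<open>Growth of the local mass of the solution\<close>

text \<open>Integrability of \<open>f\<close> is not assumed: otherwise the integral is 0 by
  convention, and the right side is nonnegative.\<close>

lemma abs_integral_le:
  fixes f :: "'a::euclidean_space \<Rightarrow> real"
  assumes "integrable lborel g" "AE y in lborel. \<bar>f y\<bar> \<le> g y"
  shows "\<bar>\<integral>y. f y \<partial>lborel\<bar> \<le> (\<integral>y. g y \<partial>lborel)"
proof (cases "integrable lborel f")
  case True
  have "\<bar>\<integral>y. f y \<partial>lborel\<bar> \<le> (\<integral>y. \<bar>f y\<bar> \<partial>lborel)" by (rule integral_abs_bound)
  also have "\<dots> \<le> (\<integral>y. g y \<partial>lborel)"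
    using True assms by (intro integral_mono_AE) auto
  finally show ?thesis .
next
  case False
  have "AE y in lborel. 0 \<le> g y" using assms(2) by eventually_elim linarith
  then show ?thesis using False by (simp add: not_integrable_integral_eq integral_nonneg_AE)
qed

text \<open>The combination of the representations of \<open>u 0\<close> and \<open>laplacian u 0\<close> is chosen such that \<open>u\<close> is only
  integrated against the nonnegative kernel \<open>q ^ 4\<close>.\<close>

lemma integral_ball_growth:
  assumes u: "Ck 4 u" and f: "integrable lborel (laplacian (laplacian u))"
    and e: "integrable lborel (\<lambda>y. exp (4 * u y))"
  obtains C where "C \<ge> 0" "\<And>R. R \<ge> 1 \<Longrightarrow> (\<integral>y. indicator (cball 0 R) y * \<bar>u y\<bar> \<partial>lborel) \<le> C * R ^ 6"
proof -
  define g where "g = laplacian u"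
  define h where "h = laplacian g"
  have u2: "Ck 2 u" by (rule Ck_le[OF u]) simp
  have g2: "Ck 2 g" unfolding g_def by (rule Ck_4_laplacian[OF u])
  have cu: "continuous_on UNIV u" by (rule Ck_continuous[OF u])
  have ch: "continuous_on UNIV h" unfolding h_def by (rule Ck_2_laplacian_continuous[OF g2])
  have [measurable]: "u \<in> borel_measurable borel" using cu by (rule borel_measurable_continuous_onI)
  have ih: "integrable lborel h" using f by (simp add: g_def h_def)
  define F where "F = (\<integral>y. \<bar>h y\<bar> / (norm (0 - y))\<^sup>2 \<partial>lborel)"
  have iF: "integrable lborel (\<lambda>y. \<bar>h y\<bar> / (norm (0 - y))\<^sup>2)"
    by (intro integrable_div_norm_sq continuous_intros ch integrable_abs ih)
  have F0: "F \<ge> 0" unfolding F_def by (rule integral_nonneg_AE) auto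
  define X where "X = (\<integral>y. exp (4 * u y) \<partial>lborel)"
  have X0: "X \<ge> 0" unfolding X_def by (rule integral_nonneg_AE) auto
  define c where "c = 4 * pi\<^sup>2 * \<bar>u 0\<bar> + 4 * pi\<^sup>2 * \<bar>g 0\<bar> + 2 * F"
  have c0: "c \<ge> 0" using F0 by (simp add: c_def)
  \<comment> \<open>Here \<open>a\<close> is a squared radius, so \<open>a ^ 3\<close> is the sixth
    power of the radius. The constant \<open>c\<close> collects the values at the origin and the
    inverse-square potential of the right-hand side.\<close>
  have key: "\<bar>\<integral>y. cutoff a ((norm (0 - y))\<^sup>2) ^ 4 * u y \<partial>lborel\<bar> \<le> c * a ^ 3" if a: "a \<ge> 1" for a
  proof -
    have a0: "a > 0" using a by simp
    define E where "E = (\<integral>y. cutoff a ((norm (0 - y))\<^sup>2) ^ 6 / (norm (0 - y))\<^sup>2 * g y \<partial>lborel)"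
    define G where "G = (\<integral>y. cutoff a ((norm (0 - y))\<^sup>2) ^ 5 * g y \<partial>lborel)"
    define H where "H = (\<integral>y. cutoff a ((norm (0 - y))\<^sup>2) ^ 7 / (norm (0 - y))\<^sup>2 * h y \<partial>lborel)"
    define K where "K = (\<integral>y. log_kernel 6 a ((norm (0 - y))\<^sup>2) * h y \<partial>lborel)"
    define N where "N = (\<integral>y. cutoff a ((norm (0 - y))\<^sup>2) ^ 4 * u y \<partial>lborel)"
    have 1: "4 * pi\<^sup>2 * u 0 = 120 / a\<^sup>2 * N - E"
      using laplacian_representation[OF u2 a0, of 6 0] unfolding integral_mult_right_zero[symmetric] N_def E_def g_def
      by (simp add: mult.assoc)
    have 2: "K = 24 / a * G - 4 * E"
      using log_kernel_green[OF g2 a0, of 6 0] by (simp add: K_def G_def E_def h_def)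
    \<comment> \<open>The exponent 7 is chosen so that its regular kernel is \<open>q ^ 5\<close>,
      the one occurring in \<open>2\<close>. Then \<open>G\<close> and \<open>E\<close> can be
      eliminated, leaving \<open>q ^ 4\<close> as the only kernel against \<open>u\<close>.\<close>
    have 3: "4 * pi\<^sup>2 * g 0 = 168 / a\<^sup>2 * G - H"
      using laplacian_representation[OF g2 a0, of 7 0] unfolding integral_mult_right_zero[symmetric] G_def H_def h_def
      by (simp add: mult.assoc)
    have "N = a\<^sup>2 / 120 * (4 * pi\<^sup>2 * u 0 + E)" using 1 a0 by simp
    also have "E = 6 / a * G - K / 4" using 2 by (simp add: diff_divide_distrib)
    also have "G = a\<^sup>2 / 168 * (4 * pi\<^sup>2 * g 0 + H)" using 3 a0 by simp
    also have "6 / a * (a\<^sup>2 / 168 * (4 * pi\<^sup>2 * g 0 + H)) = a / 28 * (4 * pi\<^sup>2 * g 0 + H)"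
      using a0 by (simp add: power2_eq_square)
    finally have N: "N = a\<^sup>2 / 120 * (4 * pi\<^sup>2 * u 0 + a / 28 * (4 * pi\<^sup>2 * g 0 + H) - K / 4)"
      by (simp add: algebra_simps)
    have H: "\<bar>H\<bar> \<le> F"
      unfolding H_def F_def
    proof (rule abs_integral_le[OF iF], rule AE_I2)
      fix y
      have "cutoff a ((norm (0 - y))\<^sup>2) ^ 7 * \<bar>h y\<bar> \<le> 1 * \<bar>h y\<bar>"
        using a0 by (intro mult_right_mono power_le_one cutoff_le_1) auto
      then show "\<bar>cutoff a ((norm (0 - y))\<^sup>2) ^ 7 / (norm (0 - y))\<^sup>2 * h y\<bar> \<le> \<bar>h y\<bar> / (norm (0 - y))\<^sup>2"
        by (simp add: abs_mult divide_right_mono)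
    qed
    have K: "\<bar>K\<bar> \<le> a * F"
      unfolding K_def F_def integral_mult_right_zero[symmetric]
    proof (rule abs_integral_le[OF integrable_mult_right[OF iF]])
      show "AE y in lborel. \<bar>log_kernel 6 a ((norm (0 - y))\<^sup>2) * h y\<bar> \<le> a * (\<bar>h y\<bar> / (norm (0 - y))\<^sup>2)"
        using AE_norm_diff_pos[of 0]
      proof eventually_elim
        case (elim y)
        then have "\<bar>log_kernel 6 a ((norm (0 - y))\<^sup>2)\<bar> * \<bar>h y\<bar> \<le> a / (norm (0 - y))\<^sup>2 * \<bar>h y\<bar>"
          using a0 by (intro mult_right_mono log_kernel_bound) auto
        then show ?case by (simp add: abs_mult)
      qed
    qed
    have aa: "1 \<le> a" "a \<le> a\<^sup>2" using a by (auto simp: power2_eq_square)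
    have "\<bar>4 * pi\<^sup>2 * u 0 + a / 28 * (4 * pi\<^sup>2 * g 0 + H) - K / 4\<bar> \<le> 4 * pi\<^sup>2 * \<bar>u 0\<bar> + a / 28 * (4 * pi\<^sup>2 * \<bar>g 0\<bar> + F) + a * F / 4"
    proof -
      have "\<bar>4 * pi\<^sup>2 * u 0\<bar> = 4 * pi\<^sup>2 * \<bar>u 0\<bar>" by (simp add: abs_mult)
      moreover have "\<bar>a / 28 * (4 * pi\<^sup>2 * g 0 + H)\<bar> \<le> a / 28 * (4 * pi\<^sup>2 * \<bar>g 0\<bar> + F)"
        unfolding abs_mult using a0 H abs_triangle_ineq[of "4 * pi\<^sup>2 * g 0" H]
        by (intro mult_mono) (auto simp: abs_mult)
      ultimately show ?thesis using K by linarith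
    qed
    also have "\<dots> \<le> a * c"
    proof -
      have "4 * pi\<^sup>2 * \<bar>u 0\<bar> \<le> a * (4 * pi\<^sup>2 * \<bar>u 0\<bar>)"
        using mult_right_mono[OF a, of "4 * pi\<^sup>2 * \<bar>u 0\<bar>"] by simp
      moreover have "a / 28 * (4 * pi\<^sup>2 * \<bar>g 0\<bar> + F) \<le> a * (4 * pi\<^sup>2 * \<bar>g 0\<bar> + F)"
        using a0 F0 by (intro mult_right_mono) auto
      moreover have "a * F / 4 \<le> a * F" using a0 F0 by simp
      ultimately show ?thesis by (simp add: c_def algebra_simps)
    qed
    finally have "\<bar>N\<bar> \<le> a\<^sup>2 / 120 * (a * c)"
      unfolding N using a0 by (simp add: abs_mult mult_left_mono power2_eq_square)
    also have "\<dots> \<le> c * a ^ 3"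
      using a0 c0 by (simp add: power2_eq_square power3_eq_cube)
    finally show ?thesis by (simp add: N_def)
  qed
  have iN: "integrable lborel (\<lambda>y. cutoff a ((norm (0 - y))\<^sup>2) ^ 4 * v y)" if "a > 0" "continuous_on UNIV v" for a and v :: "real^4 \<Rightarrow> real"
    by (intro integrable_cutoff_power that) simp
  have main: "(\<integral>y. indicator (cball 0 R) y * \<bar>u y\<bar> \<partial>lborel) \<le> 16 * (2 * X + 8 * c) * R ^ 6" if R: "R \<ge> 1" for R
  proof -
    \<comment> \<open>With this choice the cutoff is at least \<open>1 / 2\<close> on the ball of
      radius \<open>R\<close>, which costs the factor \<open>16 = 2 ^ 4\<close>.\<close>
    define a where "a = 2 * R\<^sup>2"
    have a: "a \<ge> 1" "a > 0" using R one_le_power[of R 2] by (auto simp: a_def simp del: one_le_power)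
    have "(\<integral>y. indicator (cball 0 R) y * \<bar>u y\<bar> \<partial>lborel) \<le> (\<integral>y. 16 * (cutoff a ((norm (0 - y))\<^sup>2) ^ 4 * \<bar>u y\<bar>) \<partial>lborel)"
    proof (rule integral_mono)
      show "integrable lborel (\<lambda>y. indicator (cball 0 R) y * \<bar>u y\<bar>)"
        using borel_integrable_compact[of "cball 0 R" "\<lambda>y. \<bar>u y\<bar>"] continuous_on_subset[OF cu, of "cball 0 R"]
        by (simp add: continuous_on_rabs)
      show "integrable lborel (\<lambda>y. 16 * (cutoff a ((norm (0 - y))\<^sup>2) ^ 4 * \<bar>u y\<bar>))"
        by (intro integrable_mult_right iN a continuous_intros cu)
      fix y
      show "indicator (cball 0 R) y * \<bar>u y\<bar> \<le> 16 * (cutoff a ((norm (0 - y))\<^sup>2) ^ 4 * \<bar>u y\<bar>)"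
      proof (cases "norm y \<le> R")
        case True
        then have "(norm y)\<^sup>2 \<le> R\<^sup>2" by (intro power_mono) auto
        then have "(norm y)\<^sup>2 / (2 * R\<^sup>2) \<le> R\<^sup>2 / (2 * R\<^sup>2)" by (rule divide_right_mono) simp
        also have "\<dots> = 1 / 2" using R by simp
        finally have "1 / 2 \<le> cutoff a ((norm (0 - y))\<^sup>2)"
          unfolding cutoff_def a_def diff_0 norm_minus_cancel by linarith
        then have "(1 / 2) ^ 4 \<le> cutoff a ((norm (0 - y))\<^sup>2) ^ 4" by (intro power_mono) auto
        then have "1 * \<bar>u y\<bar> \<le> 16 * cutoff a ((norm (0 - y))\<^sup>2) ^ 4 * \<bar>u y\<bar>"
          by (intro mult_right_mono) (auto simp: power4_eq_xxxx)
        then show ?thesis using True by simp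
      qed simp
    qed
    also have "\<dots> = 16 * (\<integral>y. cutoff a ((norm (0 - y))\<^sup>2) ^ 4 * \<bar>u y\<bar> \<partial>lborel)"
      by (simp only: integral_mult_right_zero)
    \<comment> \<open>Writing \<open>\<bar>u\<bar>\<close> as
      \<open>(\<bar>u\<bar> + u) - u\<close>, the bracket is twice the positive part and is
      controlled by the exponential; the signed rest is \<open>key\<close>.\<close>
    also have "(\<integral>y. cutoff a ((norm (0 - y))\<^sup>2) ^ 4 * \<bar>u y\<bar> \<partial>lborel) \<le>
       (\<integral>y. 2 * exp (4 * u y) - cutoff a ((norm (0 - y))\<^sup>2) ^ 4 * u y \<partial>lborel)"
    proof (rule integral_mono)
      show "integrable lborel (\<lambda>y. cutoff a ((norm (0 - y))\<^sup>2) ^ 4 * \<bar>u y\<bar>)"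
        by (intro iN a continuous_intros cu)
      show "integrable lborel (\<lambda>y. 2 * exp (4 * u y) - cutoff a ((norm (0 - y))\<^sup>2) ^ 4 * u y)"
        using iN[OF a(2) cu] e by simp
      fix y :: "real^4"
      have 1: "0 \<le> cutoff a ((norm (0 - y))\<^sup>2) ^ 4" "cutoff a ((norm (0 - y))\<^sup>2) ^ 4 \<le> 1"
        using a by (auto intro!: power_le_one cutoff_le_1)
      have "\<bar>u y\<bar> + u y \<le> 2 * exp (4 * u y)"
        using exp_ge_add_one_self[of "4 * u y"] exp_gt_zero[of "4 * u y"] by linarith
      then have "cutoff a ((norm (0 - y))\<^sup>2) ^ 4 * (\<bar>u y\<bar> + u y) \<le> 1 * (2 * exp (4 * u y))"
        using 1 by (intro mult_mono) auto
      then show "cutoff a ((norm (0 - y))\<^sup>2) ^ 4 * \<bar>u y\<bar> \<le> 2 * exp (4 * u y) - cutoff a ((norm (0 - y))\<^sup>2) ^ 4 * u y"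
        by (simp add: algebra_simps)
    qed
    also have "\<dots> = 2 * X - (\<integral>y. cutoff a ((norm (0 - y))\<^sup>2) ^ 4 * u y \<partial>lborel)"
      using iN[OF a(2) cu] e by (simp add: X_def)
    also have "\<dots> \<le> 2 * X + c * a ^ 3" using key[OF a(1)] by linarith
    also have "\<dots> \<le> (2 * X + 8 * c) * R ^ 6"
    proof -
      have "1 \<le> R ^ 6" using R by (rule one_le_power)
      then have "2 * X * 1 \<le> 2 * X * R ^ 6" using X0 by (intro mult_left_mono) auto
      moreover have "a ^ 3 = 8 * R ^ 6" by (simp add: a_def power_mult_distrib flip: power_mult)
      ultimately show ?thesis by (simp add: algebra_simps)
    qed
    finally show ?thesis by (simp only: mult.assoc)
  qed
  show thesis by (rule that[of "16 * (2 * X + 8 * c)"]) (use main X0 c0 in auto)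
qed

section \<open>Dependence of the kernels on their centre\<close>

text \<open>Moving the centre from 0 to \<open>x\<close> is an additive perturbation inside the
  positive part, so expansions in \<open>x\<close> reduce to one-variable Taylor estimates.\<close>

lemma cutoff_shift:
  fixes x y :: "real^4"
  shows "cutoff a ((norm (x - y))\<^sup>2) = max 0 ((1 - (norm y)\<^sup>2 / a) + (2 * (x \<bullet> y) - x \<bullet> x) / a)"
proof -
  have "(norm (x - y))\<^sup>2 = (norm y)\<^sup>2 - (2 * (x \<bullet> y) - x \<bullet> x)"
    by (simp add: power2_norm_eq_inner inner_simps inner_commute)
  then show ?thesis by (simp add: cutoff_def diff_divide_distrib)
qed

lemma cutoff_far:
  fixes x y :: "real^4"
  assumes "R > 0" "norm x \<le> R" "norm y > 2 * R"
  shows "cutoff (R\<^sup>2) ((norm (x - y))\<^sup>2) = 0" "cutoff (R\<^sup>2) ((norm y)\<^sup>2) = 0"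
proof -
  have "norm (x - y) \<ge> R" using norm_triangle_ineq2[of y x] assms by (simp add: norm_minus_commute)
  then show "cutoff (R\<^sup>2) ((norm (x - y))\<^sup>2) = 0" "cutoff (R\<^sup>2) ((norm y)\<^sup>2) = 0"
    using assms by (auto intro!: cutoff_eq_0 power_mono)
qed

lemma shift_bound:
  fixes x y :: "real^4"
  assumes R: "R > 0" "norm x \<le> R" "norm y \<le> 2 * R"
  shows "\<bar>(2 * (x \<bullet> y) - x \<bullet> x) / R\<^sup>2\<bar> \<le> 5 * norm x / R"
proof -
  have 1: "\<bar>x \<bullet> y\<bar> \<le> norm x * (2 * R)"
    using Cauchy_Schwarz_ineq2[of x y] mult_left_mono[OF R(3), of "norm x"] by simp
  have 2: "\<bar>x \<bullet> x\<bar> \<le> norm x * R"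
    using R mult_left_mono[OF R(2), of "norm x"] by (simp add: dot_square_norm power2_eq_square)
  have "\<bar>2 * (x \<bullet> y) - x \<bullet> x\<bar> \<le> 5 * norm x * R"
    using 1 2 by linarith
  then have "\<bar>2 * (x \<bullet> y) - x \<bullet> x\<bar> / R\<^sup>2 \<le> 5 * norm x * R / R\<^sup>2"
    by (intro divide_right_mono) auto
  then show ?thesis using R by (simp add: power2_eq_square)
qed

lemma laplacian_kernel_lipschitz:
  fixes x y :: "real^4"
  assumes R: "R > 0" "norm x \<le> R"
  shows "\<bar>(3 * cutoff (R\<^sup>2) ((norm (x - y))\<^sup>2) ^ 2 - 5 * cutoff (R\<^sup>2) ((norm (x - y))\<^sup>2) ^ 3) -
     (3 * cutoff (R\<^sup>2) ((norm y)\<^sup>2) ^ 2 - 5 * cutoff (R\<^sup>2) ((norm y)\<^sup>2) ^ 3)\<bar> \<le> 105 * norm x / R * indicator (cball 0 (2 * R)) y"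
proof (cases "norm y \<le> 2 * R")
  case True
  define q where "q = cutoff (R\<^sup>2) ((norm (x - y))\<^sup>2)"
  define r where "r = cutoff (R\<^sup>2) ((norm y)\<^sup>2)"
  have q: "0 \<le> q" "q \<le> 1" "0 \<le> r" "r \<le> 1" using R by (auto simp: q_def r_def intro!: cutoff_le_1)
  have "\<bar>q - r\<bar> \<le> \<bar>(2 * (x \<bullet> y) - x \<bullet> x) / R\<^sup>2\<bar>"
    unfolding q_def r_def cutoff_shift unfolding cutoff_def by linarith
  also have "\<dots> \<le> 5 * norm x / R" by (rule shift_bound[OF R True])
  finally have d: "\<bar>q - r\<bar> \<le> 5 * norm x / R" .
  have "(3 * q ^ 2 - 5 * q ^ 3) - (3 * r ^ 2 - 5 * r ^ 3) = (q - r) * (3 * (q + r) - 5 * (q\<^sup>2 + q * r + r\<^sup>2))"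
    by (simp add: power2_eq_square power3_eq_cube algebra_simps)
  \<comment> \<open>For \<open>q\<close> and \<open>r\<close> in the unit interval the second factor
    is at most \<open>3 * 2 + 5 * 3 = 21\<close>; with the 5 from \<open>shift_bound\<close> this
    gives 105.\<close>
  also have "\<bar>\<dots>\<bar> \<le> 5 * norm x / R * 21"
    unfolding abs_mult
  proof (intro mult_mono d)
    have "q\<^sup>2 \<le> 1" "r\<^sup>2 \<le> 1" "q * r \<le> 1" "q * r \<ge> 0" "q\<^sup>2 \<ge> 0" "r\<^sup>2 \<ge> 0"
      using q by (auto intro: power_le_one mult_le_one)
    then show "\<bar>3 * (q + r) - 5 * (q\<^sup>2 + q * r + r\<^sup>2)\<bar> \<le> 21"
      using q by (intro abs_leI; simp only: distrib_left; linarith)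
  qed (use R in auto)
  finally show ?thesis using True by (simp add: q_def r_def)
next
  case False
  then show ?thesis using cutoff_far[OF R, of y] by simp
qed

text \<open>The coefficients are the first derivative of \<open>840 r ^ 4 - 480 r ^ 3\<close> and
  half its second, multiplying \<open>d\<close> and the quadratic part of \<open>d ^ 2\<close>,
  where \<open>d\<close> is the shift of \<open>cutoff_shift\<close>. Taking
  \<open>5 * norm x \<le> R\<close> ensures \<open>\<bar>d\<bar> \<le> 1\<close> for the quartic
  estimate.\<close>

lemma kernel_taylor:
  fixes x y :: "real^4"
  assumes R: "R > 0" "5 * norm x \<le> R"
  defines "q \<equiv> cutoff (R\<^sup>2) ((norm (x - y))\<^sup>2)" and "r \<equiv> cutoff (R\<^sup>2) ((norm y)\<^sup>2)"
  shows "\<bar>(840 * q ^ 4 - 480 * q ^ 3) - (840 * r ^ 4 - 480 * r ^ 3) -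
     ((3360 * r ^ 3 - 1440 * r ^ 2) / R\<^sup>2 * (2 * (x \<bullet> y) - x \<bullet> x) + 4 * (5040 * r ^ 2 - 1440 * r) / R ^ 4 * (x \<bullet> y)\<^sup>2)\<bar>
     \<le> 1000000 * (norm x / R) ^ 3 * indicator (cball 0 (2 * R)) y"
proof (cases "norm y \<le> 2 * R")
  case False
  then show ?thesis using cutoff_far[of R x y] R norm_ge_zero[of x] by (simp add: q_def r_def)
next
  case True
  define t where "t = 1 - (norm y)\<^sup>2 / R\<^sup>2"
  define d where "d = (2 * (x \<bullet> y) - x \<bullet> x) / R\<^sup>2"
  \<comment> \<open>The part of \<open>d ^ 2\<close> of degree two in \<open>x\<close>. The rest of
    \<open>d ^ 2\<close> has degree three and four in \<open>x\<close>, is of size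
    \<open>m ^ 3\<close>, and is counted as error.\<close>
  define d2 where "d2 = 4 * (x \<bullet> y)\<^sup>2 / R ^ 4"
  define m where "m = norm x / R"
  have m: "0 \<le> m" "5 * m \<le> 1" using R by (auto simp: m_def divide_le_eq)
  have xR: "norm x \<le> R" using R norm_ge_zero[of x] by linarith
  have q: "q = max 0 (t + d)" by (simp add: q_def cutoff_shift t_def d_def)
  have r: "r = max 0 t" by (simp add: r_def cutoff_def t_def)
  have r01: "0 \<le> r" "r \<le> 1" using R by (auto simp: r_def intro!: cutoff_le_1)
  have d: "\<bar>d\<bar> \<le> 5 * m" using shift_bound[OF R(1) xR True] by (simp add: d_def m_def)
  have d3: "\<bar>d\<bar> ^ 3 \<le> 125 * m ^ 3" using power_mono[OF d, of 3] by (simp add: power_mult_distrib)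
  have t1: "t \<le> 1" by (simp add: t_def)
  have T3: "\<bar>q ^ 3 - r ^ 3 - 3 * r ^ 2 * d - 3 * r * d\<^sup>2\<bar> \<le> 250 * m ^ 3"
    using cubic_taylor_max_0[of t d] d3 by (simp add: q r)
  have T4: "\<bar>q ^ 4 - r ^ 4 - 4 * r ^ 3 * d - 6 * r ^ 2 * d\<^sup>2\<bar> \<le> 750 * m ^ 3"
    using quartic_taylor_max_0[OF t1, of d] d d3 m by (simp add: q r)
  have xy: "\<bar>x \<bullet> y\<bar> \<le> 2 * m * R\<^sup>2"
    using Cauchy_Schwarz_ineq2[of x y] mult_left_mono[OF True, of "norm x"] R(1) by (simp add: m_def power2_eq_square)
  have xx: "x \<bullet> x = m\<^sup>2 * R\<^sup>2"
    using R(1) by (simp add: m_def dot_square_norm power_divide)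
  define s where "s = (x \<bullet> y) / R\<^sup>2"
  have s: "\<bar>s\<bar> \<le> 2 * m" using xy R(1) by (simp add: s_def abs_divide divide_le_eq)
  have ds: "d = 2 * s - m\<^sup>2" using R(1) by (simp add: d_def s_def xx diff_divide_distrib)
  have d2s: "d2 = 4 * s\<^sup>2" by (simp add: d2_def s_def power_divide flip: power_mult)
  have "d\<^sup>2 - d2 = m\<^sup>2 * (m\<^sup>2 - 4 * s)"
    unfolding ds d2s by (simp add: power2_eq_square algebra_simps)
  also have "\<bar>\<dots>\<bar> \<le> m\<^sup>2 * (9 * m)"
    unfolding abs_mult
  proof (intro mult_mono)
    have "m\<^sup>2 \<le> m" using m by (simp add: power2_eq_square mult_left_le)
    then show "\<bar>m\<^sup>2 - 4 * s\<bar> \<le> 9 * m" using s zero_le_power2[of m] by linarith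
  qed auto
  finally have dd: "\<bar>d\<^sup>2 - d2\<bar> \<le> 9 * m ^ 3" by (simp add: power2_eq_square power3_eq_cube)
  have e1: "\<bar>6 * r ^ 2 * (d\<^sup>2 - d2)\<bar> \<le> 54 * m ^ 3"
    using mult_mono[OF power_le_one[OF r01, of 2] dd] m by (simp add: abs_mult)
  have e2: "\<bar>3 * r * (d\<^sup>2 - d2)\<bar> \<le> 27 * m ^ 3"
    using mult_mono[OF r01(2) dd] m r01 by (simp add: abs_mult)
  have "(3360 * r ^ 3 - 1440 * r ^ 2) / R\<^sup>2 * (2 * (x \<bullet> y) - x \<bullet> x) + 4 * (5040 * r ^ 2 - 1440 * r) / R ^ 4 * (x \<bullet> y)\<^sup>2
      = (3360 * r ^ 3 - 1440 * r ^ 2) * d + (5040 * r ^ 2 - 1440 * r) * d2"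
    by (simp add: d_def d2_def)
  moreover have "(840 * q ^ 4 - 480 * q ^ 3) - (840 * r ^ 4 - 480 * r ^ 3) - ((3360 * r ^ 3 - 1440 * r ^ 2) * d + (5040 * r ^ 2 - 1440 * r) * d2)
      = 840 * (q ^ 4 - r ^ 4 - 4 * r ^ 3 * d - 6 * r ^ 2 * d\<^sup>2) + 840 * (6 * r ^ 2 * (d\<^sup>2 - d2))
       - 480 * (q ^ 3 - r ^ 3 - 3 * r ^ 2 * d - 3 * r * d\<^sup>2) - 480 * (3 * r * (d\<^sup>2 - d2))"
    by (simp add: algebra_simps)
  moreover have m3: "m ^ 3 \<ge> 0" using m by simp
  \<comment> \<open>The four bounds add up to
    \<open>840 * (750 + 54) + 480 * (250 + 27) = 808320\<close>, rounded up.\<close>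
  have tri: "\<bar>840 * A + 840 * B - 480 * C - 480 * D\<bar> \<le> 1000000 * m ^ 3"
    if "\<bar>A\<bar> \<le> 750 * m ^ 3" "\<bar>B\<bar> \<le> 54 * m ^ 3" "\<bar>C\<bar> \<le> 250 * m ^ 3" "\<bar>D\<bar> \<le> 27 * m ^ 3" for A B C D
    using that m3 by linarith
  ultimately have "\<bar>(840 * q ^ 4 - 480 * q ^ 3) - (840 * r ^ 4 - 480 * r ^ 3) -
     ((3360 * r ^ 3 - 1440 * r ^ 2) / R\<^sup>2 * (2 * (x \<bullet> y) - x \<bullet> x) + 4 * (5040 * r ^ 2 - 1440 * r) / R ^ 4 * (x \<bullet> y)\<^sup>2)\<bar>
     \<le> 1000000 * m ^ 3"
    using tri[OF T4 e1 T3 e2] by (simp only:)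
  then show ?thesis using True by (simp add: m_def)
qed

section \<open>Limits of the truncated potentials\<close>

lemma cutoff_tendsto_1: "(\<lambda>n. cutoff ((real (Suc n))\<^sup>2) s) \<longlonglongrightarrow> 1"
proof -
  have "(\<lambda>n. max 0 (1 - s * inverse (real (Suc n)) ^ 2)) \<longlonglongrightarrow> max 0 (1 - s * 0 ^ 2)"
    by (intro tendsto_intros LIMSEQ_inverse_real_of_nat)
  then show ?thesis by (simp add: cutoff_def divide_inverse power_inverse)
qed

text \<open>The difference of logarithms is at most the difference of the norms, itself at most
  \<open>norm x\<close>, over one of the norms. Then \<open>1 / t \<le> 1 + 1 / t ^ 2\<close> leaves
  only inverse squares, which \<open>integrable_div_norm_sq\<close> handles.\<close>

lemma ln_norm_ratio_bound:
  fixes x y :: "real^4"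
  assumes "y \<noteq> x" "y \<noteq> 0"
  shows "\<bar>ln ((norm (x - y))\<^sup>2) - ln ((norm y)\<^sup>2)\<bar> \<le> 2 * norm x * (2 + 1 / (norm (x - y))\<^sup>2 + 1 / (norm (0 - y))\<^sup>2)"
proof -
  have pos: "norm (x - y) > 0" "norm y > 0" using assms by auto
  have inv: "1 / t \<le> 1 + 1 / t\<^sup>2" if "t > 0" for t :: real
  proof -
    have "2 * (1 / t) \<le> 1 + (1 / t)\<^sup>2"
      using zero_le_power2[of "1 / t - 1"] unfolding power2_diff by simp
    moreover have "1 / t > 0" using that by simp
    ultimately have "1 / t \<le> 1 + (1 / t)\<^sup>2" by linarith
    then show ?thesis by (simp add: power_one_over)
  qed
  have tri: "\<bar>norm (x - y) - norm y\<bar> \<le> norm x"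
    using norm_triangle_ineq3[of "x - y" "- y"] by simp
  have bnd: "(norm (x - y) - norm y) / norm y \<le> norm x * (1 + 1 / (norm y)\<^sup>2)"
    "(norm y - norm (x - y)) / norm (x - y) \<le> norm x * (1 + 1 / (norm (x - y))\<^sup>2)"
    using mult_mono[of "norm (x - y) - norm y" "norm x" "1 / norm y" "1 + 1 / (norm y)\<^sup>2"]
      mult_mono[of "norm y - norm (x - y)" "norm x" "1 / norm (x - y)" "1 + 1 / (norm (x - y))\<^sup>2"] tri pos inv
    by (auto simp: abs_le_iff)
  have "\<bar>ln (norm (x - y)) - ln (norm y)\<bar> \<le> norm x * (1 + 1 / (norm y)\<^sup>2) + norm x * (1 + 1 / (norm (x - y))\<^sup>2)"
  proof -
    have "0 \<le> norm x * (1 + 1 / (norm y)\<^sup>2)" "0 \<le> norm x * (1 + 1 / (norm (x - y))\<^sup>2)" by simp_all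
    moreover have "\<bar>A - B\<bar> \<le> S + T"
      if "A - B \<le> P" "B - A \<le> Q" "P \<le> S" "Q \<le> T" "0 \<le> S" "0 \<le> T" for A B P Q S T :: real
      using that by linarith
    ultimately show ?thesis
      using ln_diff_le[OF pos] ln_diff_le[OF pos(2,1)] bnd by blast
  qed
  moreover have "ln ((norm (x - y))\<^sup>2) - ln ((norm y)\<^sup>2) = 2 * (ln (norm (x - y)) - ln (norm y))"
    using pos by (simp add: ln_realpow)
  ultimately have "\<bar>ln ((norm (x - y))\<^sup>2) - ln ((norm y)\<^sup>2)\<bar> \<le>
      2 * (norm x * (1 + 1 / (norm y)\<^sup>2) + norm x * (1 + 1 / (norm (x - y))\<^sup>2))"
    by (metis abs_mult abs_numeral mult_left_mono zero_le_numeral)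
  then show ?thesis by (simp add: algebra_simps)
qed

text \<open>Each kernel alone diverges like the logarithm of the scale. In the difference this and
  the harmonic sums cancel, which is the origin of the normalised kernel
  \<open>ln (norm y / norm (x - y))\<close>.\<close>

lemma log_kernel_diff_tendsto:
  assumes "s > 0" "t > 0"
  shows "(\<lambda>n. log_kernel m ((real (Suc n))\<^sup>2) s - log_kernel m ((real (Suc n))\<^sup>2) t) \<longlonglongrightarrow> ln t - ln s"
proof -
  have "(\<lambda>n. ln t - ln s - (\<Sum>k=1..m. cutoff ((real (Suc n))\<^sup>2) s ^ k / k) + (\<Sum>k=1..m. cutoff ((real (Suc n))\<^sup>2) t ^ k / k))
      \<longlonglongrightarrow> ln t - ln s - (\<Sum>k=1..m. 1 ^ k / k) + (\<Sum>k=1..m. 1 ^ k / k)"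
    by (intro tendsto_intros cutoff_tendsto_1) auto
  moreover have "eventually (\<lambda>n. ln t - ln s - (\<Sum>k=1..m. cutoff ((real (Suc n))\<^sup>2) s ^ k / k) + (\<Sum>k=1..m. cutoff ((real (Suc n))\<^sup>2) t ^ k / k)
      = log_kernel m ((real (Suc n))\<^sup>2) s - log_kernel m ((real (Suc n))\<^sup>2) t) sequentially"
  proof -
    have "eventually (\<lambda>n. real n > s + t) sequentially"
      using filterlim_real_sequentially by (auto simp: filterlim_at_top_dense)
    then show ?thesis
    proof eventually_elim
      case (elim n)
      define a where "a = (real (Suc n))\<^sup>2"
      have "real n \<le> a" by (simp add: a_def power2_eq_square algebra_simps)
      then have "s < a" "t < a" "a > 0" using elim assms by auto
      then show ?case unfolding a_def[symmetric] using assms by (simp add: log_kernel_def cutoff_eq ln_div)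
    qed
  qed
  ultimately show ?thesis by (simp add: tendsto_cong)
qed

lemma log_kernel_integrable:
  fixes x :: "real^4"
  assumes cf: "continuous_on UNIV f" and f: "integrable lborel f"
  shows "integrable lborel (\<lambda>y. \<bar>ln ((norm (x - y))\<^sup>2) - ln ((norm y)\<^sup>2)\<bar> * \<bar>f y\<bar>)"
proof (rule Bochner_Integration.integrable_bound)
  have [measurable]: "f \<in> borel_measurable borel" using cf by (rule borel_measurable_continuous_onI)
  show "integrable lborel (\<lambda>y. 2 * norm x * (2 * \<bar>f y\<bar> + \<bar>f y\<bar> / (norm (x - y))\<^sup>2 + \<bar>f y\<bar> / (norm (0 - y))\<^sup>2))"
    by (intro integrable_mult_right Bochner_Integration.integrable_add integrable_div_norm_sq integrable_abs f
        continuous_intros cf)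
  show "AE y in lborel. norm (\<bar>ln ((norm (x - y))\<^sup>2) - ln ((norm y)\<^sup>2)\<bar> * \<bar>f y\<bar>) \<le>
     norm (2 * norm x * (2 * \<bar>f y\<bar> + \<bar>f y\<bar> / (norm (x - y))\<^sup>2 + \<bar>f y\<bar> / (norm (0 - y))\<^sup>2))"
    using AE_lborel_singleton[of x] AE_lborel_singleton[of 0]
  proof eventually_elim
    case (elim y)
    have "\<bar>ln ((norm (x - y))\<^sup>2) - ln ((norm y)\<^sup>2)\<bar> * \<bar>f y\<bar> \<le>
        2 * norm x * (2 + 1 / (norm (x - y))\<^sup>2 + 1 / (norm (0 - y))\<^sup>2) * \<bar>f y\<bar>"
      using elim by (intro mult_right_mono ln_norm_ratio_bound) auto
    also have "\<dots> = 2 * norm x * (2 * \<bar>f y\<bar> + \<bar>f y\<bar> / (norm (x - y))\<^sup>2 + \<bar>f y\<bar> / (norm (0 - y))\<^sup>2)"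
      by (simp add: algebra_simps)
    also have "\<dots> \<le> norm (2 * norm x * (2 * \<bar>f y\<bar> + \<bar>f y\<bar> / (norm (x - y))\<^sup>2 + \<bar>f y\<bar> / (norm (0 - y))\<^sup>2))"
      unfolding real_norm_def by (rule abs_ge_self)
    finally show ?case by (simp add: abs_mult)
  qed
  show "(\<lambda>y. \<bar>ln ((norm (x - y))\<^sup>2) - ln ((norm y)\<^sup>2)\<bar> * \<bar>f y\<bar>) \<in> borel_measurable lborel"
    by measurable
qed

lemma tendsto_0_sequentially_Suc:
  assumes C: "\<And>R. R \<ge> R0 \<Longrightarrow> \<bar>g R\<bar> \<le> C / R"
  shows "(\<lambda>n. g (real (Suc n)) :: real) \<longlonglongrightarrow> 0"
proof (rule Lim_null_comparison)
  show "(\<lambda>n. C * inverse (real (Suc n))) \<longlonglongrightarrow> 0"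
    by (rule tendsto_mult_right_zero[OF LIMSEQ_inverse_real_of_nat])
  have "eventually (\<lambda>n. real n > R0) sequentially"
    using filterlim_real_sequentially by (auto simp: filterlim_at_top_dense)
  then show "eventually (\<lambda>n. norm (g (real (Suc n))) \<le> C * inverse (real (Suc n))) sequentially"
    by eventually_elim (use C in \<open>simp add: divide_inverse\<close>)
qed

section \<open>Passage to the limit in the representation formulas\<close>

text \<open>\<open>rep\<close> at \<open>x\<close> minus \<open>rep\<close> at 0, with
  \<open>R\<close> tending to infinity: \<open>E\<close> tends to the full potential by dominated
  convergence, and the two integrals of \<open>u\<close> differ by order
  \<open>1 / R\<close>.\<close>

lemma laplacian_minus_potential_constant:
  fixes x :: "real^4"
  assumes u: "Ck 4 u" and f: "integrable lborel (laplacian (laplacian u))"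
    and e: "integrable lborel (\<lambda>y. exp (4 * u y))"
  shows "4 * pi\<^sup>2 * laplacian u x + (\<integral>y. laplacian (laplacian u) y / (norm (x - y))\<^sup>2 \<partial>lborel) =
    4 * pi\<^sup>2 * laplacian u 0 + (\<integral>y. laplacian (laplacian u) y / (norm (0 - y))\<^sup>2 \<partial>lborel)"
proof -
  define h where "h = laplacian (laplacian u)"
  have cu: "continuous_on UNIV u" by (rule Ck_continuous[OF u])
  have ch: "continuous_on UNIV h" unfolding h_def by (rule Ck_2_laplacian_continuous[OF Ck_4_laplacian[OF u]])
  have [measurable]: "u \<in> borel_measurable borel" "h \<in> borel_measurable borel"
    using cu ch by (auto intro: borel_measurable_continuous_onI)
  have ih: "integrable lborel h" using f by (simp add: h_def)
  obtain C where C: "C \<ge> 0" "\<And>R. R \<ge> 1 \<Longrightarrow> (\<integral>y. indicator (cball 0 R) y * \<bar>u y\<bar> \<partial>lborel) \<le> C * R ^ 6"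
    using integral_ball_growth[OF u f e] by blast
  define W where "W R x y = 3 * cutoff (R\<^sup>2) ((norm (x - y))\<^sup>2) ^ 2 - 5 * cutoff (R\<^sup>2) ((norm (x - y))\<^sup>2) ^ 3"
    for R and x y :: "real^4"
  define \<Phi> where "\<Phi> R x = (\<integral>y. W R x y * u y \<partial>lborel)" for R x
  define E where "E R x = (\<integral>y. cutoff (R\<^sup>2) ((norm (x - y))\<^sup>2) ^ 6 / (norm (x - y))\<^sup>2 * h y \<partial>lborel)" for R x
  have iW: "integrable lborel (\<lambda>y. W R x y * u y)" if "R > 0" for R x
  proof -
    have "integrable lborel (\<lambda>y. 3 * (cutoff (R\<^sup>2) ((norm (x - y))\<^sup>2) ^ 2 * u y) - 5 * (cutoff (R\<^sup>2) ((norm (x - y))\<^sup>2) ^ 3 * u y))"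
      using that by (intro Bochner_Integration.integrable_diff integrable_mult_right integrable_cutoff_power cu) auto
    then show ?thesis by (simp add: W_def algebra_simps)
  qed
  have rep: "4 * pi\<^sup>2 * laplacian u x + E R x = 1920 / R ^ 6 * \<Phi> R x" if "R > 0" for R x
    using laplacian_biharmonic_representation[OF u, of "R\<^sup>2" x] that
    unfolding integral_mult_right_zero by (simp add: E_def \<Phi>_def W_def h_def flip: power_mult)
  have limE: "(\<lambda>n. E (real (Suc n)) x) \<longlonglongrightarrow> (\<integral>y. h y / (norm (x - y))\<^sup>2 \<partial>lborel)" for x
    unfolding E_def
  proof (rule integral_dominated_convergence)
    show "integrable lborel (\<lambda>y. \<bar>h y\<bar> / (norm (x - y))\<^sup>2)"
      by (intro integrable_div_norm_sq continuous_intros ch integrable_abs ih)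
    show "AE y in lborel. (\<lambda>n. cutoff ((real (Suc n))\<^sup>2) ((norm (x - y))\<^sup>2) ^ 6 / (norm (x - y))\<^sup>2 * h y) \<longlonglongrightarrow> h y / (norm (x - y))\<^sup>2"
    proof (rule AE_I2)
      fix y
      have "(\<lambda>n. cutoff ((real (Suc n))\<^sup>2) ((norm (x - y))\<^sup>2) ^ 6 * (h y / (norm (x - y))\<^sup>2)) \<longlonglongrightarrow> 1 ^ 6 * (h y / (norm (x - y))\<^sup>2)"
        by (intro tendsto_intros cutoff_tendsto_1)
      then show "(\<lambda>n. cutoff ((real (Suc n))\<^sup>2) ((norm (x - y))\<^sup>2) ^ 6 / (norm (x - y))\<^sup>2 * h y) \<longlonglongrightarrow> h y / (norm (x - y))\<^sup>2"
        by simp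
    qed
    show "AE y in lborel. norm (cutoff ((real (Suc n))\<^sup>2) ((norm (x - y))\<^sup>2) ^ 6 / (norm (x - y))\<^sup>2 * h y) \<le> \<bar>h y\<bar> / (norm (x - y))\<^sup>2" for n
    proof (rule AE_I2)
      fix y
      have "cutoff ((real (Suc n))\<^sup>2) ((norm (x - y))\<^sup>2) ^ 6 * \<bar>h y\<bar> \<le> 1 * \<bar>h y\<bar>"
        by (intro mult_right_mono power_le_one cutoff_le_1) auto
      then show "norm (cutoff ((real (Suc n))\<^sup>2) ((norm (x - y))\<^sup>2) ^ 6 / (norm (x - y))\<^sup>2 * h y) \<le> \<bar>h y\<bar> / (norm (x - y))\<^sup>2"
        by (simp add: abs_mult divide_right_mono)
    qed
  qed measurable
  \<comment> \<open>The constant is the prefactor 1920, times 105 from the Lipschitz bound, times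
    \<open>64 = 2 ^ 6\<close> because the kernels live in the ball of radius
    \<open>2 * R\<close>.\<close>
  have "\<bar>1920 / R ^ 6 * \<Phi> R x - 1920 / R ^ 6 * \<Phi> R 0\<bar> \<le> (1920 * 105 * 64 * norm x * C) / R" if R: "R \<ge> max 1 (norm x)" for R
  proof -
    have R0: "R > 0" "norm x \<le> R" "2 * R \<ge> 1" using R by auto
    have iB: "integrable lborel (\<lambda>y. indicator (cball 0 (2 * R)) y * \<bar>u y\<bar>)"
      using borel_integrable_compact[of "cball 0 (2 * R)" "\<lambda>y. \<bar>u y\<bar>"] continuous_on_subset[OF cu, of "cball 0 (2 * R)"]
      by (simp add: continuous_on_rabs)
    have "\<Phi> R x - \<Phi> R 0 = (\<integral>y. W R x y * u y - W R 0 y * u y \<partial>lborel)"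
      using iW[OF R0(1)] by (simp add: \<Phi>_def)
    also have "\<bar>\<dots>\<bar> \<le> (\<integral>y. 105 * norm x / R * (indicator (cball 0 (2 * R)) y * \<bar>u y\<bar>) \<partial>lborel)"
    proof (rule abs_integral_le[OF integrable_mult_right[OF iB]], rule AE_I2)
      fix y
      have "\<bar>W R x y - W R 0 y\<bar> * \<bar>u y\<bar> \<le> (105 * norm x / R * indicator (cball 0 (2 * R)) y) * \<bar>u y\<bar>"
        using laplacian_kernel_lipschitz[OF R0(1,2), of y] by (intro mult_right_mono) (simp_all add: W_def)
      then show "\<bar>W R x y * u y - W R 0 y * u y\<bar> \<le> 105 * norm x / R * (indicator (cball 0 (2 * R)) y * \<bar>u y\<bar>)"
        by (simp add: mult.assoc flip: left_diff_distrib abs_mult)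
    qed
    also have "\<dots> = 105 * norm x / R * (\<integral>y. indicator (cball 0 (2 * R)) y * \<bar>u y\<bar> \<partial>lborel)"
      by (simp only: integral_mult_right_zero)
    also have "\<dots> \<le> 105 * norm x / R * (C * (2 * R) ^ 6)"
      using R0 by (intro mult_left_mono C) auto
    finally have "1920 / R ^ 6 * \<bar>\<Phi> R x - \<Phi> R 0\<bar> \<le> 1920 / R ^ 6 * (105 * norm x / R * (C * (2 * R) ^ 6))"
      using R0 by (intro mult_left_mono) auto
    also have "\<dots> = (1920 * 105 * 64 * norm x * C) / R"
      using R0 by (simp add: power_mult_distrib)
    finally show ?thesis
      unfolding right_diff_distrib[symmetric] abs_mult using R0 by simp
  qed
  then have "(\<lambda>n. 1920 / real (Suc n) ^ 6 * \<Phi> (real (Suc n)) x - 1920 / real (Suc n) ^ 6 * \<Phi> (real (Suc n)) 0) \<longlonglongrightarrow> 0"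
    by (rule tendsto_0_sequentially_Suc)
  then have "(\<lambda>n. (4 * pi\<^sup>2 * laplacian u x + E (real (Suc n)) x) - (4 * pi\<^sup>2 * laplacian u 0 + E (real (Suc n)) 0)) \<longlonglongrightarrow> 0"
    by (simp add: rep)
  moreover have "(\<lambda>n. (4 * pi\<^sup>2 * laplacian u x + E (real (Suc n)) x) - (4 * pi\<^sup>2 * laplacian u 0 + E (real (Suc n)) 0)) \<longlonglongrightarrow>
     (4 * pi\<^sup>2 * laplacian u x + (\<integral>y. h y / (norm (x - y))\<^sup>2 \<partial>lborel)) - (4 * pi\<^sup>2 * laplacian u 0 + (\<integral>y. h y / (norm (0 - y))\<^sup>2 \<partial>lborel))"
    by (intro tendsto_intros limE)
  ultimately show ?thesis
    using LIMSEQ_unique unfolding h_def by fastforce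
qed

text \<open>Subtracting \<open>u 0\<close> is forced: the truncated logarithmic potentials converge
  only as differences. The approximating quadratics are \<open>A R / R ^ 4\<close>, the second-order
  expansion of the integral of \<open>u\<close> against the rescaled kernel, minus its value at
  0.\<close>

lemma biharmonic_minus_potential_quadratic:
  assumes u: "Ck 4 u" and f: "integrable lborel (laplacian (laplacian u))"
    and e: "integrable lborel (\<lambda>y. exp (4 * u y))"
  shows "poly_deg_le2 (\<lambda>x. 4 * pi\<^sup>2 * (u x - u 0) -
    (\<integral>y. (ln ((norm y)\<^sup>2) - ln ((norm (x - y))\<^sup>2)) * laplacian (laplacian u) y \<partial>lborel) / 4)"
proof -
  define h where "h = laplacian (laplacian u)"
  have cu: "continuous_on UNIV u" by (rule Ck_continuous[OF u])
  have ch: "continuous_on UNIV h" unfolding h_def by (rule Ck_2_laplacian_continuous[OF Ck_4_laplacian[OF u]])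
  have [measurable]: "u \<in> borel_measurable borel" "h \<in> borel_measurable borel"
    using cu ch by (auto intro: borel_measurable_continuous_onI)
  have ih: "integrable lborel h" using f by (simp add: h_def)
  obtain C where C: "C \<ge> 0" "\<And>R. R \<ge> 1 \<Longrightarrow> (\<integral>y. indicator (cball 0 R) y * \<bar>u y\<bar> \<partial>lborel) \<le> C * R ^ 6"
    using integral_ball_growth[OF u f e] by blast
  define W where "W R x y = 840 * cutoff (R\<^sup>2) ((norm (x - y))\<^sup>2) ^ 4 - 480 * cutoff (R\<^sup>2) ((norm (x - y))\<^sup>2) ^ 3"
    for R and x y :: "real^4"
  define \<Phi> where "\<Phi> R x = (\<integral>y. W R x y * u y \<partial>lborel)" for R x
  define K where "K R x = (\<integral>y. log_kernel 6 (R\<^sup>2) ((norm (x - y))\<^sup>2) * h y \<partial>lborel)" for R x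
  define \<alpha> where "\<alpha> R y = (3360 * cutoff (R\<^sup>2) ((norm y)\<^sup>2) ^ 3 - 1440 * cutoff (R\<^sup>2) ((norm y)\<^sup>2) ^ 2) / R\<^sup>2 * u y" for R y
  define \<beta> where "\<beta> R y = 4 * (5040 * cutoff (R\<^sup>2) ((norm y)\<^sup>2) ^ 2 - 1440 * cutoff (R\<^sup>2) ((norm y)\<^sup>2)) / R ^ 4 * u y" for R y
  define A where "A R x = (\<integral>y. \<alpha> R y * (2 * (x \<bullet> y) - x \<bullet> x) + \<beta> R y * (x \<bullet> y)\<^sup>2 \<partial>lborel)" for R x
  have c: "continuous_on UNIV (\<alpha> R)" "continuous_on UNIV (\<beta> R)" if "R > 0" for R
    unfolding \<alpha>_def[abs_def] \<beta>_def[abs_def] using that by (auto intro!: continuous_intros cu)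
  have s: "\<alpha> R y = 0" "\<beta> R y = 0" if "R > 0" "norm y > R" for R y
  proof -
    have "cutoff (R\<^sup>2) ((norm y)\<^sup>2) = 0" using that by (intro cutoff_eq_0 power_mono) auto
    then show "\<alpha> R y = 0" "\<beta> R y = 0" by (simp_all add: \<alpha>_def \<beta>_def)
  qed
  have pA: "poly_deg_le2 (A R)" if "R > 0" for R
    unfolding A_def[abs_def] using that by (intro integral_quadratic[of _ R] c s)
  have iA: "integrable lborel (\<lambda>y. \<alpha> R y * (2 * (x \<bullet> y) - x \<bullet> x) + \<beta> R y * (x \<bullet> y)\<^sup>2)" if "R > 0" for R x
    using that by (intro integrable_compact_support[of _ R 0] continuous_intros c) (auto simp: s)
  have iW: "integrable lborel (\<lambda>y. W R x y * u y)" if "R > 0" for R x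
  proof -
    have "integrable lborel (\<lambda>y. 840 * (cutoff (R\<^sup>2) ((norm (x - y))\<^sup>2) ^ 4 * u y) - 480 * (cutoff (R\<^sup>2) ((norm (x - y))\<^sup>2) ^ 3 * u y))"
      using that by (intro Bochner_Integration.integrable_diff integrable_mult_right integrable_cutoff_power cu) auto
    then show ?thesis by (simp add: W_def algebra_simps)
  qed
  have rep: "4 * pi\<^sup>2 * u x - K R x / 4 = 1 / R ^ 4 * \<Phi> R x" if "R > 0" for R x
  proof -
    have "(\<integral>y. W R x y / (R\<^sup>2)\<^sup>2 * u y \<partial>lborel) = 1 / R ^ 4 * \<Phi> R x"
      unfolding \<Phi>_def integral_mult_right_zero[symmetric] by (simp flip: power_mult)
    then show ?thesis
      using biharmonic_representation[OF u, of "R\<^sup>2" x] that by (simp add: K_def W_def h_def)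
  qed
  have iK: "integrable lborel (\<lambda>y. log_kernel 6 (R\<^sup>2) ((norm (x - y))\<^sup>2) * h y)" if "R > 0" for R x
    using that by (intro singular_kernel_integrable[of "log_kernel 6 (R\<^sup>2)" "R\<^sup>2" "R\<^sup>2"] ch)
      (auto simp: log_kernel_eq_0 log_kernel_bound)
  have limK: "(\<lambda>n. K (real (Suc n)) x - K (real (Suc n)) 0) \<longlonglongrightarrow>
      (\<integral>y. (ln ((norm y)\<^sup>2) - ln ((norm (x - y))\<^sup>2)) * h y \<partial>lborel)" for x
  proof -
    have eq: "K (real (Suc n)) x - K (real (Suc n)) 0 =
        (\<integral>y. (log_kernel 6 ((real (Suc n))\<^sup>2) ((norm (x - y))\<^sup>2) - log_kernel 6 ((real (Suc n))\<^sup>2) ((norm y)\<^sup>2)) * h y \<partial>lborel)" for n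
      using iK[of "real (Suc n)" x] iK[of "real (Suc n)" 0] by (simp add: K_def left_diff_distrib)
    show ?thesis
      unfolding eq
    proof (rule integral_dominated_convergence)
      show "integrable lborel (\<lambda>y. \<bar>ln ((norm (x - y))\<^sup>2) - ln ((norm y)\<^sup>2)\<bar> * \<bar>h y\<bar>)"
        by (rule log_kernel_integrable[OF ch ih])
      show "AE y in lborel. (\<lambda>n. (log_kernel 6 ((real (Suc n))\<^sup>2) ((norm (x - y))\<^sup>2) - log_kernel 6 ((real (Suc n))\<^sup>2) ((norm y)\<^sup>2)) * h y)
          \<longlonglongrightarrow> (ln ((norm y)\<^sup>2) - ln ((norm (x - y))\<^sup>2)) * h y"
        using AE_lborel_singleton[of x] AE_lborel_singleton[of 0]
        by eventually_elim (intro tendsto_mult tendsto_const log_kernel_diff_tendsto; simp)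
      show "AE y in lborel. norm ((log_kernel 6 ((real (Suc n))\<^sup>2) ((norm (x - y))\<^sup>2) - log_kernel 6 ((real (Suc n))\<^sup>2) ((norm y)\<^sup>2)) * h y)
          \<le> \<bar>ln ((norm (x - y))\<^sup>2) - ln ((norm y)\<^sup>2)\<bar> * \<bar>h y\<bar>" for n
        using AE_lborel_singleton[of x] AE_lborel_singleton[of 0]
      proof eventually_elim
        case (elim y)
        show ?case
          unfolding real_norm_def abs_mult using elim by (intro mult_right_mono log_kernel_diff_bound) auto
      qed
    qed measurable
  qed
  have err: "(\<lambda>n. (1 / real (Suc n) ^ 4 * \<Phi> (real (Suc n)) x - 1 / real (Suc n) ^ 4 * \<Phi> (real (Suc n)) 0)
       - 1 / real (Suc n) ^ 4 * A (real (Suc n)) x) \<longlonglongrightarrow> 0" for x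
  proof (rule tendsto_0_sequentially_Suc)
    fix R assume R: "R \<ge> max 1 (5 * norm x)"
    have R0: "R > 0" "5 * norm x \<le> R" "2 * R \<ge> 1" using R by auto
    have iB: "integrable lborel (\<lambda>y. indicator (cball 0 (2 * R)) y * \<bar>u y\<bar>)"
      using borel_integrable_compact[of "cball 0 (2 * R)" "\<lambda>y. \<bar>u y\<bar>"] continuous_on_subset[OF cu, of "cball 0 (2 * R)"]
      by (simp add: continuous_on_rabs)
    have eq: "\<Phi> R x - \<Phi> R 0 - A R x = (\<integral>y. W R x y * u y - W R 0 y * u y - (\<alpha> R y * (2 * (x \<bullet> y) - x \<bullet> x) + \<beta> R y * (x \<bullet> y)\<^sup>2) \<partial>lborel)"
      unfolding \<Phi>_def A_def
      using iW[OF R0(1), of x] iW[OF R0(1), of 0] iA[OF R0(1), of x] by simp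
    have "\<bar>\<Phi> R x - \<Phi> R 0 - A R x\<bar> \<le> (\<integral>y. 1000000 * (norm x / R) ^ 3 * (indicator (cball 0 (2 * R)) y * \<bar>u y\<bar>) \<partial>lborel)"
      unfolding eq
    proof (rule abs_integral_le[OF integrable_mult_right[OF iB]], rule AE_I2)
      fix y
      let ?T = "(3360 * cutoff (R\<^sup>2) ((norm y)\<^sup>2) ^ 3 - 1440 * cutoff (R\<^sup>2) ((norm y)\<^sup>2) ^ 2) / R\<^sup>2 * (2 * (x \<bullet> y) - x \<bullet> x) +
         4 * (5040 * cutoff (R\<^sup>2) ((norm y)\<^sup>2) ^ 2 - 1440 * cutoff (R\<^sup>2) ((norm y)\<^sup>2)) / R ^ 4 * (x \<bullet> y)\<^sup>2"
      have "\<bar>W R x y - W R 0 y - ?T\<bar> * \<bar>u y\<bar> \<le> (1000000 * (norm x / R) ^ 3 * indicator (cball 0 (2 * R)) y) * \<bar>u y\<bar>"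
        using kernel_taylor[OF R0(1,2), of y] by (intro mult_right_mono) (simp_all add: W_def)
      moreover have "W R x y * u y - W R 0 y * u y - (\<alpha> R y * (2 * (x \<bullet> y) - x \<bullet> x) + \<beta> R y * (x \<bullet> y)\<^sup>2) = (W R x y - W R 0 y - ?T) * u y"
      proof -
        have "w * v - w' * v - (a * v * P + b * v * Q) = (w - w' - (a * P + b * Q)) * v" for w w' a b P Q v :: real
          by (simp add: algebra_simps)
        then show ?thesis unfolding \<alpha>_def \<beta>_def .
      qed
      ultimately show "\<bar>W R x y * u y - W R 0 y * u y - (\<alpha> R y * (2 * (x \<bullet> y) - x \<bullet> x) + \<beta> R y * (x \<bullet> y)\<^sup>2)\<bar> \<le>
          1000000 * (norm x / R) ^ 3 * (indicator (cball 0 (2 * R)) y * \<bar>u y\<bar>)"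
        by (simp only: abs_mult mult.assoc)
    qed
    also have "\<dots> = 1000000 * (norm x / R) ^ 3 * (\<integral>y. indicator (cball 0 (2 * R)) y * \<bar>u y\<bar> \<partial>lborel)"
      by (simp only: integral_mult_right_zero)
    also have "\<dots> \<le> 1000000 * (norm x / R) ^ 3 * (C * (2 * R) ^ 6)"
      using R0 by (intro mult_left_mono C) auto
    finally have "1 / R ^ 4 * \<bar>\<Phi> R x - \<Phi> R 0 - A R x\<bar> \<le> 1 / R ^ 4 * (1000000 * (norm x / R) ^ 3 * (C * (2 * R) ^ 6))"
      using R0 by (intro mult_left_mono) auto
    also have "\<dots> = (64000000 * norm x ^ 3 * C) / R"
    proof -
      have "R ^ 6 / (R ^ 4 * R ^ 3) = 1 / R"
        using R0 by (simp add: field_simps eval_nat_numeral)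
      moreover have "1 / R ^ 4 * (1000000 * (norm x / R) ^ 3 * (C * (2 * R) ^ 6)) =
          64000000 * norm x ^ 3 * C * (R ^ 6 / (R ^ 4 * R ^ 3))"
        by (simp add: power_mult_distrib power_divide)
      ultimately show ?thesis by simp
    qed
    finally show "\<bar>(1 / R ^ 4 * \<Phi> R x - 1 / R ^ 4 * \<Phi> R 0) - 1 / R ^ 4 * A R x\<bar> \<le> (64000000 * norm x ^ 3 * C) / R"
      unfolding right_diff_distrib[symmetric] abs_mult using R0 by simp
  qed
  show ?thesis
    unfolding h_def[symmetric]
  proof (rule poly_deg_le2_tendsto)
    show "poly_deg_le2 (\<lambda>x. 0 + 1 / real (Suc n) ^ 4 * A (real (Suc n)) x)" for n
      by (intro poly_deg_le2_affine pA) simp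
    fix x
    have lim: "(\<lambda>n. 4 * pi\<^sup>2 * (u x - u 0) - (K (real (Suc n)) x - K (real (Suc n)) 0) / 4 -
        ((1 / real (Suc n) ^ 4 * \<Phi> (real (Suc n)) x - 1 / real (Suc n) ^ 4 * \<Phi> (real (Suc n)) 0)
       - 1 / real (Suc n) ^ 4 * A (real (Suc n)) x)) \<longlonglongrightarrow>
       4 * pi\<^sup>2 * (u x - u 0) - (\<integral>y. (ln ((norm y)\<^sup>2) - ln ((norm (x - y))\<^sup>2)) * h y \<partial>lborel) / 4 - 0"
      by (intro tendsto_intros limK err) simp
    \<comment> \<open>By \<open>rep\<close> each approximating quadratic equals a combination whose
      limit is already known. Their pointwise convergence is thus a consequence, and no bound on
      their coefficients enters.\<close>
    have "4 * pi\<^sup>2 * (u x - u 0) - (K R x - K R 0) / 4 -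
        ((1 / R ^ 4 * \<Phi> R x - 1 / R ^ 4 * \<Phi> R 0) - 1 / R ^ 4 * A R x) = 0 + 1 / R ^ 4 * A R x" if "R > 0" for R
      using rep[OF that, of x] rep[OF that, of 0] by (simp add: algebra_simps diff_divide_distrib)
    from this[of "real (Suc _)"]
    show "(\<lambda>n. 0 + 1 / real (Suc n) ^ 4 * A (real (Suc n)) x) \<longlonglongrightarrow>
       4 * pi\<^sup>2 * (u x - u 0) - (\<integral>y. (ln ((norm y)\<^sup>2) - ln ((norm (x - y))\<^sup>2)) * h y \<partial>lborel) / 4"
      using lim by (simp only: of_nat_0_less_iff zero_less_Suc diff_zero)
  qed
qed

theorem theorem4p1:
  fixes p :: real and u :: "real^4 \<Rightarrow> real"
  assumes "p > 0"
    and "Ck 4 u"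
    and "\<forall>x. laplacian (laplacian u) x = (1 - norm x powr p) * exp (4 * u x)"
    and "integrable lborel (\<lambda>y. (1 - norm y powr p) * exp (4 * u y))"
  shows "\<exists>P. poly_deg_le2 P \<and>
           (\<forall>x. u x = (1 / (8 * pi\<^sup>2)) *
              (\<integral>y. ln (norm y / norm (x - y)) * ((1 - norm y powr p) * exp (4 * u y)) \<partial>lborel)
              + P x)
         \<and> (\<exists>C. \<forall>x. laplacian u x = - (1 / (4 * pi\<^sup>2)) *
              (\<integral>y. (1 / (norm (x - y))\<^sup>2) * ((1 - norm y powr p) * exp (4 * u y)) \<partial>lborel) + C)"
proof -
  note u = assms(2)
  define h where "h y = (1 - norm y powr p) * exp (4 * u y)" for y
  have h: "laplacian (laplacian u) = h" using assms(3) by (auto simp: h_def)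
  have [measurable]: "u \<in> borel_measurable borel"
    using Ck_continuous[OF u] by (rule borel_measurable_continuous_onI)
  have [measurable]: "h \<in> borel_measurable borel" unfolding h_def[abs_def] by measurable
  have int: "integrable lborel (laplacian (laplacian u))"
    unfolding h using assms(4) by (simp add: h_def[abs_def])
  have e: "integrable lborel (\<lambda>y. exp (4 * u y))"
    by (rule integrable_exp[OF assms(1) Ck_continuous[OF u] assms(4)])
  define V where "V x = (\<integral>y. ln (norm y / norm (x - y)) * h y \<partial>lborel)" for x
  \<comment> \<open>Squares inside the logarithms double the potential. The points
    \<open>y = 0\<close> and \<open>y = x\<close>, where default values of division and
    \<open>ln\<close> occur, form a null set.\<close>
  have V: "(\<integral>y. (ln ((norm y)\<^sup>2) - ln ((norm (x - y))\<^sup>2)) * h y \<partial>lborel) = 2 * V x" for x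
    unfolding V_def integral_mult_right_zero[symmetric]
  proof (rule integral_cong_AE)
    show "AE y in lborel. (ln ((norm y)\<^sup>2) - ln ((norm (x - y))\<^sup>2)) * h y = 2 * (ln (norm y / norm (x - y)) * h y)"
      using AE_lborel_singleton[of x] AE_lborel_singleton[of 0]
      by eventually_elim (simp add: ln_div ln_realpow algebra_simps)
  qed measurable
  define P where "P x = u x - 1 / (8 * pi\<^sup>2) * V x" for x
  \<comment> \<open>The factor \<open>2 / 4\<close> divided by \<open>4 * pi ^ 2\<close> is the
    required \<open>1 / (8 * pi ^ 2)\<close>; adding \<open>u 0\<close> undoes the normalisation at
    the origin.\<close>
  have "poly_deg_le2 (\<lambda>x. u 0 + 1 / (4 * pi\<^sup>2) * (4 * pi\<^sup>2 * (u x - u 0) - 2 * V x / 4))"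
    using poly_deg_le2_affine[OF biharmonic_minus_potential_quadratic[OF u int e]] unfolding h V .
  moreover have "u 0 + 1 / (4 * pi\<^sup>2) * (4 * pi\<^sup>2 * (u x - u 0) - 2 * V x / 4) = P x" for x
    by (simp add: P_def right_diff_distrib)
  ultimately have "poly_deg_le2 P" by simp
  moreover have "\<forall>x. u x = 1 / (8 * pi\<^sup>2) * V x + P x" by (simp add: P_def)
  moreover have "\<exists>C. \<forall>x. laplacian u x = - (1 / (4 * pi\<^sup>2)) * (\<integral>y. (1 / (norm (x - y))\<^sup>2) * h y \<partial>lborel) + C"
  proof (intro exI allI)
    fix x
    \<comment> \<open>The constant is found by evaluating the formula at the origin.\<close>
    show "laplacian u x = - (1 / (4 * pi\<^sup>2)) * (\<integral>y. (1 / (norm (x - y))\<^sup>2) * h y \<partial>lborel)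
        + (laplacian u 0 + 1 / (4 * pi\<^sup>2) * (\<integral>y. h y / (norm (0 - y))\<^sup>2 \<partial>lborel))"
    proof -
      have "L = - (1 / a) * I + (L0 + 1 / a * I0)" if "a * L + I = a * L0 + I0" "a \<noteq> 0" for a L I L0 I0 :: real
      proof -
        have "L = (a * L0 + I0 - I) / a" using that by (simp add: field_simps)
        then show ?thesis using that by (simp add: add_divide_distrib diff_divide_distrib)
      qed
      from this[OF laplacian_minus_potential_constant[OF u int e, of x]] show ?thesis
        by (simp add: h)
    qed
  qed
  ultimately show ?thesis unfolding V_def h_def by blast
qed

end
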